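(* Let $a\in\mathbb{C}\setminus\{0\}$ and let $(c_k)_{k\ge 1}$ be a sequence of independent standard complex Gaussian random variables. For each $N\ge 1$ let $M=M_N=VDV^*$, where $V$ is an $N\times N$ Haar-distributed unitary matrix and $D=\mathrm{diag}(Z_1,\dots,Z_N)$ is independent of $V$, with $Z_1,\dots,Z_N$ i.i.d. random variables on the unit circle (whose common law may depend on $N$). Assume that almost surely $D$ has simple spectrum, and that for every integer $b$, $\sup_{k\ge 1}|\mathbb{E}[Z_1^k]|=o(N^{-b})$ as $N\to\infty$. Let $v=v_N\in\mathbb{C}^N$ be a unit vector which is either deterministic, or random, independent of $M$ and distributed with a non-vanishing density on the unit sphere of $\mathbb{C}^N$, and let $A=A_N=I_N-(1-aN^{-1/2})vv^*$. Let $$\phi_{a'}(z)=a'-\sum_{k\ge1}c_kz^k,\qquad z\in\mathbb{D},\qquad a'=\frac{a}{\sqrt2}.$$ Then, as $N\to\infty$, the point process on $\mathbb{D}$ formed by the eigenvalues of $MA$ converges vaguely to the point process on $\mathbb{D}$ formed by the zeros of $\phi_{a'}$: $$\sum_{\lambda\in \mathrm{Sp}(MA)}\delta_\lambda\ \xrightarrow[N\to\infty]{v}\ \sum_{w\in\mathcal{Z}_{\phi_{a'}}}\delta_w .$$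
   Context: $\mathbb{D}$ is the open unit disk of $\mathbb{C}$. A standard complex Gaussian variable $c$ is centered and rotationally invariant with $\mathbb{E}|c|^2=1$ (so $|c|^2$ is exponential of parameter 1); the series $\phi_{a'}$ almost surely defines an analytic function on $\mathbb{D}$. The density of a random $v$ is with respect to the uniform measure on the unit sphere. $\mathrm{Sp}$ denotes the spectrum, $\mathcal{Z}_f$ the zero set in $\mathbb{D}$ of an analytic function $f$; eigenvalues and zeros are repeated with multiplicity. The measures are viewed as measures on $\mathbb{D}$, i.e. only points in $\mathbb{D}$ are counted. A point process on $\mathbb{D}$ is a random integer-valued Radon measure on $\mathbb{D}$. Point processes $\mu_N$ converge vaguely to $\mu$ (written $\mu_N\xrightarrow{v}\mu$) if for every continuous compactly supported function $\varphi$ on $\mathbb{D}$, $\int\varphi\,d\mu_N$ converges in distribution to $\int\varphi\,d\mu$. *)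

theory Defs
  imports
    "HOL-Probability.Probability"
    "HOL-Complex_Analysis.Complex_Analysis"
    "Jordan_Normal_Form.Schur_Decomposition"
    "Jordan_Normal_Form.Spectral_Radius"
begin

unbundle no vec_syntax
no_notation fps_nth (infixl \<open>$\<close> 75)

subsection \<open>Borel structures on vectors and matrices\<close>

definition mat_borel :: "nat \<Rightarrow> complex mat measure" where
  "mat_borel N = vimage_algebra (carrier_mat N N)
     (\<lambda>A. \<lambda>(i, j)\<in>{..<N} \<times> {..<N}. A $$ (i, j))
     (PiM ({..<N} \<times> {..<N}) (\<lambda>_. borel))"

definition vec_borel :: "nat \<Rightarrow> complex vec measure" where
  "vec_borel N = vimage_algebra (carrier_vec N)
     (\<lambda>x. \<lambda>i\<in>{..<N}. x $ i) (PiM {..<N} (\<lambda>_. borel))"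

subsection \<open>Haar measure on the unitary group\<close>

definition unitary_group :: "nat \<Rightarrow> complex mat set" where
  "unitary_group N =
     {U \<in> carrier_mat N N. U * mat_adjoint U = 1\<^sub>m N \<and> mat_adjoint U * U = 1\<^sub>m N}"

definition unitary_borel :: "nat \<Rightarrow> complex mat measure" where
  "unitary_borel N = restrict_space (mat_borel N) (unitary_group N)"

definition haar_unitary :: "nat \<Rightarrow> complex mat measure \<Rightarrow> bool" where
  "haar_unitary N \<mu> \<longleftrightarrow> prob_space \<mu> \<and> sets \<mu> = sets (unitary_borel N) \<and>
     (\<forall>U\<in>unitary_group N.
        distr \<mu> (unitary_borel N) (\<lambda>X. U * X) = \<mu> \<and>
        distr \<mu> (unitary_borel N) (\<lambda>X. X * U) = \<mu>)"

subsection \<open>The unit sphere and its uniform measure\<close>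

definition cvec_norm :: "complex vec \<Rightarrow> real" where
  "cvec_norm x = L2_set (\<lambda>i. cmod (x $ i)) {..<dim_vec x}"

definition unit_sphere :: "nat \<Rightarrow> complex vec set" where
  "unit_sphere N = {x \<in> carrier_vec N. cvec_norm x = 1}"

definition sphere_borel :: "nat \<Rightarrow> complex vec measure" where
  "sphere_borel N = restrict_space (vec_borel N) (unit_sphere N)"

text \<open>
  The uniform (rotation invariant) probability measure on the sphere, as the image of the
  normalised Lebesgue measure of the unit ball under radial projection. The origin, which is
  Lebesgue-null, is sent to itself and removed by the restriction. Meant for \<open>N \<ge> 1\<close>.
\<close>

definition uniform_sphere :: "nat \<Rightarrow> complex vec measure" where
  "uniform_sphere N = restrict_space
     (distr
        (uniform_measure (PiM {..<N} (\<lambda>_. lborel))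
           {x \<in> space (PiM {..<N} (\<lambda>_. lborel :: complex measure)). cvec_norm (vec N x) \<le> 1})
        (vec_borel N)
        (\<lambda>x. complex_of_real (1 / cvec_norm (vec N x)) \<cdot>\<^sub>v vec N x))
     (unit_sphere N)"

subsection \<open>Matrices\<close>

text \<open>The rank one matrix \<open>v v\<^sup>*\<close>.\<close>

definition outer_self :: "complex vec \<Rightarrow> complex mat" where
  "outer_self v = mat (dim_vec v) (dim_vec v) (\<lambda>(i, j). v $ i * cnj (v $ j))"

definition simple_spectrum :: "complex mat \<Rightarrow> bool" where
  "simple_spectrum A \<longleftrightarrow> (\<forall>w\<in>spectrum A. Polynomial.order w (char_poly A) = 1)"

subsection \<open>Random variables\<close>

text \<open>
  Independence of two random variables with possibly different value types; the library's
  \<open>indep_var\<close> requires equal types.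
\<close>

definition indep_rv ::
  "'a measure \<Rightarrow> 'b measure \<Rightarrow> ('a \<Rightarrow> 'b) \<Rightarrow> 'c measure \<Rightarrow> ('a \<Rightarrow> 'c) \<Rightarrow> bool" where
  "indep_rv P S X T Y \<longleftrightarrow> X \<in> measurable P S \<and> Y \<in> measurable P T \<and>
     prob_space.indep_set P
       {X -` A \<inter> space P |A. A \<in> sets S} {Y -` B \<inter> space P |B. B \<in> sets T}"

text \<open>Standard complex Gaussian: centered, rotation invariant, with second absolute moment 1.\<close>

definition std_complex_gaussian :: "'a measure \<Rightarrow> ('a \<Rightarrow> complex) \<Rightarrow> bool" where
  "std_complex_gaussian P X \<longleftrightarrow>
     distributed P lborel X (\<lambda>z. ennreal (exp (- (cmod z)\<^sup>2) / pi))"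

definition conv_in_distribution ::
  "(nat \<Rightarrow> 'a measure) \<Rightarrow> (nat \<Rightarrow> 'a \<Rightarrow> real) \<Rightarrow> 'b measure \<Rightarrow> ('b \<Rightarrow> real) \<Rightarrow> bool" where
  "conv_in_distribution P X Q Y \<longleftrightarrow>
     (\<forall>N\<ge>1. X N \<in> borel_measurable (P N)) \<and> Y \<in> borel_measurable Q \<and>
     weak_conv_m (\<lambda>N. distr (P N) borel (X N)) (distr Q borel Y)"

subsection \<open>Point processes on the unit disk\<close>

text \<open>The Borel measure on the open unit disk giving mass \<open>m w\<close> to each point \<open>w\<close>.\<close>

definition disk_point_measure :: "(complex \<Rightarrow> nat) \<Rightarrow> complex measure" where
  "disk_point_measure m =
     distr (point_measure (ball 0 1) (\<lambda>w. of_nat (m w))) (restrict_space borel (ball 0 1)) (\<lambda>w. w)"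

definition eigenvalue_measure :: "complex mat \<Rightarrow> complex measure" where
  "eigenvalue_measure A = disk_point_measure
     (\<lambda>w. if w \<in> spectrum A then Polynomial.order w (char_poly A) else 0)"

text \<open>
  The zero set is only meant for functions analytic on the disk (and not identically zero);
  on any other function the measure is set to zero. For a random power series that is analytic
  almost surely, this fixes the value on the exceptional null event.
\<close>

definition zero_measure :: "(complex \<Rightarrow> complex) \<Rightarrow> complex measure" where
  "zero_measure f = disk_point_measure
     (\<lambda>w. if f holomorphic_on ball 0 1 \<and> f w = 0 then nat (zorder f w) else 0)"

definition vague_conv_disk ::
  "(nat \<Rightarrow> 'a measure) \<Rightarrow> (nat \<Rightarrow> 'a \<Rightarrow> complex measure) \<Rightarrow>
   'b measure \<Rightarrow> ('b \<Rightarrow> complex measure) \<Rightarrow> bool" where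
  "vague_conv_disk P \<mu> Q \<nu> \<longleftrightarrow>
     (\<forall>g :: complex \<Rightarrow> real.
        continuous_on (ball 0 1) g \<longrightarrow>
        (\<exists>K. compact K \<and> K \<subseteq> ball 0 1 \<and> (\<forall>z\<in>ball 0 1 - K. g z = 0)) \<longrightarrow>
        conv_in_distribution P (\<lambda>N \<omega>. \<integral>z. g z \<partial>\<mu> N \<omega>) Q (\<lambda>\<omega>. \<integral>z. g z \<partial>\<nu> \<omega>))"

end

theory Submission
  imports Defs "HOL-Real_Asymp.Real_Asymp"
begin

text \<open>
  Write \<open>u = V\<^sup>* v\<close>, \<open>w\<^sub>j = \<bar>u\<^sub>j\<bar>\<^sup>2\<close> and \<open>t = a / \<surd>N\<close>. By the matrix determinant lemma, inside the unit disk the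
  characteristic polynomial of \<open>M A\<close> is a zero free factor times \<open>a' - \<Sum>\<^sub>k x\<^sub>k z\<^sup>k\<close>, where
  \<open>x\<^sub>k = (1 - t) \<surd>(N/2) \<Sum>\<^sub>j w\<^sub>j Z\<^sub>j\<^bsup>-k\<^esup>\<close>. Conditionally on \<open>w\<close> these coefficients are weighted sums of independent
  variables, and \<open>N \<Sum>\<^sub>j w\<^sub>j\<^sup>2 \<rightarrow> 2\<close> with vanishing higher moments, because unitary invariance
  determines the moments of the \<open>w\<^sub>j\<close>; so the joint characteristic functions of the \<open>x\<^sub>k\<close>
  converge to those of independent standard complex Gaussians, while \<open>E \<bar>x\<^sub>k\<bar>\<^sup>2\<close> stays bounded uniformly in
  \<open>k\<close>. By the theorem of Rouche, a sum of a test function over the zeros is a continuous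
  function of the coefficients on each set \<open>{x. \<forall>k. \<bar>x\<^sub>k\<bar> \<rho>\<^sup>k \<le> C}\<close>, on which product convergence is locally uniform
  convergence of the power series. A Stone-Weierstrass argument with trigonometric polynomials
  then turns convergence of characteristic functions into convergence of the law of such sums.
  A random \<open>v\<close> is reduced to deterministic vectors by independence.
\<close>

subsection \<open>Convergence of functionals of random sequences\<close>

text \<open>The \<open>sqrt 2\<close> comes from the Haar vector: E |u_j|^4 = 2 / (N (N + 1)), so
  \<open>sqrt N\<close> times the weighted sum of the Z_j^-k has variance close to 2; dividing by
  \<open>sqrt 2\<close> normalises it and turns the constant term a into a'. Three obstacles shape
  the argument. The zeros depend on all coefficients at once, while characteristic functions see
  finitely many of them. The weighted cubes are compact in the product topology, and second moments
  bounded uniformly in k put the whole sequence into one cube up to small probability, because the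
  weights rho^k decay geometrically. Next, the sum over zeros is badly behaved at the zero series;
  the deterministic nonzero constant term keeps both the perturbed model and its limit away from
  that point. Finally, that sum is unbounded, so convergence in distribution is tested through
  continuous step functions of it. The conditional characteristic functions are expanded by hand,
  with errors explicit in N, because the weights are dependent and the law of the Z_j may change
  with N.\<close>

inductive_set trig_span :: "((nat \<Rightarrow> complex) \<Rightarrow> complex) set" where
  trig_span_exp: "(\<lambda>x. exp (\<i> * complex_of_real (Re (\<Sum>k<K. \<alpha> k * x k)))) \<in> trig_span"
| trig_span_add: "p \<in> trig_span \<Longrightarrow> q \<in> trig_span \<Longrightarrow> (\<lambda>x. p x + q x) \<in> trig_span"
| trig_span_scale: "p \<in> trig_span \<Longrightarrow> (\<lambda>x. c * p x) \<in> trig_span"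

lemma trig_span_exp_mult:
  "(\<lambda>x. exp (\<i> * complex_of_real (Re (\<Sum>k<K. \<alpha> k * x k))) *
        exp (\<i> * complex_of_real (Re (\<Sum>k<L. \<beta> k * x k)))) \<in> trig_span"
proof -
  \<comment> \<open>Both coefficient families are padded with zeros to the common length
    \<open>max K L\<close>, so that the two exponents add coordinate by coordinate.\<close>
  let ?\<gamma> = "\<lambda>k. (if k < K then \<alpha> k else 0) + (if k < L then \<beta> k else 0)"
  have pad: "(\<Sum>k<max K L. (if k < n then f k else 0) * x k) = (\<Sum>k<n. f k * x k)"
    if "n \<le> max K L" for n and f x :: "nat \<Rightarrow> complex"
    using that by (intro sum.mono_neutral_cong_right) auto
  have "(\<Sum>k<max K L. ?\<gamma> k * x k) = (\<Sum>k<K. \<alpha> k * x k) + (\<Sum>k<L. \<beta> k * x k)"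
    for x
    by (simp only: distrib_right sum.distrib) (simp only: pad max.cobounded1 max.cobounded2)
  then have "exp (\<i> * complex_of_real (Re (\<Sum>k<K. \<alpha> k * x k))) *
        exp (\<i> * complex_of_real (Re (\<Sum>k<L. \<beta> k * x k))) =
        exp (\<i> * complex_of_real (Re (\<Sum>k<max K L. ?\<gamma> k * x k)))" for x
    by (simp add: exp_add[symmetric] distrib_left)
  then show ?thesis
    using trig_span_exp[of ?\<gamma> "max K L"] by presburger
qed

text \<open>Closure under products is what keeps polynomials in sines inside the span, as
  Stone-Weierstrass requires.\<close>

lemma trig_span_mult:
  assumes "p \<in> trig_span" "q \<in> trig_span"
  shows "(\<lambda>x. p x * q x) \<in> trig_span"
  using assms(1)
proof induction
  case (trig_span_exp \<alpha> K)
  show ?case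
    using assms(2)
  proof induction
    case (trig_span_exp \<beta> L)
    then show ?case by (rule trig_span_exp_mult)
  next
    case (trig_span_add p q)
    then show ?case by (simp add: distrib_left trig_span.trig_span_add)
  next
    case (trig_span_scale p c)
    then show ?case using trig_span.trig_span_scale[of _ c] by (simp add: mult.left_commute)
  qed
next
  case (trig_span_add p q)
  then show ?case by (simp add: distrib_right trig_span.trig_span_add)
next
  case (trig_span_scale p c)
  then show ?case using trig_span.trig_span_scale[of _ c] by (simp add: mult.assoc)
qed

lemma trig_span_const: "(\<lambda>x. c) \<in> trig_span"
  using trig_span_scale[OF trig_span_exp[of "\<lambda>_. 0" 0], of c] by simp

lemma trig_span_sin: "(\<lambda>x. complex_of_real (sin (Re (\<alpha> * x k)))) \<in> trig_span"
proof -
  \<comment> \<open>The sine is a combination of the two characters with frequencies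
    \<open>\<alpha>\<close> and \<open>- \<alpha>\<close> at the single coordinate \<open>k\<close>;
    the other coefficients below \<open>Suc k\<close> are zero.\<close>
  have "complex_of_real (sin (Re (\<alpha> * x k))) =
     (- \<i> / 2) * exp (\<i> * complex_of_real (Re (\<Sum>j<Suc k. (if j = k then \<alpha> else 0) * x j))) +
     (\<i> / 2) * exp (\<i> * complex_of_real (Re (\<Sum>j<Suc k. (if j = k then - \<alpha> else 0) * x j)))" for x
  proof -
    have "(\<Sum>j<Suc k. (if j = k then \<beta> else 0) * x j) = \<beta> * x k" for \<beta> :: complex
      by (simp add: if_distrib[of "\<lambda>u. u * _"] cong: if_cong)
    then show ?thesis
      by (simp only: cis_conv_exp[symmetric]) (use sin_minus[of "Re (\<alpha> * x k)"] cos_minus[of "Re (\<alpha> * x k)"] in \<open>simp add: complex_eq_iff\<close>)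
  qed
  then show ?thesis
    by (simp only:) (intro trig_span_add trig_span_scale trig_span_exp)
qed

text \<open>All three claims are inherited by linear combinations, so a single character is enough.
  Integrability is carried through the induction because the integral of a sum has to be
  split.\<close>

lemma trig_span_integral_tendsto:
  assumes "q \<in> trig_span"
    and "\<And>N. prob_space (P N)" "prob_space Q"
    and mX: "\<And>N k. (\<lambda>\<omega>. X N \<omega> k) \<in> borel_measurable (P N)"
    and mY: "\<And>k. (\<lambda>\<omega>. Y \<omega> k) \<in> borel_measurable Q"
    and char: "\<And>K \<alpha>.
       (\<lambda>N. \<integral>\<omega>. exp (\<i> * complex_of_real (Re (\<Sum>k<K. \<alpha> k * X N \<omega> k))) \<partial>P N)
       \<longlonglongrightarrow> (\<integral>\<omega>. exp (\<i> * complex_of_real (Re (\<Sum>k<K. \<alpha> k * Y \<omega> k))) \<partial>Q)"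
  shows "(\<forall>N. integrable (P N) (\<lambda>\<omega>. q (X N \<omega>))) \<and> integrable Q (\<lambda>\<omega>. q (Y \<omega>)) \<and>
     (\<lambda>N. \<integral>\<omega>. q (X N \<omega>) \<partial>P N) \<longlonglongrightarrow> (\<integral>\<omega>. q (Y \<omega>) \<partial>Q)"
  using assms(1)
proof induction
  case (trig_span_exp \<alpha> K)
  interpret Q: prob_space Q by fact
  have "integrable (P N) (\<lambda>\<omega>. exp (\<i> * complex_of_real (Re (\<Sum>k<K. \<alpha> k * X N \<omega> k))))" for N
  proof -
    interpret prob_space "P N" by fact
    have [measurable]: "\<And>k. (\<lambda>\<omega>. X N \<omega> k) \<in> borel_measurable (P N)" by (rule mX)
    show ?thesis by (rule integrable_const_bound[of _ 1]) auto
  qed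
  moreover have "integrable Q (\<lambda>\<omega>. exp (\<i> * complex_of_real (Re (\<Sum>k<K. \<alpha> k * Y \<omega> k))))"
  proof -
    note mY[measurable]
    show ?thesis by (rule Q.integrable_const_bound[of _ 1]) auto
  qed
  ultimately show ?case using char by blast
next
  case (trig_span_add p q)
  then show ?case by (auto intro: tendsto_add)
next
  case (trig_span_scale p c)
  then show ?case by (auto intro: tendsto_mult)
qed

text \<open>\<open>arcsin \<circ> sin\<close> is a triangle wave that is the identity near 0. So a functional composed with it
  is uniformly close, on the whole space and not only on a compact set, to a polynomial in sines,
  which is a trigonometric polynomial.\<close>

definition clamp_wave :: "(nat \<Rightarrow> real) \<Rightarrow> (nat \<Rightarrow> complex) \<Rightarrow> nat \<Rightarrow> complex" where
  "clamp_wave s x k = Complex (sin (Re (x k) / s k)) (sin (Im (x k) / s k))"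

definition unclamp :: "(nat \<Rightarrow> real) \<Rightarrow> (nat \<Rightarrow> complex) \<Rightarrow> nat \<Rightarrow> complex" where
  "unclamp s y k = of_real (s k) * Complex (arcsin (Re (y k))) (arcsin (Im (y k)))"

text \<open>Tychonoff's theorem, transferred from the abstract product topology to the function
  type.\<close>

lemma compact_coordinatewise:
  fixes S :: "'a::t2_space set"
  assumes "compact S"
  shows "compact {x :: nat \<Rightarrow> 'a. \<forall>k. x k \<in> S}"
proof -
  have "compactin (product_topology (\<lambda>_::nat. euclidean :: 'a topology) UNIV) (PiE UNIV (\<lambda>_. S))"
    using assms by (subst compactin_PiE) auto
  moreover have "PiE UNIV (\<lambda>_. S) = {x :: nat \<Rightarrow> 'a. \<forall>k. x k \<in> S}"
    by (auto simp: PiE_def Pi_def)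
  ultimately show ?thesis
    by (metis compactin_euclidean_iff euclidean_product_topology)
qed

lemma trig_approximation:
  fixes F :: "(nat \<Rightarrow> complex) \<Rightarrow> real"
  assumes "\<And>k. s k > 0" "\<epsilon> > 0"
    and F: "continuous_on {x. \<forall>k. \<bar>Re (x k)\<bar> \<le> s k * (pi/2) \<and> \<bar>Im (x k)\<bar> \<le> s k * (pi/2)} F"
  obtains q where "q \<in> trig_span"
    "\<And>x. cmod (of_real (F (unclamp s (clamp_wave s x))) - q x) < \<epsilon>"
proof -
  let ?B = "cbox (Complex (-1) (-1)) (Complex 1 1)"
  define S where "S = {y :: nat \<Rightarrow> complex. \<forall>k. y k \<in> ?B}"
  have B: "z \<in> ?B \<longleftrightarrow> \<bar>Re z\<bar> \<le> 1 \<and> \<bar>Im z\<bar> \<le> 1" for z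
    by (auto simp: in_cbox_complex_iff abs_le_iff)
  \<comment> \<open>\<open>R\<close> collects the continuous functions on the sine cube whose
    pullback along the wave is trigonometric. The real and imaginary coordinates belong to it and
    separate points.\<close>
  define R where "R = {p :: (nat \<Rightarrow> complex) \<Rightarrow> real. continuous_on S p \<and>
      (\<lambda>x. complex_of_real (p (clamp_wave s x))) \<in> trig_span}"
  have coord: "continuous_on S (\<lambda>y. y k)" for k
    by (rule continuous_on_coordinatewise_then_product continuous_on_product_coordinates
        continuous_on_subset[OF continuous_on_product_coordinates])+ auto
  have ReR: "(\<lambda>y. Re (y k)) \<in> R" for k
    using trig_span_sin[of "of_real (1 / s k)" k]
    by (auto simp: R_def clamp_wave_def intro!: continuous_intros coord)
  \<comment> \<open>The factor \<open>- \<i>\<close> turns an imaginary part into a real part, the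
    only form that \<open>trig_span_sin\<close> covers.\<close>
  have ImR: "(\<lambda>y. Im (y k)) \<in> R" for k
    using trig_span_sin[of "- \<i> * of_real (1 / s k)" k]
    by (auto simp: R_def clamp_wave_def intro!: continuous_intros coord)
  interpret function_ring_on R S
  proof
    show "compact S" unfolding S_def by (intro compact_coordinatewise compact_cbox)
    show "continuous_on S f" if "f \<in> R" for f using that by (simp add: R_def)
    show "(\<lambda>x. f x + g x) \<in> R" if "f \<in> R" "g \<in> R" for f g
      using that trig_span_add by (force simp: R_def intro: continuous_on_add)
    show "(\<lambda>x. f x * g x) \<in> R" if "f \<in> R" "g \<in> R" for f g
      using that trig_span_mult by (force simp: R_def intro: continuous_on_mult)
    show "(\<lambda>_. c) \<in> R" for c
      using trig_span_const by (simp add: R_def)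
    show "\<exists>f\<in>R. f x \<noteq> f y" if "x \<noteq> y" for x y
    proof -
      obtain k where "x k \<noteq> y k" using \<open>x \<noteq> y\<close> by auto
      then consider "Re (x k) \<noteq> Re (y k)" | "Im (x k) \<noteq> Im (y k)" by (auto simp: complex_eq_iff)
      then show ?thesis by cases (intro bexI[OF _ ReR] bexI[OF _ ImR]; assumption)+
    qed
  qed
  have contU: "continuous_on S (unclamp s)"
  proof (rule continuous_on_coordinatewise_then_product)
    fix k
    have eq: "unclamp s y k = of_real (s k) * (of_real (arcsin (Re (y k))) + \<i> * of_real (arcsin (Im (y k))))" for y
      by (simp add: unclamp_def complex_eq_iff)
    show "continuous_on S (\<lambda>y. unclamp s y k)"
      unfolding eq
      by (intro continuous_intros coord) (auto simp: S_def B abs_le_iff minus_le_iff)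
  qed
  have "continuous_on S (\<lambda>y. F (unclamp s y))"
  proof (rule continuous_on_compose2[OF F contU])
    have "\<bar>Re (unclamp s y k)\<bar> \<le> s k * (pi/2) \<and> \<bar>Im (unclamp s y k)\<bar> \<le> s k * (pi/2)"
      if "y \<in> S" for y k
    proof -
      have "\<bar>Re (y k)\<bar> \<le> 1" "\<bar>Im (y k)\<bar> \<le> 1" using that by (auto simp: S_def B)
      then have "\<bar>arcsin (Re (y k))\<bar> \<le> pi/2" "\<bar>arcsin (Im (y k))\<bar> \<le> pi/2"
        using arcsin_bounded[of "Re (y k)"] arcsin_bounded[of "Im (y k)"] by (auto simp: abs_le_iff)
      then show ?thesis
        using assms(1)[of k] by (auto simp: unclamp_def abs_mult intro!: mult_left_mono)
    qed
    then show "unclamp s ` S \<subseteq> {x. \<forall>k. \<bar>Re (x k)\<bar> \<le> s k * (pi/2) \<and> \<bar>Im (x k)\<bar> \<le> s k * (pi/2)}"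
      by blast
  qed
  from Stone_Weierstrass_basic[OF this \<open>\<epsilon> > 0\<close>] obtain p where p: "p \<in> R"
    "\<And>y. y \<in> S \<Longrightarrow> \<bar>F (unclamp s y) - p y\<bar> < \<epsilon>" by blast
  have S: "clamp_wave s x \<in> S" for x
    by (auto simp: S_def B clamp_wave_def)
  show ?thesis
  proof
    show "(\<lambda>x. complex_of_real (p (clamp_wave s x))) \<in> trig_span" using p by (simp add: R_def)
    show "cmod (of_real (F (unclamp s (clamp_wave s x))) - complex_of_real (p (clamp_wave s x))) < \<epsilon>" for x
      using p(2)[OF S, of x] by (simp flip: of_real_diff)
  qed
qed

lemma unclamp_clamp_wave:
  assumes "\<And>k. s k > 0" "\<And>k. \<bar>Re (x k)\<bar> \<le> s k * (pi/2) \<and> \<bar>Im (x k)\<bar> \<le> s k * (pi/2)"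
  shows "unclamp s (clamp_wave s x) = x"
proof
  fix k
  have "\<bar>Re (x k) / s k\<bar> \<le> pi/2" "\<bar>Im (x k) / s k\<bar> \<le> pi/2"
    using assms(1)[of k] assms(2)[of k] by (simp_all add: abs_divide field_simps)
  then have "arcsin (sin (Re (x k) / s k)) = Re (x k) / s k" "arcsin (sin (Im (x k) / s k)) = Im (x k) / s k"
    by (intro arcsin_sin; linarith)+
  then show "unclamp s (clamp_wave s x) k = x k"
    using assms(1)[of k] by (simp add: unclamp_def clamp_wave_def complex_eq_iff)
qed


text \<open>Markov's inequality for the squared modulus bounds the k-th event by
  \<open>m / C^2 * (\<rho>^2)^k\<close>. Thanks to the weights the union bound over all k is a
  convergent geometric series.\<close>

lemma (in prob_space) prob_exists_large_coordinate:
  fixes X :: "'a \<Rightarrow> nat \<Rightarrow> complex"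
  assumes [measurable]: "\<And>k. (\<lambda>\<omega>. X \<omega> k) \<in> borel_measurable M"
    and int: "\<And>k. integrable M (\<lambda>\<omega>. (cmod (X \<omega> k))\<^sup>2)"
    and m: "\<And>k. expectation (\<lambda>\<omega>. (cmod (X \<omega> k))\<^sup>2) \<le> m"
    and \<rho>: "0 < \<rho>" "\<rho> < 1" and "C > 0"
  shows "prob {\<omega> \<in> space M. \<exists>k. cmod (X \<omega> k) * \<rho> ^ k > C} \<le> m / (1 - \<rho>\<^sup>2) / C\<^sup>2"
proof -
  let ?A = "\<lambda>k. {\<omega> \<in> space M. (cmod (X \<omega> k))\<^sup>2 \<ge> (C / \<rho> ^ k)\<^sup>2}"
  have sub: "{\<omega> \<in> space M. \<exists>k. cmod (X \<omega> k) * \<rho> ^ k > C} \<subseteq> (\<Union>k. ?A k)"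
  proof safe
    fix \<omega> k assume "\<omega> \<in> space M" and *: "cmod (X \<omega> k) * \<rho> ^ k > C"
    have "C / \<rho> ^ k \<le> cmod (X \<omega> k)" using * \<rho> by (simp add: pos_divide_le_eq)
    then have "(cmod (X \<omega> k))\<^sup>2 \<ge> (C / \<rho> ^ k)\<^sup>2"
      using \<rho> \<open>C > 0\<close> by (intro power_mono) auto
    then show "\<omega> \<in> (\<Union>k. ?A k)" using \<open>\<omega> \<in> space M\<close> by blast
  qed
  have A: "prob (?A k) \<le> m / C\<^sup>2 * (\<rho>\<^sup>2) ^ k" for k
  proof -
    have "prob (?A k) \<le> expectation (\<lambda>\<omega>. (cmod (X \<omega> k))\<^sup>2) / (C / \<rho> ^ k)\<^sup>2"
      using \<rho> \<open>C > 0\<close> by (intro integral_Markov_inequality_measure[OF int, where A="{}"]) auto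
    also have "\<dots> \<le> m / (C / \<rho> ^ k)\<^sup>2"
      by (intro divide_right_mono m) auto
    also have "\<dots> = m / C\<^sup>2 * (\<rho>\<^sup>2) ^ k"
      using \<rho> by (simp add: power_divide power_mult[symmetric] mult.commute)
    finally show ?thesis .
  qed
  have sm: "(\<lambda>k. m / C\<^sup>2 * (\<rho>\<^sup>2) ^ k) sums (m / C\<^sup>2 * (1 / (1 - \<rho>\<^sup>2)))"
    using \<rho> by (intro sums_mult geometric_sums) (auto simp: power_less_one_iff abs_square_less_1)
  have sA: "summable (\<lambda>k. prob (?A k))"
    by (rule summable_comparison_test[OF _ sums_summable[OF sm]]) (use A in auto)
  have "prob {\<omega> \<in> space M. \<exists>k. cmod (X \<omega> k) * \<rho> ^ k > C} \<le> prob (\<Union>k. ?A k)"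
    by (intro finite_measure_mono sub) measurable
  also have "\<dots> \<le> (\<Sum>k. prob (?A k))"
    by (intro finite_measure_subadditive_countably sA) auto
  also have "\<dots> \<le> m / C\<^sup>2 * (1 / (1 - \<rho>\<^sup>2))"
    using suminf_le[OF A sA sums_summable[OF sm]] sums_unique[OF sm] by simp
  finally show ?thesis by (simp add: field_simps)
qed

text \<open>\<open>F\<close> composed with the triangle wave is uniformly within
  \<open>\<epsilon>\<close> of a trigonometric polynomial \<open>q\<close>, whose expectations
  converge by hypothesis. The wave only alters sequences outside a weighted cube, an event of small
  probability under all laws concerned, and there boundedness of \<open>F\<close> limits the
  damage.\<close>

theorem sequence_functional_convergence:
  fixes X :: "nat \<Rightarrow> 'a \<Rightarrow> nat \<Rightarrow> complex" and Y :: "'b \<Rightarrow> nat \<Rightarrow> complex"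
    and F :: "(nat \<Rightarrow> complex) \<Rightarrow> real"
  assumes P: "\<And>N. prob_space (P N)" and Q: "prob_space Q"
    and mX: "\<And>N k. (\<lambda>\<omega>. X N \<omega> k) \<in> borel_measurable (P N)"
    and mY: "\<And>k. (\<lambda>\<omega>. Y \<omega> k) \<in> borel_measurable Q"
    and char: "\<And>K \<alpha>.
       (\<lambda>N. \<integral>\<omega>. exp (\<i> * complex_of_real (Re (\<Sum>k<K. \<alpha> k * X N \<omega> k))) \<partial>P N)
       \<longlonglongrightarrow> (\<integral>\<omega>. exp (\<i> * complex_of_real (Re (\<Sum>k<K. \<alpha> k * Y \<omega> k))) \<partial>Q)"
    and iX: "\<And>N k. integrable (P N) (\<lambda>\<omega>. (cmod (X N \<omega> k))\<^sup>2)"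
    and iY: "\<And>k. integrable Q (\<lambda>\<omega>. (cmod (Y \<omega> k))\<^sup>2)"
    and bX: "\<forall>\<^sub>F N in sequentially. \<forall>k. (\<integral>\<omega>. (cmod (X N \<omega> k))\<^sup>2 \<partial>P N) \<le> m"
    and bY: "\<And>k. (\<integral>\<omega>. (cmod (Y \<omega> k))\<^sup>2 \<partial>Q) \<le> m"
    and \<rho>: "0 < \<rho>" "\<rho> < 1"
    and F: "\<And>C. continuous_on {x. \<forall>k. cmod (x k) * \<rho> ^ k \<le> C} F"
    and mF: "F \<in> borel_measurable borel" and bF: "\<And>x. \<bar>F x\<bar> \<le> B"
  shows "(\<lambda>N. \<integral>\<omega>. F (X N \<omega>) \<partial>P N) \<longlonglongrightarrow> (\<integral>\<omega>. F (Y \<omega>) \<partial>Q)"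
proof (rule tendstoI)
  fix e :: real assume "e > 0"
  \<comment> \<open>Replacing \<open>F\<close> by \<open>q\<close> costs
    \<open>2 * \<epsilon>\<close> on each side and the convergence of the
    \<open>q\<close>-expectations costs \<open>\<epsilon>\<close>, so the total
    \<open>5 * \<epsilon>\<close> stays below \<open>e\<close>.\<close>
  define \<epsilon> where "\<epsilon> = e / 6"
  have "\<epsilon> > 0" using \<open>e > 0\<close> by (simp add: \<epsilon>_def)
  have B: "B \<ge> 0" using bF[of "\<lambda>_. 0"] by linarith
  have m: "m \<ge> 0" using bY[of 0] by (smt (verit) integral_nonneg_AE AE_I2 zero_le_power2)
  \<comment> \<open>\<open>W / C^2\<close> is \<open>2 * B\<close>, the largest possible change of
    \<open>F\<close>, times the bound of \<open>prob_exists_large_coordinate\<close>.\<close>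
  define W where "W = 2 * B * (m / (1 - \<rho>\<^sup>2))"
  have \<rho>2: "\<rho>\<^sup>2 < 1" using \<rho> by (simp add: abs_square_less_1)
  have W: "W \<ge> 0" using B m \<rho>2 by (simp add: W_def)
  obtain C where C: "C > 0" "W / C\<^sup>2 < \<epsilon>"
  proof
    show "sqrt (W / \<epsilon> + 1) > 0" using W \<open>\<epsilon> > 0\<close> by (simp add: add_nonneg_pos)
    show "W / (sqrt (W / \<epsilon> + 1))\<^sup>2 < \<epsilon>" 
      using W \<open>\<epsilon> > 0\<close> by (simp add: add_nonneg_pos pos_divide_less_eq field_simps)
  qed
  \<comment> \<open>The scale is chosen so that the wave is the identity as long as real and
    imaginary part of the k-th coordinate are at most \<open>C / \<rho> ^ k\<close>.\<close>
  define s where "s k = C / \<rho> ^ k / (pi / 2)" for k :: nat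
  have s: "s k > 0" for k using C \<rho> by (simp add: s_def)
  have spi: "s k * (pi / 2) = C / \<rho> ^ k" for k by (simp add: s_def)
  \<comment> \<open>Real and imaginary parts bounded by \<open>C / \<rho> ^ k\<close> bound the
    modulus by twice that, which is why continuity on the cube of size \<open>2 * C\<close> is
    invoked.\<close>
  have "continuous_on {x. \<forall>k. \<bar>Re (x k)\<bar> \<le> s k * (pi/2) \<and> \<bar>Im (x k)\<bar> \<le> s k * (pi/2)} F"
  proof (rule continuous_on_subset[OF F[of "2 * C"]], safe)
    fix x :: "nat \<Rightarrow> complex" and k
    assume *: "\<forall>k. \<bar>Re (x k)\<bar> \<le> s k * (pi/2) \<and> \<bar>Im (x k)\<bar> \<le> s k * (pi/2)"
    have "cmod (x k) \<le> \<bar>Re (x k)\<bar> + \<bar>Im (x k)\<bar>" by (rule cmod_le)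
    also have "\<dots> \<le> 2 * (C / \<rho> ^ k)" using *[rule_format, of k] spi[of k] by linarith
    finally show "cmod (x k) * \<rho> ^ k \<le> 2 * C" using \<rho> by (simp add: field_simps)
  qed
  from trig_approximation[OF s \<open>\<epsilon> > 0\<close> this] obtain q where q: "q \<in> trig_span"
    "\<And>x. cmod (of_real (F (unclamp s (clamp_wave s x))) - q x) < \<epsilon>" by blast
  \<comment> \<open>Stated for an arbitrary probability space, since it serves the approximating
    laws as well as the limit.\<close>
  have main: "cmod (of_real (\<integral>\<omega>. F (U \<omega>) \<partial>M) - (\<integral>\<omega>. q (U \<omega>) \<partial>M)) \<le> 2 * \<epsilon>"
    if "prob_space M" and mU: "\<And>k. (\<lambda>\<omega>. U \<omega> k) \<in> borel_measurable M"
      and iU: "\<And>k. integrable M (\<lambda>\<omega>. (cmod (U \<omega> k))\<^sup>2)"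
      and bU: "\<And>k. (\<integral>\<omega>. (cmod (U \<omega> k))\<^sup>2 \<partial>M) \<le> m"
      and iq: "integrable M (\<lambda>\<omega>. q (U \<omega>))"
    for M :: "'c measure" and U
  proof -
    interpret prob_space M by fact
    note mU[measurable]
    have mU': "U \<in> borel_measurable M"
      using measurable_coordinatewise_then_product[of U M] mU by simp
    have mF'[measurable]: "(\<lambda>\<omega>. F (U \<omega>)) \<in> borel_measurable M"
      using measurable_compose[OF mU' mF] .
    have iF: "integrable M (\<lambda>\<omega>. F (U \<omega>))"
      by (rule integrable_const_bound[of _ B]) (use bF in auto)
    let ?A = "{\<omega> \<in> space M. \<exists>k. cmod (U \<omega> k) * \<rho> ^ k > C}"
    have [measurable]: "?A \<in> sets M" by measurable
    have iA: "integrable M (indicat_real ?A)"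
      by (intro integrable_real_indicator) (auto simp: emeasure_eq_measure)
    have pw: "cmod (of_real (F (U \<omega>)) - q (U \<omega>)) \<le> \<epsilon> + 2 * B * indicator ?A \<omega>"
      if "\<omega> \<in> space M" for \<omega>
    proof (cases "\<omega> \<in> ?A")
      case True
      let ?x = "unclamp s (clamp_wave s (U \<omega>))"
      have "cmod (of_real (F (U \<omega>)) - q (U \<omega>)) \<le> cmod (of_real (F ?x) - q (U \<omega>)) + cmod (of_real (F (U \<omega>) - F ?x))"
        by (rule order_trans[OF eq_refl norm_triangle_ineq]) simp
      also have "\<dots> \<le> \<epsilon> + 2 * B"
        unfolding norm_of_real using q(2)[of "U \<omega>"] bF[of ?x] bF[of "U \<omega>"] by linarith
      finally show ?thesis using True by simp
    next
      case False
      have "cmod (U \<omega> k) \<le> C / \<rho> ^ k" for k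
      proof -
        have "cmod (U \<omega> k) * \<rho> ^ k \<le> C" using False that by (auto simp: not_less)
        then show ?thesis using \<rho> by (simp add: field_simps)
      qed
      then have "unclamp s (clamp_wave s (U \<omega>)) = U \<omega>"
        by (intro unclamp_clamp_wave s)
          (metis spi abs_Re_le_cmod abs_Im_le_cmod order_trans)
      then show ?thesis using q(2)[of "U \<omega>"] False by simp
    qed
    have "cmod (of_real (\<integral>\<omega>. F (U \<omega>) \<partial>M) - (\<integral>\<omega>. q (U \<omega>) \<partial>M))
      = cmod (\<integral>\<omega>. of_real (F (U \<omega>)) - q (U \<omega>) \<partial>M)"
      using iF iq by (simp add: Bochner_Integration.integral_diff)
    also have "\<dots> \<le> (\<integral>\<omega>. cmod (of_real (F (U \<omega>)) - q (U \<omega>)) \<partial>M)"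
      by (rule integral_norm_bound)
    also have "\<dots> \<le> (\<integral>\<omega>. \<epsilon> + 2 * B * indicator ?A \<omega> \<partial>M)"
      using iF iq iA by (intro integral_mono pw) auto
    also have "\<dots> = \<epsilon> + 2 * B * prob ?A"
      using iA by (subst Bochner_Integration.integral_add) (auto simp: prob_space)
    also have "2 * B * prob ?A \<le> 2 * B * (m / (1 - \<rho>\<^sup>2) / C\<^sup>2)"
      using B C by (intro mult_left_mono prob_exists_large_coordinate iU bU \<rho>) auto
    also have "2 * B * (m / (1 - \<rho>\<^sup>2) / C\<^sup>2) = W / C\<^sup>2"
      by (simp add: W_def)
    finally show ?thesis using C by linarith
  qed
  have qlim: "(\<forall>N. integrable (P N) (\<lambda>\<omega>. q (X N \<omega>))) \<and> integrable Q (\<lambda>\<omega>. q (Y \<omega>)) \<and>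
     (\<lambda>N. \<integral>\<omega>. q (X N \<omega>) \<partial>P N) \<longlonglongrightarrow> (\<integral>\<omega>. q (Y \<omega>) \<partial>Q)"
    by (rule trig_span_integral_tendsto[where X=X and Y=Y and P=P and Q=Q, OF q(1) P Q mX mY char])
  have mainY: "cmod (of_real (\<integral>\<omega>. F (Y \<omega>) \<partial>Q) - (\<integral>\<omega>. q (Y \<omega>) \<partial>Q)) \<le> 2 * \<epsilon>"
    using qlim by (intro main Q mY iY bY) auto
  have "\<forall>\<^sub>F N in sequentially. dist (\<integral>\<omega>. q (X N \<omega>) \<partial>P N) (\<integral>\<omega>. q (Y \<omega>) \<partial>Q) < \<epsilon>"
    using qlim \<open>\<epsilon> > 0\<close> by (auto dest: tendstoD)
  with bX show "\<forall>\<^sub>F N in sequentially. dist (\<integral>\<omega>. F (X N \<omega>) \<partial>P N) (\<integral>\<omega>. F (Y \<omega>) \<partial>Q) < e"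
  proof eventually_elim
    case (elim N)
    let ?a = "complex_of_real (\<integral>\<omega>. F (X N \<omega>) \<partial>P N)" and ?b = "complex_of_real (\<integral>\<omega>. F (Y \<omega>) \<partial>Q)"
    let ?c = "\<integral>\<omega>. q (X N \<omega>) \<partial>P N" and ?d = "\<integral>\<omega>. q (Y \<omega>) \<partial>Q"
    have "cmod (?a - ?c) \<le> 2 * \<epsilon>"
      using qlim elim by (intro main P mX iX) auto
    moreover have "cmod (?a - ?b) \<le> cmod (?a - ?c) + cmod (?c - ?d) + cmod (?b - ?d)"
      using norm_triangle_ineq4[of "?a - ?d" "?b - ?d"] norm_triangle_ineq[of "?a - ?c" "?c - ?d"] by simp
    ultimately have "cmod (?a - ?b) < e"
      using mainY elim(2) \<open>\<epsilon> > 0\<close> by (simp add: dist_norm \<epsilon>_def)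
    then show ?case by (simp add: dist_real_def flip: of_real_diff)
  qed
qed

subsection \<open>Sums over zeros of power series\<close>

lemma finite_zeros_compact:
  assumes "f holomorphic_on S" "open S" "connected S" "compact K" "K \<subseteq> S" "\<exists>w\<in>S. f w \<noteq> 0"
  shows "finite {z\<in>K. f z = 0}"
proof (cases "f constant_on S")
  case True
  then have eq: "{z\<in>K. f z = 0} = {}" using assms(5,6) by (auto simp: constant_on_def)
  show ?thesis unfolding eq by simp
next
  case False
  then show ?thesis using holomorphic_compact_finite_zeros assms by blast
qed

text \<open>Restricting to zeros with \<open>g w \<noteq> 0\<close> makes the index set finite when
  \<open>f\<close> is analytic and not identically zero and \<open>g\<close> has compact support; an
  infinite index set would silently give the value 0.\<close>

definition zero_sum :: "(complex \<Rightarrow> real) \<Rightarrow> complex set \<Rightarrow> (complex \<Rightarrow> complex) \<Rightarrow> real" where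
  "zero_sum g S f = (\<Sum>w\<in>{w\<in>S. f w = 0 \<and> g w \<noteq> 0}. of_int (zorder f w) * g w)"

text \<open>Rouche's theorem counts zeros weighted by winding numbers. For a circle these are 1
  inside and 0 outside, so both sides become plain counts in the open ball. The doubled radius
  provides an open domain around the circle.\<close>

lemma Rouche_ball:
  assumes h: "h holomorphic_on ball w (2 * \<eta>)" and f: "f holomorphic_on ball w (2 * \<eta>)"
    and "\<eta> > 0" and fin: "finite {p \<in> ball w (2 * \<eta>). f p = 0}"
    and less: "\<And>z. z \<in> sphere w \<eta> \<Longrightarrow> cmod (f z - h z) < cmod (h z)"
    and zero: "h w = 0" and nz: "\<And>z. z \<in> ball w (2 * \<eta>) \<Longrightarrow> z \<noteq> w \<Longrightarrow> h z \<noteq> 0"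
  shows "(\<Sum>p\<in>{p \<in> ball w \<eta>. f p = 0}. zorder f p) = zorder h w"
proof -
  let ?s = "ball w (2 * \<eta>)" and ?\<gamma> = "circlepath w \<eta>"
  have hz: "{p \<in> ?s. h p = 0} = {w}" using zero nz \<open>\<eta> > 0\<close> by auto
  \<comment> \<open>The strict inequality excludes zeros of \<open>f\<close> on the circle itself,
    so each zero is either inside or outside.\<close>
  have fz: "f z \<noteq> 0" if "z \<in> sphere w \<eta>" for z
    using less[OF that] by auto
  have R: "(\<Sum>p\<in>{p\<in>?s. h p + (f p - h p) = 0}. winding_number ?\<gamma> p * zorder (\<lambda>p. h p + (f p - h p)) p)
     = (\<Sum>p\<in>{p\<in>?s. h p = 0}. winding_number ?\<gamma> p * zorder h p)"
  proof (rule Rouche_theorem)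
    show "path_image ?\<gamma> \<subseteq> ?s" using \<open>\<eta> > 0\<close> by (auto simp: sphere_def)
    show "\<forall>z\<in>path_image ?\<gamma>. cmod (f z - h z) < cmod (h z)"
      using less \<open>\<eta> > 0\<close> by auto
    show "\<forall>z. z \<notin> ?s \<longrightarrow> winding_number ?\<gamma> z = 0"
      using \<open>\<eta> > 0\<close> by (auto intro!: winding_number_zero_outside[of _ "cball w \<eta>"] simp: sphere_def)
  qed (use h f fin hz in \<open>auto intro!: holomorphic_intros\<close>)
  have "(\<Sum>p\<in>{p\<in>?s. f p = 0}. winding_number ?\<gamma> p * zorder f p) = (\<Sum>p\<in>{p \<in> ball w \<eta>. f p = 0}. of_int (zorder f p))"
  proof (rule sum.mono_neutral_cong_right[OF fin])
    show "{p \<in> ball w \<eta>. f p = 0} \<subseteq> {p \<in> ball w (2 * \<eta>). f p = 0}" using \<open>\<eta> > 0\<close> by auto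
    show "\<forall>i\<in>{p \<in> ball w (2 * \<eta>). f p = 0} - {p \<in> ball w \<eta>. f p = 0}. winding_number ?\<gamma> i * complex_of_int (zorder f i) = 0"
    proof
      fix i assume i: "i \<in> {p \<in> ball w (2 * \<eta>). f p = 0} - {p \<in> ball w \<eta>. f p = 0}"
      then have "i \<notin> cball w \<eta>" using fz[of i] by (auto simp: dist_commute)
      then have "winding_number ?\<gamma> i = 0"
        using \<open>\<eta> > 0\<close> by (auto intro!: winding_number_zero_outside[of _ "cball w \<eta>"] simp: sphere_def)
      then show "winding_number ?\<gamma> i * complex_of_int (zorder f i) = 0" by simp
    qed
    show "winding_number ?\<gamma> x * complex_of_int (zorder f x) = of_int (zorder f x)"
      if "x \<in> {p \<in> ball w \<eta>. f p = 0}" for x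
      using that by (simp add: winding_number_circlepath dist_norm norm_minus_commute)
  qed
  moreover have "h p + (f p - h p) = f p" for p by simp
  note R[unfolded this hz]
  moreover have "(\<Sum>p\<in>{w}. winding_number ?\<gamma> p * zorder h p) = of_int (zorder h w)"
    using \<open>\<eta> > 0\<close> by (simp add: winding_number_circlepath_centre)
  ultimately have "(\<Sum>p\<in>{p \<in> ball w \<eta>. f p = 0}. complex_of_int (zorder f p)) = of_int (zorder h w)"
    by (simp only:)
  then have "complex_of_int (\<Sum>p\<in>{p \<in> ball w \<eta>. f p = 0}. zorder f p) = of_int (zorder h w)"
    by (simp only: of_int_sum)
  then show ?thesis by (simp only: of_int_eq_iff)
qed

lemma zorder_nonneg:
  assumes "f holomorphic_on S" "open S" "connected S" "z \<in> S" "\<exists>w\<in>S. f w \<noteq> 0"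
  shows "zorder f z \<ge> 0"
  using zorder_exist_zero[OF assms] by (auto split: if_splits)

text \<open>Hurwitz's theorem in weighted form. The zeros of \<open>h\<close> in \<open>K\<close>
  are surrounded by disjoint disks on which \<open>g\<close> varies by less than
  \<open>\<epsilon>\<close>. Uniform closeness on the circles preserves the number of zeros in each
  disk, and closeness on the rest of \<open>K\<close> excludes further zeros that \<open>g\<close>
  could see. The sums then differ by at most \<open>\<epsilon>\<close> times the number
  \<open>m\<close> of zeros.\<close>

theorem zero_sum_tendsto:
  fixes f :: "'i \<Rightarrow> complex \<Rightarrow> complex"
  assumes U: "open U" "connected U"
    and h: "h holomorphic_on U" "\<exists>w\<in>U. h w \<noteq> 0"
    and f: "\<forall>\<^sub>F i in F. f i holomorphic_on U"
    and lim: "\<And>L. compact L \<Longrightarrow> L \<subseteq> U \<Longrightarrow> uniform_limit L f h F"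
    and g: "continuous_on U g" and K: "compact K" "K \<subseteq> U" "\<And>z. z \<in> U - K \<Longrightarrow> g z = 0"
  shows "((\<lambda>i. zero_sum g U (f i)) \<longlongrightarrow> zero_sum g U h) F"
proof (rule tendstoI)
  fix e :: real assume "e > 0"
  define Z where "Z = {w\<in>K. h w = 0}"
  have finZ: "finite Z"
    unfolding Z_def by (rule finite_zeros_compact[OF h(1) U K(1,2) h(2)])
  have ZU: "Z \<subseteq> U" using K by (auto simp: Z_def)
  define m where "m = (\<Sum>w\<in>Z. real_of_int (zorder h w))"
  have zh: "zorder h w \<ge> 0" if "w \<in> Z" for w
    using zorder_nonneg[OF h(1) U _ h(2)] that ZU by blast
  have m: "m \<ge> 0" using zh by (auto simp: m_def intro!: sum_nonneg)
  \<comment> \<open>The summand 1 keeps the quotient meaningful when \<open>h\<close> has no zeros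
    in \<open>K\<close>, that is, when \<open>m = 0\<close>.\<close>
  define \<epsilon> where "\<epsilon> = e / (m + 1)"
  have \<epsilon>: "\<epsilon> > 0" "\<epsilon> * m < e" using \<open>e > 0\<close> m by (auto simp: \<epsilon>_def field_simps)
  have ex: "\<exists>\<eta>>0. ball w \<eta> \<subseteq> U \<and> (\<forall>z\<in>ball w \<eta>. (z \<noteq> w \<longrightarrow> h z \<noteq> 0) \<and> \<bar>g z - g w\<bar> < \<epsilon>)"
    if "w \<in> Z" for w
  proof -
    have "w \<in> U" using that ZU by auto
    from zorder_exist_zero[OF h(1) U this h(2)] obtain r where r: "r > 0" "cball w r \<subseteq> U"
      "\<forall>z\<in>cball w r. h z = zor_poly h w z * (z - w) ^ nat (zorder h w) \<and> zor_poly h w z \<noteq> 0" by blast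
    from g \<open>w \<in> U\<close> \<epsilon>(1) obtain d where d: "d > 0" "\<And>z. z \<in> U \<Longrightarrow> dist z w < d \<Longrightarrow> dist (g z) (g w) < \<epsilon>"
      unfolding continuous_on_iff by metis
    show ?thesis
    proof (intro exI[of _ "min r d"] conjI ballI impI)
      fix z assume z: "z \<in> ball w (min r d)"
      then have zr: "z \<in> cball w r" by auto
      show "h z \<noteq> 0" if "z \<noteq> w" using r(3) zr that by auto
      have "z \<in> U" using zr r(2) by blast
      moreover have "dist z w < d" using z by (auto simp: dist_commute)
      ultimately show "\<bar>g z - g w\<bar> < \<epsilon>"
        using d(2) unfolding dist_real_def by blast
    qed (use r d in auto)
  qed
  have "\<exists>\<eta>>0. \<forall>w\<in>Z. ball w \<eta> \<subseteq> U \<and> (\<forall>z\<in>ball w \<eta>. (z \<noteq> w \<longrightarrow> h z \<noteq> 0) \<and> \<bar>g z - g w\<bar> < \<epsilon>)"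
  proof -
    have "\<forall>w\<in>Z. \<exists>r. r > 0 \<and> ball w r \<subseteq> U \<and> (\<forall>z\<in>ball w r. (z \<noteq> w \<longrightarrow> h z \<noteq> 0) \<and> \<bar>g z - g w\<bar> < \<epsilon>)"
      using ex by blast
    from bchoice[OF this] obtain R where R: "\<And>w. w \<in> Z \<Longrightarrow> R w > 0 \<and> ball w (R w) \<subseteq> U \<and> (\<forall>z\<in>ball w (R w). (z \<noteq> w \<longrightarrow> h z \<noteq> 0) \<and> \<bar>g z - g w\<bar> < \<epsilon>)"
      by blast
    have le: "Min (insert 1 (R ` Z)) \<le> R w" if "w \<in> Z" for w
      using finZ that by (intro Min_le) auto
    have "Min (insert 1 (R ` Z)) > 0"
      using finZ R by (subst Min_gr_iff) auto
    moreover have "ball w (Min (insert 1 (R ` Z))) \<subseteq> ball w (R w)" if "w \<in> Z" for w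
      by (rule subset_ball[OF le[OF that]])
    ultimately show ?thesis
      using R by (intro exI[of _ "Min (insert 1 (R ` Z))"] conjI ballI) blast+
  qed
  then obtain \<eta>0 where \<eta>0: "\<eta>0 > 0" "\<And>w. w \<in> Z \<Longrightarrow> ball w \<eta>0 \<subseteq> U"
      "\<And>w z. w \<in> Z \<Longrightarrow> z \<in> ball w \<eta>0 \<Longrightarrow> z \<noteq> w \<Longrightarrow> h z \<noteq> 0"
      "\<And>w z. w \<in> Z \<Longrightarrow> z \<in> ball w \<eta>0 \<Longrightarrow> \<bar>g z - g w\<bar> < \<epsilon>" by blast
  \<comment> \<open>Distinct points of \<open>Z\<close> are at distance at least
    \<open>\<eta>0\<close>. One third of it makes the disks disjoint and leaves the doubled closed
    disk inside the region controlled by \<open>\<eta>0\<close>.\<close>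
  define \<eta> where "\<eta> = \<eta>0 / 3"
  have \<eta>: "\<eta> > 0" using \<eta>0 by (simp add: \<eta>_def)
  have sub: "cball w (2 * \<eta>) \<subseteq> ball w \<eta>0" for w using \<eta>0(1) by (auto simp: \<eta>_def)
  have disj: "ball w \<eta> \<inter> ball w' \<eta> = {}" if "w \<in> Z" "w' \<in> Z" "w \<noteq> w'" for w w'
  proof -
    have "w' \<notin> ball w \<eta>0" using \<eta>0(3)[OF that(1), of w'] that by (auto simp: Z_def)
    then show ?thesis using \<eta>0(1)
      by (intro disjoint_ballI) (auto simp: \<eta>_def not_less)
  qed
  \<comment> \<open>The circles are added separately because they may leave \<open>K\<close>, while
    Rouche's theorem needs closeness on all of each circle.\<close>
  define L where "L = (K - (\<Union>w\<in>Z. ball w \<eta>)) \<union> (\<Union>w\<in>Z. sphere w \<eta>)"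
  have cL: "compact L" unfolding L_def
    by (intro compact_Un compact_UN finZ compact_diff K) auto
  have LU: "L \<subseteq> U"
  proof -
    have "sphere w \<eta> \<subseteq> U" if "w \<in> Z" for w
    proof -
      have "sphere w \<eta> \<subseteq> cball w (2 * \<eta>)" using \<eta> by auto
      then show ?thesis using sub[of w] \<eta>0(2)[OF that] by blast
    qed
    then show ?thesis using K unfolding L_def by blast
  qed
  have hL: "h z \<noteq> 0" if "z \<in> L" for z
  proof
    assume "h z = 0"
    consider "z \<in> K" "z \<notin> (\<Union>w\<in>Z. ball w \<eta>)" | w where "w \<in> Z" "z \<in> sphere w \<eta>"
      using \<open>z \<in> L\<close> unfolding L_def by blast
    then show False
    proof cases
      case 1
      then have "z \<in> Z" using \<open>h z = 0\<close> by (auto simp: Z_def)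
      then show False using 1 \<eta> by auto
    next
      case 2
      then have "z \<in> cball w (2 * \<eta>)" "z \<noteq> w" using \<eta> by auto
      then have "z \<in> ball w \<eta>0" "z \<noteq> w" using sub by blast+
      then show False using \<eta>0(3) 2 \<open>h z = 0\<close> by blast
    qed
  qed
  obtain \<delta> where \<delta>: "\<delta> > 0" "\<And>z. z \<in> L \<Longrightarrow> cmod (h z) \<ge> \<delta>"
  proof (cases "L = {}")
    case True
    then show ?thesis using that[of 1] by auto
  next
    case False
    have "continuous_on L (\<lambda>z. cmod (h z))"
      using holomorphic_on_imp_continuous_on[OF h(1)] continuous_on_subset[OF _ LU]
      by (intro continuous_intros) auto
    from continuous_attains_inf[OF cL False this] obtain z0 where "z0 \<in> L" "\<And>z. z \<in> L \<Longrightarrow> cmod (h z0) \<le> cmod (h z)"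
      by blast
    then show ?thesis using that[of "cmod (h z0)"] hL by auto
  qed
  from lim[OF cL LU] have "\<forall>\<^sub>F i in F. \<forall>z\<in>L. dist (f i z) (h z) < \<delta>"
    using \<delta>(1) by (rule uniform_limitD)
  with f show "\<forall>\<^sub>F i in F. dist (zero_sum g U (f i)) (zero_sum g U h) < e"
  proof eventually_elim
    case (elim i)
    note fh = elim(1)
    have close: "cmod (f i z - h z) < cmod (h z)" if "z \<in> L" for z
      using elim(2) \<delta>(2)[OF that] that by (force simp: dist_norm)
    have fL: "f i z \<noteq> 0" if "z \<in> L" for z using close[OF that] by auto
    let ?N = "\<lambda>w. {p \<in> ball w \<eta>. f i p = 0}"
    \<comment> \<open>Any circle lies in \<open>L\<close>, where \<open>f i\<close> has no zeros, so
      \<open>f i\<close> is not identically zero. If \<open>Z\<close> is empty there is no disk to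
      treat.\<close>
    have fnz: "\<exists>w\<in>U. f i w \<noteq> 0" if "Z \<noteq> {}"
    proof -
      obtain w where "w \<in> Z" using \<open>Z \<noteq> {}\<close> by blast
      moreover have "w + of_real \<eta> \<in> sphere w \<eta>" using \<eta> by (simp add: dist_norm)
      ultimately have "w + of_real \<eta> \<in> L" unfolding L_def by blast
      then show ?thesis using fL LU by blast
    qed
    have fin2: "finite {p \<in> ball w (2 * \<eta>). f i p = 0}" if "w \<in> Z" for w
    proof (rule finite_subset)
      show "finite {p \<in> cball w (2 * \<eta>). f i p = 0}"
        using sub[of w] \<eta>0(2)[OF that] that fnz
        by (intro finite_zeros_compact[OF fh U] compact_cball) (meson order_trans | blast)+
    qed auto
    have finN: "finite (?N w)" if "w \<in> Z" for w
      by (rule finite_subset[OF _ fin2[OF that]]) (use \<eta> in auto)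
    have zf: "zorder (f i) p \<ge> 0" if "p \<in> ?N w" "w \<in> Z" for p w
    proof (rule zorder_nonneg[OF fh U])
      show "p \<in> U" using that sub[of w] \<eta>0(2)[of w] \<eta> by force
      show "\<exists>w\<in>U. f i w \<noteq> 0" using fnz that by auto
    qed
    have count: "(\<Sum>p\<in>?N w. zorder (f i) p) = zorder h w" if "w \<in> Z" for w
    proof (rule Rouche_ball[OF _ _ \<eta> fin2[OF that]])
      have "ball w (2 * \<eta>) \<subseteq> U" using sub \<eta>0(2)[OF that] by (meson ball_subset_cball order_trans)
      then show "h holomorphic_on ball w (2 * \<eta>)" "f i holomorphic_on ball w (2 * \<eta>)"
        using h fh holomorphic_on_subset by blast+
      show "cmod (f i z - h z) < cmod (h z)" if "z \<in> sphere w \<eta>" for z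
        using that \<open>w \<in> Z\<close> by (intro close) (auto simp: L_def)
      show "h w = 0" using that by (auto simp: Z_def)
      show "h z \<noteq> 0" if "z \<in> ball w (2 * \<eta>)" "z \<noteq> w" for z
        using \<eta>0(3)[OF \<open>w \<in> Z\<close>] sub that ball_subset_cball by blast
    qed
    have "zero_sum g U (f i) = (\<Sum>p\<in>(\<Union>w\<in>Z. ?N w). of_int (zorder (f i) p) * g p)"
      unfolding zero_sum_def
    proof (rule sum.mono_neutral_left)
      show "finite (\<Union>w\<in>Z. ?N w)" using finZ finN by auto
      show "{w \<in> U. f i w = 0 \<and> g w \<noteq> 0} \<subseteq> (\<Union>w\<in>Z. ?N w)"
      proof safe
        fix p assume p: "p \<in> U" "f i p = 0" "g p \<noteq> 0"
        then have "p \<in> K" using K(3) by blast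
        moreover have "p \<notin> L" using fL p by blast
        ultimately have "p \<in> (\<Union>w\<in>Z. ball w \<eta>)" unfolding L_def by blast
        then show "p \<in> (\<Union>w\<in>Z. ?N w)" using p by blast
      qed
      have "p \<in> U" if "p \<in> ?N w" "w \<in> Z" for p w
        using that sub[of w] \<eta>0(2)[of w] \<eta> by force
      then show "\<forall>p\<in>(\<Union>w\<in>Z. ?N w) - {w \<in> U. f i w = 0 \<and> g w \<noteq> 0}. real_of_int (zorder (f i) p) * g p = 0"
        by auto
    qed
    also have "\<dots> = (\<Sum>w\<in>Z. \<Sum>p\<in>?N w. of_int (zorder (f i) p) * g p)"
      by (rule sum.UNION_disjoint) (use finZ finN disj in blast)+
    finally have Sf: "zero_sum g U (f i) = (\<Sum>w\<in>Z. \<Sum>p\<in>?N w. of_int (zorder (f i) p) * g p)" .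
    have "zero_sum g U h = (\<Sum>w\<in>Z. of_int (zorder h w) * g w)"
      unfolding zero_sum_def
      by (rule sum.mono_neutral_left[OF finZ]) (use K ZU in \<open>auto simp: Z_def\<close>)
    \<comment> \<open>By \<open>count\<close> the multiplicity of \<open>w\<close> can be
      distributed over the nearby zeros of \<open>f i\<close>, which makes the two sums comparable
      term by term.\<close>
    also have "\<dots> = (\<Sum>w\<in>Z. \<Sum>p\<in>?N w. of_int (zorder (f i) p) * g w)"
      by (intro sum.cong refl) (simp add: count[symmetric] sum_distrib_right)
    finally have "zero_sum g U (f i) - zero_sum g U h
       = (\<Sum>w\<in>Z. \<Sum>p\<in>?N w. of_int (zorder (f i) p) * (g p - g w))"
      unfolding Sf by (simp add: sum_subtractf right_diff_distrib)
    also have "\<bar>\<dots>\<bar> \<le> (\<Sum>w\<in>Z. \<Sum>p\<in>?N w. of_int (zorder (f i) p) * \<epsilon>)"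
    proof (intro sum_abs[THEN order_trans] sum_mono)
      fix w p assume wp: "w \<in> Z" "p \<in> ?N w"
      have "p \<in> ball w \<eta>0" using wp sub[of w] \<eta> by force
      then have "\<bar>g p - g w\<bar> \<le> \<epsilon>" using \<eta>0(4) wp by force
      then show "\<bar>real_of_int (zorder (f i) p) * (g p - g w)\<bar> \<le> of_int (zorder (f i) p) * \<epsilon>"
        using zf[OF wp(2,1)] by (simp add: abs_mult mult_left_mono)
    qed
    also have "\<dots> = \<epsilon> * m"
      by (simp add: m_def count[symmetric] sum_distrib_left sum_distrib_right mult.commute)
    finally show ?case using \<epsilon> by (simp add: dist_real_def)
  qed
qed


section \<open>Power series as functions of their coefficient sequence\<close>

definition pser :: "(nat \<Rightarrow> complex) \<Rightarrow> complex \<Rightarrow> complex" where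
  "pser x z = (\<Sum>k. x k * z ^ k)"

text \<open>Coefficient bounds of Cauchy type for the disk of radius \<open>\<rho>\<close>. They cut
  out a closed set in the product topology on which coordinatewise convergence controls the
  series.\<close>

definition weighted_cube :: "real \<Rightarrow> real \<Rightarrow> (nat \<Rightarrow> complex) set" where
  "weighted_cube \<rho> C = {x. \<forall>k. cmod (x k) * \<rho> ^ k \<le> C}"

lemma summable_pser:
  assumes "x \<in> weighted_cube \<rho> C" "0 \<le> r" "r < \<rho>"
  shows "summable (\<lambda>k. cmod (x k) * r ^ k)" "cmod (x k) * r ^ k \<le> C * (r / \<rho>) ^ k"
    "summable (\<lambda>k. C * (r / \<rho>) ^ k)"
proof -
  have le: "cmod (x k) * r ^ k \<le> C * (r / \<rho>) ^ k" for k
  proof -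
    have "cmod (x k) * r ^ k = cmod (x k) * \<rho> ^ k * (r / \<rho>) ^ k"
      using assms by (simp add: power_divide)
    also have "\<dots> \<le> C * (r / \<rho>) ^ k"
      using assms by (intro mult_right_mono) (auto simp: weighted_cube_def)
    finally show ?thesis .
  qed
  then show "cmod (x k) * r ^ k \<le> C * (r / \<rho>) ^ k" .
  show s: "summable (\<lambda>k. C * (r / \<rho>) ^ k)"
    using assms by (intro summable_mult summable_geometric) auto
  show "summable (\<lambda>k. cmod (x k) * r ^ k)"
    by (rule summable_comparison_test'[OF s, of 0]) (use le assms in auto)
qed

lemma pser_sums:
  assumes "x \<in> weighted_cube \<rho> C" "z \<in> ball 0 \<rho>"
  shows "(\<lambda>k. x k * z ^ k) sums pser x z"
proof -
  have "summable (\<lambda>k. norm (x k * z ^ k))"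
    using summable_pser(1)[OF assms(1), of "cmod z"] assms(2) by (simp add: norm_mult norm_power)
  then show ?thesis
    unfolding pser_def by (rule summable_sums[OF summable_norm_cancel])
qed

lemma pser_holomorphic:
  assumes "x \<in> weighted_cube \<rho> C"
  shows "pser x holomorphic_on ball 0 \<rho>"
  by (rule power_series_holomorphic) (use pser_sums[OF assms] in simp)

text \<open>A nonzero constant term is seen at the origin. Otherwise the zero at the origin is
  isolated, and a small real point serves as witness.\<close>

lemma pser_nonzero:
  assumes "x \<in> weighted_cube \<rho> C" "\<rho> > 0" "x \<noteq> (\<lambda>_. 0)"
  shows "\<exists>w\<in>ball 0 \<rho>. pser x w \<noteq> 0"
proof (cases "x 0 = 0")
  case False
  then show ?thesis using assms(2) by (intro bexI[of _ 0]) (auto simp: pser_def)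
next
  case True
  obtain m where m: "x m \<noteq> 0" using assms(3) by auto
  with True have "m > 0" by (cases m) auto
  have sums: "(\<lambda>n. x n * (z - 0) ^ n) sums pser x z" if "norm (z - 0) < \<rho>" for z
    using pser_sums[OF assms(1), of z] that by simp
  have p0: "pser x 0 = 0" using True by (simp add: pser_def)
  obtain s where s: "0 < s" "\<And>z. z \<in> cball 0 s - {0} \<Longrightarrow> pser x z \<noteq> 0"
  proof (rule powser_0_nonzero[OF assms(2) sums p0 m \<open>m > 0\<close>])
    fix s assume "0 < s" "\<And>z. z \<in> cball 0 s - {0} \<Longrightarrow> pser x z \<noteq> 0"
    then show thesis by (rule that)
  qed
  define t where "t = min s (\<rho> / 2)"
  have t: "0 < t" "t \<le> s" "t < \<rho>" using s(1) assms(2) by (auto simp: t_def)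
  have "complex_of_real t \<in> cball 0 s - {0}" "complex_of_real t \<in> ball 0 \<rho>" using t by simp_all
  then show ?thesis using s(2) by blast
qed

text \<open>The product topology only provides convergence of each coefficient. The cube supplies a
  geometric majorant on \<open>L\<close>, and Tannery's theorem, dominated convergence for series,
  does the rest.\<close>

lemma pser_uniform_limit:
  assumes x: "x \<in> weighted_cube \<rho> C" and S: "S \<subseteq> weighted_cube \<rho> C" and L: "compact L" "L \<subseteq> ball 0 \<rho>"
  shows "uniform_limit L pser (pser x) (at x within S)"
proof (cases "L = {} \<or> at x within S = bot")
  case True
  then show ?thesis by (auto simp: uniform_limit_iff)
next
  case False
  then have nb: "at x within S \<noteq> bot" by auto
  obtain z0 where z0: "z0 \<in> L" "\<And>z. z \<in> L \<Longrightarrow> cmod z \<le> cmod z0"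
    using continuous_attains_sup[of L cmod] L False by (auto intro: continuous_intros)
  define r where "r = cmod z0"
  have r: "0 \<le> r" "r < \<rho>" using z0 L by (auto simp: r_def)
  \<comment> \<open>This bound for \<open>cmod (pser y z - pser x z)\<close> no longer depends on
    \<open>z\<close> in \<open>L\<close>, so its limit is already uniform.\<close>
  let ?d = "\<lambda>y. \<Sum>k. cmod (y k - x k) * r ^ k"
  have coord: "((\<lambda>y. y k) \<longlongrightarrow> x k) (at x within S)" for k
  proof -
    have "continuous_on UNIV (\<lambda>y :: nat \<Rightarrow> complex. y k)" by (rule continuous_on_product_coordinates)
    then have "((\<lambda>y. y k) \<longlongrightarrow> x k) (at x)" by (simp add: continuous_on_def)
    then show ?thesis by (rule tendsto_within_subset) simp
  qed
  have diff: "(\<lambda>k. y k - x k) \<in> weighted_cube \<rho> (2 * C)" if "y \<in> S" for y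
    unfolding weighted_cube_def
  proof safe
    fix k
    have "cmod (y k - x k) * \<rho> ^ k \<le> (cmod (y k) + cmod (x k)) * \<rho> ^ k"
      using r by (intro mult_right_mono norm_triangle_ineq4) auto
    also have "\<dots> \<le> 2 * C"
      using x S that by (auto simp: weighted_cube_def distrib_right subset_iff intro: add_mono[of _ C _ C, simplified])
    finally show "cmod (y k - x k) * \<rho> ^ k \<le> 2 * C" .
  qed
  have evS: "\<forall>\<^sub>F y in at x within S. y \<in> S" by (simp add: eventually_at_filter)
  have "(?d \<longlongrightarrow> (\<Sum>k. 0)) (at x within S)"
  proof (rule tannerys_theorem[where M = "\<lambda>k. 2 * C * (r / \<rho>) ^ k", THEN conjunct2, THEN conjunct2])
    show "((\<lambda>y. cmod (y k - x k) * r ^ k) \<longlongrightarrow> 0) (at x within S)" for k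
      by (rule tendsto_eq_intros coord refl | simp)+
    have "\<forall>\<^sub>F p in at_top \<times>\<^sub>F (at x within S). True \<and> snd p \<in> S"
      by (rule eventually_prodI[OF eventually_True evS])
    then show "\<forall>\<^sub>F (k, y) in at_top \<times>\<^sub>F (at x within S). norm (cmod (y k - x k) * r ^ k) \<le> 2 * C * (r / \<rho>) ^ k"
    proof eventually_elim
      case (elim p)
      then show ?case using summable_pser(2)[OF diff r, of "snd p" "fst p"] r
        by (auto simp: case_prod_beta)
    qed
    show "summable (\<lambda>k. 2 * C * (r / \<rho>) ^ k)" using r by (intro summable_mult summable_geometric) auto
  qed (rule nb)
  then have lim: "(?d \<longlongrightarrow> 0) (at x within S)" by simp
  show ?thesis
  proof (rule uniform_limitI)
    fix e :: real assume "e > 0"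
    from order_tendstoD(2)[OF lim this] evS show "\<forall>\<^sub>F y in at x within S. \<forall>z\<in>L. dist (pser y z) (pser x z) < e"
    proof eventually_elim
      case (elim y)
      show ?case
      proof
        fix z assume "z \<in> L"
        then have z: "cmod z \<le> r" "z \<in> ball 0 \<rho>" using z0 L by (auto simp: r_def)
        have "(\<lambda>k. y k * z ^ k - x k * z ^ k) sums (pser y z - pser x z)"
          using S elim x z by (intro sums_diff pser_sums[where C = C]) auto
        then have eq: "pser y z - pser x z = (\<Sum>k. (y k - x k) * z ^ k)"
          by (simp add: sums_iff left_diff_distrib)
        have le: "norm ((y k - x k) * z ^ k) \<le> cmod (y k - x k) * r ^ k" for k
          using z by (auto simp: norm_mult norm_power intro!: mult_left_mono power_mono)
        note sm = summable_pser(1)[OF diff[OF elim(2)] r]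
        have "cmod (pser y z - pser x z) \<le> ?d y"
          unfolding eq by (rule norm_suminf_le[OF le sm])
        then show "dist (pser y z) (pser x z) < e" using elim by (simp add: dist_norm)
      qed
    qed
  qed
qed

lemma zero_sum_pser_continuous:
  assumes \<rho>: "\<rho> > 0" and g: "continuous_on (ball 0 \<rho>) g"
    and K: "compact K" "K \<subseteq> ball 0 \<rho>" "\<And>z. z \<in> ball 0 \<rho> - K \<Longrightarrow> g z = 0"
  shows "continuous_on (weighted_cube \<rho> C - {\<lambda>_. 0}) (\<lambda>x. zero_sum g (ball 0 \<rho>) (pser x))"
  unfolding continuous_on_def
proof
  fix x assume x: "x \<in> weighted_cube \<rho> C - {\<lambda>_. 0}"
  show "((\<lambda>x. zero_sum g (ball 0 \<rho>) (pser x)) \<longlongrightarrow> zero_sum g (ball 0 \<rho>) (pser x))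
     (at x within weighted_cube \<rho> C - {\<lambda>_. 0})"
  proof (rule zero_sum_tendsto[OF _ _ _ _ _ _ g K])
    show "pser x holomorphic_on ball 0 \<rho>" using x pser_holomorphic by blast
    show "\<exists>w\<in>ball 0 \<rho>. pser x w \<noteq> 0" using pser_nonzero[OF _ \<rho>] x by blast
    show "\<forall>\<^sub>F i in at x within weighted_cube \<rho> C - {\<lambda>_. 0}. pser i holomorphic_on ball 0 \<rho>"
      unfolding eventually_at_filter using pser_holomorphic by (intro always_eventually) blast
    show "uniform_limit L pser (pser x) (at x within weighted_cube \<rho> C - {\<lambda>_. 0})"
      if "compact L" "L \<subseteq> ball 0 \<rho>" for L
      using x that by (intro pser_uniform_limit) auto
  qed auto
qed

text \<open>A total version of the sum over zeros: the value 0 is assigned to the zero sequence and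
  to sequences outside all cubes, where \<open>zero_sum\<close> would be meaningless.\<close>

definition zero_functional :: "(complex \<Rightarrow> real) \<Rightarrow> real \<Rightarrow> (nat \<Rightarrow> complex) \<Rightarrow> real" where
  "zero_functional g \<rho> x =
     (if x \<in> (\<Union>n::nat. weighted_cube \<rho> n) - {\<lambda>_. 0} then zero_sum g (ball 0 \<rho>) (pser x) else 0)"

lemma closed_weighted_cube: "closed (weighted_cube \<rho> C)"
proof -
  have "weighted_cube \<rho> C = (\<Inter>k. {x. cmod (x k) * \<rho> ^ k \<le> C})" by (auto simp: weighted_cube_def)
  also have "closed \<dots>"
    by (intro closed_INT ballI closed_Collect_le continuous_intros continuous_on_product_coordinates)
  finally show ?thesis .
qed

lemma weighted_cube_nat: "x \<in> weighted_cube \<rho> C \<Longrightarrow> x \<in> (\<Union>n::nat. weighted_cube \<rho> n)"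
proof -
  assume x: "x \<in> weighted_cube \<rho> C"
  obtain n :: nat where "C \<le> n" using real_arch_simple by blast
  then have "x \<in> weighted_cube \<rho> n"
    using x unfolding weighted_cube_def mem_Collect_eq by (meson order_trans)
  then show ?thesis by blast
qed

text \<open>Continuity holds on each cube without the zero sequence, but not on their union. These
  countably many Borel pieces and the complement, where the functional vanishes, cover the space, so
  measurability can be checked piecewise.\<close>

lemma zero_functional_measurable:
  assumes \<rho>: "\<rho> > 0" and g: "continuous_on (ball 0 \<rho>) g"
    and K: "compact K" "K \<subseteq> ball 0 \<rho>" "\<And>z. z \<in> ball 0 \<rho> - K \<Longrightarrow> g z = 0"
  shows "zero_functional g \<rho> \<in> borel_measurable borel"
proof (rule measurable_piecewise_restrict)
  let ?S = "\<lambda>n::nat. weighted_cube \<rho> n - {\<lambda>_. 0}"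
  define U where "U = (\<Union>n. ?S n)"
  have Sb: "?S n \<in> sets borel" for n
    by (intro sets.Diff borel_closed closed_weighted_cube closed_singleton)
  show "countable (insert (- U) (range ?S))" by auto
  show "\<Omega> \<inter> space borel \<in> sets borel" if "\<Omega> \<in> insert (- U) (range ?S)" for \<Omega>
  proof -
    have "range ?S \<subseteq> sets borel" using Sb by blast
    then have "U \<in> sets borel" unfolding U_def by (rule sets.countable_UN)
    then have "- U \<in> sets borel" by (rule borel_comp)
    with that Sb have "\<Omega> \<in> sets borel" by (elim insertE imageE) (simp_all only:)
    then show ?thesis by (simp only: space_borel Int_UNIV_right)
  qed
  show "space borel \<subseteq> \<Union> (insert (- U) (range ?S))"
    by (simp only: Union_insert U_def[symmetric] Compl_partition2 space_borel subset_UNIV)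
  show "zero_functional g \<rho> \<in> borel_measurable (restrict_space borel \<Omega>)"
    if "\<Omega> \<in> insert (- U) (range ?S)" for \<Omega>
  proof (cases "\<Omega> = - U")
    case True
    have "zero_functional g \<rho> x = 0" if "x \<in> space (restrict_space borel \<Omega>)" for x
    proof -
      have "x \<notin> U" using that True by (simp only: space_restrict_space) blast
      then have "x \<notin> (\<Union>n::nat. weighted_cube \<rho> n) - {\<lambda>_. 0}" unfolding U_def by blast
      then show ?thesis unfolding zero_functional_def by (simp only: if_False)
    qed
    then show ?thesis by (subst measurable_cong[where g = "\<lambda>_. 0"]) auto
  next
    case False
    then obtain n where n: "\<Omega> = ?S n"
      using \<open>\<Omega> \<in> insert (- U) (range ?S)\<close> by (elim insertE imageE) blast+
    have "continuous_on \<Omega> (zero_functional g \<rho>) \<longleftrightarrow> continuous_on \<Omega> (\<lambda>x. zero_sum g (ball 0 \<rho>) (pser x))"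
      unfolding n by (rule continuous_on_cong[OF refl]) (auto simp: zero_functional_def)
    then show ?thesis
      using zero_sum_pser_continuous[OF \<rho> g K] n by (intro borel_measurable_continuous_on_restrict) auto
  qed
qed

subsection \<open>Moments of rotation invariant vectors\<close>

text \<open>Orthogonality of the characters of the cyclic group of order \<open>n\<close>: each term
  is a power of one root of unity \<open>q\<close>, and the geometric sum vanishes unless
  \<open>q = 1\<close>.\<close>

lemma sum_cis_orthogonal:
  fixes n l l' :: nat
  assumes "l < n" "l' < n"
  shows "(\<Sum>m<n. cis (2 * pi * m / n) ^ l * cnj (cis (2 * pi * m / n)) ^ l') = (if l = l' then of_nat n else 0)"
proof -
  define q where "q = cis (2 * pi * (real l - real l') / n)"
  have n: "n > 0" using assms by simp
  have term_eq: "cis (2 * pi * m / n) ^ l * cnj (cis (2 * pi * m / n)) ^ l' = q ^ m" for m :: nat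
    unfolding q_def cis_cnj Complex.DeMoivre cis_mult
    by (rule arg_cong[where f = cis]) (use n in \<open>simp add: field_simps\<close>)
  show ?thesis
  proof (cases "l = l'")
    case True
    then show ?thesis unfolding term_eq by (simp add: q_def)
  next
    case False
    have "q ^ n = cis (2 * pi * of_int (int l - int l'))"
      unfolding q_def Complex.DeMoivre by (rule arg_cong[where f = cis]) (use n in simp)
    also have "\<dots> = 1" by (rule cis_multiple_2pi) simp
    finally have qn: "q ^ n = 1" .
    \<comment> \<open>If \<open>q = 1\<close>, then \<open>n\<close> divides \<open>l - l'\<close>;
      as the absolute difference is below \<open>n\<close>, this forces
      \<open>l = l'\<close>.\<close>
    have "q \<noteq> 1"
    proof
      assume "q = 1"
      then have "cos (2 * pi * (real l - real l') / n) = 1" by (simp add: q_def complex_eq_iff)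
      then obtain k :: int where k: "2 * pi * (real l - real l') / n = of_int k * 2 * pi"
        using cos_one_2pi_int by blast
      then have "(2 * pi) * ((real l - real l') / n) = (2 * pi) * of_int k" by (simp add: mult_ac)
      then have "(real l - real l') / n = of_int k" by (subst (asm) mult_cancel_left) simp
      then have "(real l - real l') = real_of_int k * real n"
        using n by (simp add: field_simps)
      then have "real_of_int (int l - int l') = real_of_int (k * int n)" by simp
      then have "int l - int l' = k * int n" by (simp only: of_int_eq_iff)
      moreover have "\<bar>int l - int l'\<bar> < int n" using assms by linarith
      ultimately have "\<bar>k\<bar> * int n < 1 * int n" by (simp add: abs_mult)
      then have "\<bar>k\<bar> < 1" by (rule mult_right_less_imp_less) simp
      then have "k = 0" by simp
      with \<open>int l - int l' = k * int n\<close> False show False by simp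
    qed
    then show ?thesis unfolding term_eq using qn False by (simp add: geometric_sum)
  qed
qed

lemma cmod_power_even: "complex_of_real (cmod z ^ (2 * k)) = z ^ k * cnj z ^ k"
proof -
  have "complex_of_real (cmod z ^ (2 * k)) = complex_of_real ((cmod z)\<^sup>2) ^ k"
    by (simp only: power_mult of_real_power)
  then show ?thesis by (simp only: complex_norm_square power_mult_distrib)
qed

text \<open>Averaging over the \<open>(k+1)\<close>-st roots of unity extracts the phase invariant part of
  \<open>\<bar>a + r b\<bar>\<^sup>2\<^sup>k\<close>.\<close>

lemma sum_cis_norm_power:
  fixes a b :: complex and r :: real and k n :: nat
  assumes n: "n = Suc k"
  shows "(\<Sum>m<n. cmod (a + (of_real r * cis (2 * pi * m / n)) * b) ^ (2 * k)) =
    n * (\<Sum>l\<le>k. (of_nat (k choose l))\<^sup>2 * r ^ (2 * l) * (((cmod a)\<^sup>2) ^ (k - l) * ((cmod b)\<^sup>2) ^ l))"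
proof -
  let ?z = "\<lambda>m::nat. cis (2 * pi * m / n)"
  let ?c = "\<lambda>l l'. of_nat (k choose l) * of_nat (k choose l') * of_real (r ^ (l + l')) *
        (a ^ (k - l) * cnj a ^ (k - l') * (b ^ l * cnj b ^ l')) :: complex"
  have e: "complex_of_real (cmod (a + (of_real r * ?z m) * b) ^ (2 * k)) =
     (\<Sum>l\<le>k. \<Sum>l'\<le>k. ?c l l' * (?z m ^ l * cnj (?z m) ^ l'))" for m
  proof -
    let ?x = "of_real r * ?z m * b"
    have "complex_of_real (cmod (a + ?x) ^ (2 * k)) = (?x + a) ^ k * (cnj ?x + cnj a) ^ k"
      unfolding cmod_power_even by (simp add: add.commute)
    also have "\<dots> = (\<Sum>l\<le>k. of_nat (k choose l) * ?x ^ l * a ^ (k - l)) *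
        (\<Sum>l'\<le>k. of_nat (k choose l') * cnj ?x ^ l' * cnj a ^ (k - l'))"
      by (simp only: binomial_ring)
    also have "\<dots> = (\<Sum>l\<le>k. \<Sum>l'\<le>k. ?c l l' * (?z m ^ l * cnj (?z m) ^ l'))"
      unfolding sum_product
      by (intro sum.cong refl) (simp add: power_mult_distrib power_add mult_ac)
    finally show ?thesis .
  qed
  have "complex_of_real (\<Sum>m<n. cmod (a + (of_real r * ?z m) * b) ^ (2 * k)) =
     (\<Sum>m<n. \<Sum>l\<le>k. \<Sum>l'\<le>k. ?c l l' * (?z m ^ l * cnj (?z m) ^ l'))"
    by (simp only: of_real_sum e)
  also have "\<dots> = (\<Sum>l\<le>k. \<Sum>l'\<le>k. \<Sum>m<n. ?c l l' * (?z m ^ l * cnj (?z m) ^ l'))"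
    by (rule trans[OF sum.swap], rule sum.cong[OF refl], rule sum.swap)
  also have "\<dots> = (\<Sum>l\<le>k. \<Sum>l'\<le>k. ?c l l' * (if l = l' then of_nat n else 0))"
    by (intro sum.cong refl, subst sum_distrib_left[symmetric], subst sum_cis_orthogonal) (auto simp: n)
  also have "\<dots> = (\<Sum>l\<le>k. ?c l l * of_nat n)"
    by (intro sum.cong refl) (simp add: if_distrib[of "\<lambda>x. _ * x"] cong: if_cong)
  also have "\<dots> = (\<Sum>l\<le>k. complex_of_real (n * ((of_nat (k choose l))\<^sup>2 * r ^ (2 * l) * (((cmod a)\<^sup>2) ^ (k - l) * ((cmod b)\<^sup>2) ^ l))))"
  proof (intro sum.cong refl)
    fix l
    have *: "complex_of_real (((cmod x)\<^sup>2) ^ j) = x ^ j * cnj x ^ j" for x and j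
      using cmod_power_even[of x j] by (simp add: power_mult)
    show "?c l l * of_nat n = complex_of_real (n * ((of_nat (k choose l))\<^sup>2 * r ^ (2 * l) * (((cmod a)\<^sup>2) ^ (k - l) * ((cmod b)\<^sup>2) ^ l)))"
      unfolding of_real_mult * mult_2[of l] by (simp add: power2_eq_square mult_ac)
  qed
  also have "\<dots> = complex_of_real (n * (\<Sum>l\<le>k. (of_nat (k choose l))\<^sup>2 * r ^ (2 * l) * (((cmod a)\<^sup>2) ^ (k - l) * ((cmod b)\<^sup>2) ^ l)))"
    by (simp only: of_real_sum[symmetric] sum_distrib_left[symmetric])
  finally show ?thesis by (simp only: of_real_eq_iff)
qed

text \<open>The argument will be the square of a radius, hence nonnegative. The half line is
  infinite, which already exceeds the root count of a nonzero polynomial.\<close>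

lemma nonneg_polynomial_identity:
  fixes c :: "nat \<Rightarrow> real"
  assumes "\<And>x. x \<ge> 0 \<Longrightarrow> (\<Sum>i\<le>k. c i * x ^ i) = 0" "l \<le> k"
  shows "c l = 0"
proof (rule ccontr)
  assume "c l \<noteq> 0"
  with assms(2) have "\<exists>i\<le>k. c i \<noteq> 0" by blast
  from polyfun_rootbound[OF this] have "finite {x. (\<Sum>i\<le>k. c i * x ^ i) = 0}" by blast
  moreover have "{0..} \<subseteq> {x. (\<Sum>i\<le>k. c i * x ^ i) = 0}" using assms(1) by auto
  ultimately show False using infinite_Ici[of "0::real"] finite_subset by blast
qed

text \<open>\<open>rotate_u\<close> says that
  \<open>(u_i + \<tau> * u_j) / sqrt (1 + |\<tau>|^2)\<close>, a coordinate after a unitary rotation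
  of the plane of \<open>i\<close> and \<open>j\<close>, has the same even absolute moments as
  \<open>u_i\<close>. In this form Haar invariance enters the moment computation.\<close>

locale rotation_invariant_vector = prob_space M for M :: "'a measure" +
  fixes N :: nat and u :: "'a \<Rightarrow> nat \<Rightarrow> complex"
  assumes N: "N > 0"
    and measurable_u [measurable]: "\<And>j. j < N \<Longrightarrow> (\<lambda>\<omega>. u \<omega> j) \<in> borel_measurable M"
    and norm_u: "\<And>\<omega>. \<omega> \<in> space M \<Longrightarrow> (\<Sum>j<N. (cmod (u \<omega> j))\<^sup>2) = 1"
    and rotate_u: "\<And>i j \<tau> k. i < N \<Longrightarrow> j < N \<Longrightarrow> i \<noteq> j \<Longrightarrow>
      expectation (\<lambda>\<omega>. cmod (u \<omega> i + \<tau> * u \<omega> j) ^ (2 * k)) =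
      (1 + (cmod \<tau>)\<^sup>2) ^ k * expectation (\<lambda>\<omega>. cmod (u \<omega> i) ^ (2 * k))"
begin

definition w :: "'a \<Rightarrow> nat \<Rightarrow> real" where "w \<omega> j = (cmod (u \<omega> j))\<^sup>2"

lemma w_measurable [measurable]: "j < N \<Longrightarrow> (\<lambda>\<omega>. w \<omega> j) \<in> borel_measurable M"
  by (simp add: w_def)

lemma w_nonneg: "w \<omega> j \<ge> 0"
  by (simp add: w_def)

lemma sum_w: "\<omega> \<in> space M \<Longrightarrow> (\<Sum>j<N. w \<omega> j) = 1"
  using norm_u by (simp add: w_def)

lemma w_le_1: "\<omega> \<in> space M \<Longrightarrow> j < N \<Longrightarrow> w \<omega> j \<le> 1"
  using sum_w[of \<omega>] member_le_sum[of j "{..<N}" "w \<omega>"] w_nonneg by simp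

lemma integrable_w_power [simp]:
  assumes "i < N" "j < N"
  shows "integrable M (\<lambda>\<omega>. w \<omega> i ^ p * w \<omega> j ^ q)"
proof (rule integrable_const_bound[of _ 1])
  show "AE \<omega> in M. norm (w \<omega> i ^ p * w \<omega> j ^ q) \<le> 1"
    using w_le_1 w_nonneg assms by (intro AE_I2) (simp add: mult_le_one power_le_one)
qed (use assms in measurable)

lemma integrable_w_power1 [simp]: "i < N \<Longrightarrow> integrable M (\<lambda>\<omega>. w \<omega> i ^ p)"
  using integrable_w_power[of i i p 0] by simp

text \<open>Invariance is used for \<open>\<tau>\<close> equal to \<open>r\<close> times a root of
  unity. Averaging over the roots leaves a polynomial identity in \<open>x = r^2\<close>, whose l-th
  coefficients give \<open>(k choose l)^2\<close> times the mixed moment on one side and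
  \<open>(k choose l)\<close> times the pure moment on the other.\<close>

lemma mixed_moment:
  assumes "i < N" "j < N" "i \<noteq> j" "l \<le> k"
  shows "expectation (\<lambda>\<omega>. w \<omega> i ^ (k - l) * w \<omega> j ^ l) = expectation (\<lambda>\<omega>. w \<omega> i ^ k) / (k choose l)"
proof -
  define n where "n = Suc k"
  let ?E = "\<lambda>l. expectation (\<lambda>\<omega>. w \<omega> i ^ (k - l) * w \<omega> j ^ l)"
  let ?e = "expectation (\<lambda>\<omega>. w \<omega> i ^ k)"
  \<comment> \<open>The difference of the coefficients of \<open>x ^ l\<close> on the two sides of
    the averaged identity.\<close>
  let ?d = "\<lambda>l. (real (k choose l))\<^sup>2 * ?E l - real (k choose l) * ?e"
  have int: "integrable M (\<lambda>\<omega>. cmod (u \<omega> i + \<tau> * u \<omega> j) ^ (2 * k))" for \<tau>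
  proof (rule integrable_const_bound[of _ "(1 + cmod \<tau>) ^ (2 * k)"])
    have "cmod (u \<omega> i + \<tau> * u \<omega> j) \<le> 1 + cmod \<tau>" if "\<omega> \<in> space M" for \<omega>
    proof -
      have 1: "cmod (u \<omega> i) \<le> 1" "cmod (u \<omega> j) \<le> 1"
        using w_le_1[OF that assms(1)] w_le_1[OF that assms(2)] by (simp_all add: w_def abs_square_le_1)
      have "cmod (u \<omega> i + \<tau> * u \<omega> j) \<le> cmod (u \<omega> i) + cmod \<tau> * cmod (u \<omega> j)"
        using norm_triangle_ineq[of "u \<omega> i" "\<tau> * u \<omega> j"] by (simp add: norm_mult)
      also have "\<dots> \<le> 1 + cmod \<tau> * 1" using 1 by (intro add_mono mult_left_mono) auto
      finally show ?thesis by simp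
    qed
    then show "AE \<omega> in M. norm (cmod (u \<omega> i + \<tau> * u \<omega> j) ^ (2 * k)) \<le> (1 + cmod \<tau>) ^ (2 * k)"
      by (intro AE_I2) (simp add: power_mono)
  qed (use assms in measurable)
  have "(\<Sum>l\<le>k. ?d l * x ^ l) = 0" if "x \<ge> 0" for x
  proof -
    define r where "r = sqrt x"
    have r: "r\<^sup>2 = x" "r ^ (2 * l) = x ^ l" for l using that by (simp_all add: r_def power_mult)
    let ?\<tau> = "\<lambda>m::nat. of_real r * cis (2 * pi * m / n)"
    have "(\<Sum>m<n. expectation (\<lambda>\<omega>. cmod (u \<omega> i + ?\<tau> m * u \<omega> j) ^ (2 * k))) =
        expectation (\<lambda>\<omega>. \<Sum>m<n. cmod (u \<omega> i + ?\<tau> m * u \<omega> j) ^ (2 * k))"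
      by (rule Bochner_Integration.integral_sum[symmetric]) (rule int)
    also have "\<dots> = expectation (\<lambda>\<omega>. n * (\<Sum>l\<le>k. (real (k choose l))\<^sup>2 * r ^ (2 * l) * (w \<omega> i ^ (k - l) * w \<omega> j ^ l)))"
      unfolding sum_cis_norm_power[OF n_def] w_def ..
    also have "\<dots> = n * (\<Sum>l\<le>k. (real (k choose l))\<^sup>2 * x ^ l * ?E l)"
      using assms(1,2) by (simp add: r)
    finally have "(\<Sum>m<n. expectation (\<lambda>\<omega>. cmod (u \<omega> i + ?\<tau> m * u \<omega> j) ^ (2 * k))) =
        n * (\<Sum>l\<le>k. (real (k choose l))\<^sup>2 * x ^ l * ?E l)" .
    moreover have "expectation (\<lambda>\<omega>. cmod (u \<omega> i + ?\<tau> m * u \<omega> j) ^ (2 * k)) = (1 + x) ^ k * ?e" for m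
      using rotate_u[OF assms(1-3), of "?\<tau> m" k] r(1) by (simp add: norm_mult w_def power_mult)
    ultimately have "n * ((1 + x) ^ k * ?e) = n * (\<Sum>l\<le>k. (real (k choose l))\<^sup>2 * x ^ l * ?E l)"
      by simp
    then have "(1 + x) ^ k * ?e = (\<Sum>l\<le>k. (real (k choose l))\<^sup>2 * x ^ l * ?E l)"
      by (simp add: n_def)
    moreover have "(1 + x) ^ k = (\<Sum>l\<le>k. real (k choose l) * x ^ l)"
      using binomial_ring[of x 1 k] by (simp add: add.commute)
    moreover have "(\<Sum>l\<le>k. ?d l * x ^ l) =
        (\<Sum>l\<le>k. (real (k choose l))\<^sup>2 * x ^ l * ?E l) - (\<Sum>l\<le>k. real (k choose l) * x ^ l) * ?e"
      unfolding sum_distrib_right sum_subtractf[symmetric] by (simp add: algebra_simps)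
    ultimately show ?thesis by simp
  qed
  then have "?d l = 0" using assms(4) by (rule nonneg_polynomial_identity)
  moreover have "real (k choose l) \<noteq> 0" using assms(4) by simp
  ultimately show ?thesis by (simp add: power2_eq_square field_simps)
qed

definition e :: "nat \<Rightarrow> real" where "e k = expectation (\<lambda>\<omega>. w \<omega> 0 ^ k)"

text \<open>The case \<open>l = k\<close> of \<open>mixed_moment\<close> moves the full power from
  coordinate 0 to coordinate \<open>i\<close>.\<close>

lemma moment_w: "i < N \<Longrightarrow> expectation (\<lambda>\<omega>. w \<omega> i ^ k) = e k"
  using mixed_moment[of 0 i k k] N by (cases "i = 0") (simp_all add: e_def)

text \<open>Inserting the factor \<open>1 = \<Sum>j<N. w \<omega> j\<close> into the k-th moment
  gives \<open>e (Suc k)\<close> for \<open>j = 0\<close> and \<open>e (Suc k) / (k + 1)\<close> for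
  each of the other \<open>N - 1\<close> indices. The resulting numbers are the moments of the
  Beta(1, N - 1) law.\<close>

lemma e_Suc: "e (Suc k) = e k * (real k + 1) / (real N + real k)"
proof -
  have "e k = expectation (\<lambda>\<omega>. \<Sum>j<N. w \<omega> 0 ^ k * w \<omega> j)"
    unfolding e_def
    by (rule Bochner_Integration.integral_cong) (simp_all add: sum_distrib_left[symmetric] sum_w)
  also have "\<dots> = (\<Sum>j<N. expectation (\<lambda>\<omega>. w \<omega> 0 ^ k * w \<omega> j))"
    using integrable_w_power[of 0 _ k 1] N by (intro Bochner_Integration.integral_sum) simp
  also have "\<dots> = (\<Sum>j<N. if j = 0 then e (Suc k) else e (Suc k) / (k + 1))"
  proof (intro sum.cong refl)
    fix j assume "j \<in> {..<N}"
    then show "expectation (\<lambda>\<omega>. w \<omega> 0 ^ k * w \<omega> j) = (if j = 0 then e (Suc k) else e (Suc k) / (k + 1))"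
      using mixed_moment[of 0 j 1 "Suc k"] N by (auto simp: e_def mult.commute add.commute)
  qed
  also have "\<dots> = e (Suc k) + (real N - 1) * (e (Suc k) / (k + 1))"
  proof -
    have "{..<N} = insert 0 {1..<N}" using N by auto
    then show ?thesis using N by (simp add: of_nat_diff)
  qed
  finally show ?thesis using N by (simp add: field_simps)
qed

lemma e_0: "e 0 = 1"
  by (simp add: e_def prob_space)

lemma e_2: "e 2 = 2 / (real N * (real N + 1))"
proof -
  have "e 1 = 1 / N" using e_Suc[of 0] by (simp add: e_0)
  moreover have "e 2 = e 1 * 2 / (real N + 1)" using e_Suc[of 1] by (simp add: numeral_2_eq_2)
  ultimately show ?thesis by simp
qed

lemma e_3: "e 3 = 6 / (real N * (real N + 1) * (real N + 2))"
proof -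
  have "e 3 = e 2 * 3 / (real N + 2)" using e_Suc[of 2] by simp
  then show ?thesis by (simp add: e_2)
qed

lemma e_4: "e 4 = 24 / (real N * (real N + 1) * (real N + 2) * (real N + 3))"
proof -
  have "e 4 = e 3 * 4 / (real N + 3)" using e_Suc[of 3] by simp
  then show ?thesis by (simp add: e_3)
qed

lemma expectation_sum_w_power: "expectation (\<lambda>\<omega>. \<Sum>j<N. w \<omega> j ^ k) = N * e k"
  by (simp add: moment_w)

text \<open>The squared sum expands into pairs: a diagonal pair contributes \<open>e 4\<close> and
  any other \<open>e 4 / 6\<close>, where 6 is \<open>4 choose 2\<close>. The centre 2 is the limit
  of the mean \<open>2 * N / (N + 1)\<close>.\<close>

lemma expectation_sum_w_squared_deviation:
  "expectation (\<lambda>\<omega>. (N * (\<Sum>j<N. w \<omega> j ^ 2) - 2)\<^sup>2) =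
   4 * (real N)\<^sup>2 * (real N + 5) / ((real N + 1) * (real N + 2) * (real N + 3)) - 8 * real N / (real N + 1) + 4"
proof -
  let ?S = "\<lambda>\<omega>. \<Sum>j<N. w \<omega> j ^ 2"
  have S2: "(?S \<omega>)\<^sup>2 = (\<Sum>i<N. \<Sum>j<N. w \<omega> i ^ 2 * w \<omega> j ^ 2)" for \<omega>
    by (simp add: power2_eq_square[of "?S \<omega>"] sum_product)
  have int: "integrable M (\<lambda>\<omega>. \<Sum>i<N. \<Sum>j<N. w \<omega> i ^ 2 * w \<omega> j ^ 2)"
    by (intro Bochner_Integration.integrable_sum integrable_w_power) auto
  have i1: "integrable M (\<lambda>\<omega>. (?S \<omega>)\<^sup>2)" unfolding S2 by (rule int)
  have i2: "integrable M ?S"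
    by (intro Bochner_Integration.integrable_sum integrable_w_power1) auto
  have "expectation (\<lambda>\<omega>. \<Sum>i<N. \<Sum>j<N. w \<omega> i ^ 2 * w \<omega> j ^ 2) =
     (\<Sum>i<N. \<Sum>j<N. expectation (\<lambda>\<omega>. w \<omega> i ^ 2 * w \<omega> j ^ 2))"
    by (subst Bochner_Integration.integral_sum,
        (intro Bochner_Integration.integrable_sum integrable_w_power; simp),
        intro sum.cong[OF refl] Bochner_Integration.integral_sum integrable_w_power) auto
  also have "\<dots> = (\<Sum>i<N. \<Sum>j<N. if j = i then e 4 else e 4 / 6)"
  proof (intro sum.cong refl)
    fix i j assume "i \<in> {..<N}" "j \<in> {..<N}"
    then show "expectation (\<lambda>\<omega>. w \<omega> i ^ 2 * w \<omega> j ^ 2) = (if j = i then e 4 else e 4 / 6)"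
      using mixed_moment[of i j 2 4] moment_w[of i 4]
      by (auto simp: choose_two simp flip: power_add)
  qed
  also have "\<dots> = (\<Sum>i<N. e 4 + (real N - 1) * (e 4 / 6))"
  proof (intro sum.cong refl)
    fix i assume "i \<in> {..<N}"
    then have "{..<N} = insert i ({..<N} - {i})" by auto
    moreover have "card ({..<N} - {i}) = N - 1" using \<open>i \<in> {..<N}\<close> by simp
    ultimately show "(\<Sum>j<N. if j = i then e 4 else e 4 / 6) = e 4 + (real N - 1) * (e 4 / 6)"
      using N by (subst \<open>{..<N} = _\<close>, subst sum.insert) (auto simp: of_nat_diff)
  qed
  also have "\<dots> = 4 * (real N + 5) / ((real N + 1) * (real N + 2) * (real N + 3))"
  proof -
    define X where "X = (real N + 1) * (real N + 2) * (real N + 3)"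
    have X: "X > 0" by (simp add: X_def)
    have e4: "e 4 = 24 / (N * X)" by (simp add: e_4 X_def mult.assoc)
    have "(\<Sum>i<N. e 4 + (real N - 1) * (e 4 / 6)) = 4 * (real N + 5) / X"
      using N X by (simp add: e4 field_simps)
    then show ?thesis by (simp add: X_def)
  qed
  finally have ES2: "expectation (\<lambda>\<omega>. (?S \<omega>)\<^sup>2) = 4 * (real N + 5) / ((real N + 1) * (real N + 2) * (real N + 3))"
    by (simp add: S2)
  have "expectation (\<lambda>\<omega>. (N * ?S \<omega> - 2)\<^sup>2) = expectation (\<lambda>\<omega>. N\<^sup>2 * (?S \<omega>)\<^sup>2 - 4 * N * ?S \<omega> + 4)"
    by (rule Bochner_Integration.integral_cong) (simp_all add: power2_diff power_mult_distrib)
  also have "\<dots> = N\<^sup>2 * expectation (\<lambda>\<omega>. (?S \<omega>)\<^sup>2) - 4 * N * expectation ?S + 4"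
    using i1 i2 by (simp add: prob_space del: integral_sum Bochner_Integration.integral_sum')
  also have "\<dots> = 4 * (real N)\<^sup>2 * (real N + 5) / ((real N + 1) * (real N + 2) * (real N + 3)) - 8 * real N / (real N + 1) + 4"
    unfolding ES2 expectation_sum_w_power e_2 using N by simp
  finally show ?thesis .
qed

end

subsection \<open>Characteristic functions of randomly weighted sums\<close>

lemma (in prob_space) indep_rv_distr_pair:
  assumes "indep_rv M S X T Y"
  shows "distr M (S \<Otimes>\<^sub>M T) (\<lambda>\<omega>. (X \<omega>, Y \<omega>)) = distr M S X \<Otimes>\<^sub>M distr M T Y"
proof -
  have X [measurable]: "X \<in> measurable M S" and Y [measurable]: "Y \<in> measurable M T"
    using assms by (auto simp: indep_rv_def)
  show ?thesis
  proof (rule pair_measure_eqI[symmetric])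
    show "sigma_finite_measure (distr M S X)"
      by (intro prob_space_imp_sigma_finite prob_space_distr X)
    show "sigma_finite_measure (distr M T Y)"
      by (intro prob_space_imp_sigma_finite prob_space_distr Y)
    show "sets (distr M S X \<Otimes>\<^sub>M distr M T Y) = sets (distr M (S \<Otimes>\<^sub>M T) (\<lambda>\<omega>. (X \<omega>, Y \<omega>)))"
      by simp
    fix A B assume "A \<in> sets (distr M S X)" "B \<in> sets (distr M T Y)"
    then have A [measurable]: "A \<in> sets S" and B [measurable]: "B \<in> sets T" by auto
    have "prob ((X -` A \<inter> space M) \<inter> (Y -` B \<inter> space M)) = prob (X -` A \<inter> space M) * prob (Y -` B \<inter> space M)"
      using assms A B by (intro indep_setD) (auto simp: indep_rv_def)
    moreover have "(\<lambda>\<omega>. (X \<omega>, Y \<omega>)) -` (A \<times> B) \<inter> space M = (X -` A \<inter> space M) \<inter> (Y -` B \<inter> space M)"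
      by auto
    ultimately show "emeasure (distr M S X) A * emeasure (distr M T Y) B =
        emeasure (distr M (S \<Otimes>\<^sub>M T) (\<lambda>\<omega>. (X \<omega>, Y \<omega>))) (A \<times> B)"
      by (simp add: emeasure_distr emeasure_eq_measure ennreal_mult'')
  qed
qed

text \<open>Fubini for the product of the two laws, pulled back to the original space. The inner
  expectation over a second sample point plays the role of conditioning on \<open>X\<close>.\<close>

lemma (in prob_space) indep_rv_integral:
  fixes f :: "'b \<times> 'c \<Rightarrow> 'd::{banach, second_countable_topology}"
  assumes "indep_rv M S X T Y" and f [measurable]: "f \<in> borel_measurable (S \<Otimes>\<^sub>M T)"
    and bound: "\<And>x y. x \<in> space S \<Longrightarrow> y \<in> space T \<Longrightarrow> norm (f (x, y)) \<le> B"
  shows "expectation (\<lambda>\<omega>. f (X \<omega>, Y \<omega>)) = expectation (\<lambda>\<omega>. expectation (\<lambda>\<omega>'. f (X \<omega>, Y \<omega>')))"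
    and "(\<lambda>\<omega>. expectation (\<lambda>\<omega>'. f (X \<omega>, Y \<omega>'))) \<in> borel_measurable M"
proof -
  have X [measurable]: "X \<in> measurable M S" and Y [measurable]: "Y \<in> measurable M T"
    using assms by (auto simp: indep_rv_def)
  interpret S: prob_space "distr M S X" by (rule prob_space_distr[OF X])
  interpret T: prob_space "distr M T Y" by (rule prob_space_distr[OF Y])
  interpret ST: pair_prob_space "distr M S X" "distr M T Y" ..
  have fm: "f \<in> borel_measurable (distr M S X \<Otimes>\<^sub>M distr M T Y)"
    using f by (simp cong: measurable_cong_sets)
  have int: "integrable (distr M S X \<Otimes>\<^sub>M distr M T Y) f"
    by (rule ST.integrable_const_bound[of _ B, OF _ fm]) (auto simp: space_pair_measure intro!: AE_I2 bound)
  have inner: "(\<integral>y. f (x, y) \<partial>distr M T Y) = expectation (\<lambda>\<omega>'. f (x, Y \<omega>'))" if "x \<in> space S" for x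
    using that by (intro integral_distr) measurable
  have im: "(\<lambda>x. \<integral>y. f (x, y) \<partial>distr M T Y) \<in> borel_measurable S"
  proof -
    have "(\<lambda>x. \<integral>y. f (x, y) \<partial>distr M T Y) \<in> borel_measurable (distr M S X)"
      using ST.integrable_fst'[OF int] by simp
    then show ?thesis by simp
  qed
  have "(\<lambda>\<omega>. \<integral>y. f (X \<omega>, y) \<partial>distr M T Y) \<in> borel_measurable M"
    by (rule measurable_compose[OF X im])
  also have "?this \<longleftrightarrow> (\<lambda>\<omega>. expectation (\<lambda>\<omega>'. f (X \<omega>, Y \<omega>'))) \<in> borel_measurable M"
    using measurable_space[OF X] by (intro measurable_cong inner)
  finally show "(\<lambda>\<omega>. expectation (\<lambda>\<omega>'. f (X \<omega>, Y \<omega>'))) \<in> borel_measurable M" .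
  have "expectation (\<lambda>\<omega>. f (X \<omega>, Y \<omega>)) = integral\<^sup>L (distr M (S \<Otimes>\<^sub>M T) (\<lambda>\<omega>. (X \<omega>, Y \<omega>))) f"
    by (rule integral_distr[symmetric]) measurable
  also have "\<dots> = (\<integral>x. \<integral>y. f (x, y) \<partial>distr M T Y \<partial>distr M S X)"
    unfolding indep_rv_distr_pair[OF assms(1)] by (rule ST.integral_fst'[OF int, symmetric])
  also have "\<dots> = expectation (\<lambda>\<omega>. \<integral>y. f (X \<omega>, y) \<partial>distr M T Y)"
    by (rule integral_distr[OF X im])
  also have "\<dots> = expectation (\<lambda>\<omega>. expectation (\<lambda>\<omega>'. f (X \<omega>, Y \<omega>')))"
    using measurable_space[OF X] by (intro Bochner_Integration.integral_cong refl inner)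
  finally show "expectation (\<lambda>\<omega>. f (X \<omega>, Y \<omega>)) = expectation (\<lambda>\<omega>. expectation (\<lambda>\<omega>'. f (X \<omega>, Y \<omega>')))" .
qed

text \<open>The upper bound on \<open>exp (- y)\<close> follows from
  \<open>exp y \<ge> 1 + y + y^2 / 2\<close>, because
  \<open>(1 - y + y^2 / 2) * (1 + y + y^2 / 2) = 1 + y^4 / 4\<close> is at least 1.\<close>

lemma exp_minus_quadratic:
  assumes "0 \<le> (y::real)"
  shows "\<bar>exp (- y) - (1 - y)\<bar> \<le> y\<^sup>2 / 2"
proof -
  have "exp (- y) * (1 + y + y\<^sup>2 / 2) \<le> exp (- y) * exp y"
    using exp_lower_Taylor_quadratic[OF assms] by (intro mult_left_mono) auto
  also have "\<dots> = 1" by (simp add: exp_minus_inverse mult.commute)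
  also have "1 \<le> (1 - y + y\<^sup>2 / 2) * (1 + y + y\<^sup>2 / 2)"
  proof -
    have "(1 - y + y\<^sup>2 / 2) * (1 + y + y\<^sup>2 / 2) = 1 + (y\<^sup>2)\<^sup>2 / 4"
      by (simp add: power2_eq_square algebra_simps)
    then show ?thesis by simp
  qed
  finally have "exp (- y) \<le> 1 - y + y\<^sup>2 / 2"
    by (rule mult_right_le_imp_le) (use assms in \<open>simp add: add_pos_nonneg\<close>)
  moreover have "exp (- y) \<ge> 1 - y" using exp_ge_add_one_self[of "- y"] by simp
  ultimately show ?thesis by simp
qed

text \<open>Both quantities are compared with second order Taylor polynomials. The remainder of the
  oscillating exponential gives the cubic term and that of the Gaussian exponential the quartic
  term; the first two terms are the mismatch of mean and variance.\<close>

lemma (in prob_space) char_near_gaussian: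
  fixes Y :: "'a \<Rightarrow> real"
  assumes [measurable]: "Y \<in> borel_measurable M" and Y: "\<And>\<omega>. \<omega> \<in> space M \<Longrightarrow> \<bar>Y \<omega>\<bar> \<le> B"
    and "s \<ge> 0" "\<sigma> \<ge> 0"
  shows "cmod (expectation (\<lambda>\<omega>. iexp (s * Y \<omega>)) - exp (- (\<sigma> / 2 * s\<^sup>2)))
    \<le> s * \<bar>expectation Y\<bar> + s\<^sup>2 * \<bar>expectation (\<lambda>\<omega>. (Y \<omega>)\<^sup>2) - \<sigma>\<bar> / 2 + s ^ 3 * B ^ 3 / 6 + s ^ 4 * \<sigma>\<^sup>2 / 8"
proof -
  let ?m = "expectation Y" and ?v = "expectation (\<lambda>\<omega>. (Y \<omega>)\<^sup>2)"
  let ?T = "\<lambda>\<omega>. 1 + \<i> * (s * Y \<omega>) - of_real (s\<^sup>2 * (Y \<omega>)\<^sup>2 / 2)"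
  have iY: "integrable M Y" by (rule integrable_const_bound[of _ B]) (use Y in auto)
  have iY2: "integrable M (\<lambda>\<omega>. (Y \<omega>)\<^sup>2)"
    by (rule integrable_const_bound[of _ "B\<^sup>2"]) (use Y in \<open>auto simp: abs_le_square_iff[symmetric] intro!: AE_I2 order_trans[OF Y abs_ge_self]\<close>)
  have ie: "integrable M (\<lambda>\<omega>. iexp (s * Y \<omega>))"
    by (rule integrable_const_bound[of _ 1]) auto
  have iT: "integrable M ?T"
  proof -
    have "integrable M (\<lambda>\<omega>. complex_of_real (s\<^sup>2 * (Y \<omega>)\<^sup>2 / 2))"
      using iY2 by (intro integrable_of_real) auto
    then show ?thesis
      using iY by (intro Bochner_Integration.integrable_add Bochner_Integration.integrable_diff) auto
  qed
  have ET: "expectation ?T = 1 + \<i> * (s * ?m) - of_real (s\<^sup>2 * ?v / 2)"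
    using iY iY2 by (simp add: prob_space flip: of_real_mult)
  have pw: "cmod (iexp (s * Y \<omega>) - ?T \<omega>) \<le> s ^ 3 * B ^ 3 / 6" if "\<omega> \<in> space M" for \<omega>
  proof -
    have "(\<Sum>k\<le>2. (\<i> * of_real (s * Y \<omega>)) ^ k / fact k) = ?T \<omega>"
      by (simp add: numeral_2_eq_2 power2_eq_square fact_numeral mult_ac) 
    then have "cmod (iexp (s * Y \<omega>) - ?T \<omega>) \<le> \<bar>s * Y \<omega>\<bar> ^ 3 / 6"
      using iexp_approx1[of "s * Y \<omega>" 2] by (simp add: numeral_3_eq_3[symmetric] fact_numeral)
    also have "\<bar>s * Y \<omega>\<bar> ^ 3 \<le> (s * B) ^ 3"
      using Y[OF that] \<open>s \<ge> 0\<close> by (intro power_mono) (auto simp: abs_mult intro: mult_left_mono)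
    finally show ?thesis by (simp add: power_mult_distrib)
  qed
  have "cmod (expectation (\<lambda>\<omega>. iexp (s * Y \<omega>)) - expectation ?T) =
      cmod (expectation (\<lambda>\<omega>. iexp (s * Y \<omega>) - ?T \<omega>))"
    using ie iT by simp
  also have "\<dots> \<le> expectation (\<lambda>\<omega>. cmod (iexp (s * Y \<omega>) - ?T \<omega>))"
    by (rule integral_norm_bound)
  also have "\<dots> \<le> expectation (\<lambda>\<omega>. s ^ 3 * B ^ 3 / 6)"
    using ie iT pw by (intro integral_mono) auto
  finally have 1: "cmod (expectation (\<lambda>\<omega>. iexp (s * Y \<omega>)) - expectation ?T) \<le> s ^ 3 * B ^ 3 / 6"
    by (simp add: prob_space)
  let ?y = "\<sigma> / 2 * s\<^sup>2"
  have "expectation ?T - exp (- ?y) = \<i> * (s * ?m) - of_real (s\<^sup>2 * (?v - \<sigma>) / 2) - of_real (exp (- ?y) - (1 - ?y))"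
    unfolding ET by (simp add: exp_of_real[symmetric] field_simps)
  also have "cmod \<dots> \<le> cmod (\<i> * (s * ?m)) + cmod (of_real (s\<^sup>2 * (?v - \<sigma>) / 2)) + cmod (of_real (exp (- ?y) - (1 - ?y)))"
    by (intro order_trans[OF norm_triangle_ineq4] add_right_mono norm_triangle_ineq4)
  also have "cmod (\<i> * (s * ?m)) = s * \<bar>?m\<bar>" using \<open>s \<ge> 0\<close> by (simp add: norm_mult)
  also have "cmod (of_real (s\<^sup>2 * (?v - \<sigma>) / 2)) = s\<^sup>2 * \<bar>?v - \<sigma>\<bar> / 2" unfolding norm_of_real by (simp add: abs_mult)
  also have "cmod (of_real (exp (- ?y) - (1 - ?y))) \<le> ?y\<^sup>2 / 2"
    unfolding norm_of_real using \<open>\<sigma> \<ge> 0\<close> by (intro exp_minus_quadratic) auto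
  also have "?y\<^sup>2 / 2 = s ^ 4 * \<sigma>\<^sup>2 / 8" by (simp add: power_mult_distrib power_divide mult.commute flip: power_mult)
  finally have 2: "cmod (expectation ?T - exp (- ?y)) \<le> s * \<bar>?m\<bar> + s\<^sup>2 * \<bar>?v - \<sigma>\<bar> / 2 + s ^ 4 * \<sigma>\<^sup>2 / 8"
    by simp
  show ?thesis
    using norm_triangle_ineq[of "expectation (\<lambda>\<omega>. iexp (s * Y \<omega>)) - expectation ?T" "expectation ?T - exp (- ?y)"] 1 2
    by simp
qed

text \<open>Independence and additivity of the exponent turn both sides into products of numbers of
  modulus at most 1. Such products differ by at most the sum of the differences of their
  factors.\<close>

lemma (in prob_space) weighted_char_near_gaussian:
  fixes Y :: "nat \<Rightarrow> 'a \<Rightarrow> real"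
  assumes ind: "indep_vars (\<lambda>_. borel) Y {..<N}" 
    and Y: "\<And>j \<omega>. j < N \<Longrightarrow> \<omega> \<in> space M \<Longrightarrow> \<bar>Y j \<omega>\<bar> \<le> B"
    and \<mu>: "\<And>j. j < N \<Longrightarrow> \<bar>expectation (Y j)\<bar> \<le> \<mu>"
    and v: "\<And>j. j < N \<Longrightarrow> \<bar>expectation (\<lambda>\<omega>. (Y j \<omega>)\<^sup>2) - \<sigma>\<bar> \<le> v"
    and s: "\<And>j. j < N \<Longrightarrow> s j \<ge> 0" and "\<sigma> \<ge> 0"
  shows "cmod (expectation (\<lambda>\<omega>. iexp (\<Sum>j<N. s j * Y j \<omega>)) - exp (- (\<sigma> / 2 * (\<Sum>j<N. (s j)\<^sup>2))))
    \<le> (\<Sum>j<N. s j) * \<mu> + (\<Sum>j<N. (s j)\<^sup>2) * v / 2 + (\<Sum>j<N. s j ^ 3) * B ^ 3 / 6 + (\<Sum>j<N. s j ^ 4) * \<sigma>\<^sup>2 / 8"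
proof -
  have mY: "Y j \<in> borel_measurable M" if "j < N" for j
    using ind that by (auto simp: indep_vars_def)
  let ?\<psi> = "\<lambda>j. expectation (\<lambda>\<omega>. iexp (s j * Y j \<omega>))"
  let ?g = "\<lambda>j. complex_of_real (exp (- (\<sigma> / 2 * (s j)\<^sup>2)))"
  have ind': "indep_vars (\<lambda>_. borel) (\<lambda>j \<omega>. iexp (s j * Y j \<omega>)) {..<N}"
    by (rule indep_vars_compose2[OF ind, where Y = "\<lambda>j y. iexp (s j * y)"]) measurable
  have int: "integrable M (\<lambda>\<omega>. iexp (s j * Y j \<omega>))" if "j < N" for j
    using mY[OF that] by (intro integrable_const_bound[of _ 1]) auto
  have "expectation (\<lambda>\<omega>. iexp (\<Sum>j<N. s j * Y j \<omega>)) = expectation (\<lambda>\<omega>. \<Prod>j<N. iexp (s j * Y j \<omega>))"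
    by (simp add: exp_sum sum_distrib_left)
  also have "\<dots> = (\<Prod>j<N. ?\<psi> j)"
    using ind' int by (intro indep_vars_lebesgue_integral) auto
  finally have E: "expectation (\<lambda>\<omega>. iexp (\<Sum>j<N. s j * Y j \<omega>)) = (\<Prod>j<N. ?\<psi> j)" .
  have G: "complex_of_real (exp (- (\<sigma> / 2 * (\<Sum>j<N. (s j)\<^sup>2)))) = (\<Prod>j<N. ?g j)"
    unfolding of_real_prod[symmetric] by (simp add: exp_sum[symmetric] sum_distrib_left sum_negf)
  have "cmod ((\<Prod>j<N. ?\<psi> j) - (\<Prod>j<N. ?g j)) \<le> (\<Sum>j<N. cmod (?\<psi> j - ?g j))"
  proof (rule norm_prod_diff)
    show "cmod (?\<psi> j) \<le> 1" if "j \<in> {..<N}" for j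
    proof -
      have "cmod (?\<psi> j) \<le> expectation (\<lambda>\<omega>. cmod (iexp (s j * Y j \<omega>)))" by (rule integral_norm_bound)
      also have "\<dots> = 1" by (simp add: prob_space)
      finally show ?thesis .
    qed
    show "cmod (?g j) \<le> 1" if "j \<in> {..<N}" for j
      unfolding norm_of_real using \<open>\<sigma> \<ge> 0\<close> by simp
  qed
  also have "\<dots> \<le> (\<Sum>j<N. s j * \<mu> + (s j)\<^sup>2 * v / 2 + s j ^ 3 * B ^ 3 / 6 + s j ^ 4 * \<sigma>\<^sup>2 / 8)"
  proof (rule sum_mono)
    fix j assume "j \<in> {..<N}"
    then have j: "j < N" by simp
    have "cmod (?\<psi> j - ?g j) \<le> s j * \<bar>expectation (Y j)\<bar> + (s j)\<^sup>2 * \<bar>expectation (\<lambda>\<omega>. (Y j \<omega>)\<^sup>2) - \<sigma>\<bar> / 2 + s j ^ 3 * B ^ 3 / 6 + s j ^ 4 * \<sigma>\<^sup>2 / 8"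
      by (rule char_near_gaussian[OF mY[OF j] Y[OF j] s[OF j] \<open>\<sigma> \<ge> 0\<close>])
    also have "\<dots> \<le> s j * \<mu> + (s j)\<^sup>2 * v / 2 + s j ^ 3 * B ^ 3 / 6 + s j ^ 4 * \<sigma>\<^sup>2 / 8"
      using s[OF j] \<mu>[OF j] v[OF j] by (intro add_right_mono add_mono mult_left_mono divide_right_mono) auto
    finally show "cmod (?\<psi> j - ?g j) \<le> s j * \<mu> + (s j)\<^sup>2 * v / 2 + s j ^ 3 * B ^ 3 / 6 + s j ^ 4 * \<sigma>\<^sup>2 / 8" .
  qed
  also have "\<dots> = (\<Sum>j<N. s j) * \<mu> + (\<Sum>j<N. (s j)\<^sup>2) * v / 2 + (\<Sum>j<N. s j ^ 3) * B ^ 3 / 6 + (\<Sum>j<N. s j ^ 4) * \<sigma>\<^sup>2 / 8"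
    by (simp add: sum.distrib sum_distrib_right sum_divide_distrib)
  finally show ?thesis unfolding E G .
qed

lemma borel_measurable_cnj [measurable]: "cnj \<in> borel_measurable borel"
  by (intro borel_measurable_continuous_onI continuous_intros)

text \<open>In the expanded square the diagonal terms are known exactly since \<open>Z\<close> has
  modulus 1, and independence bounds the correlations of distinct variables by
  \<open>\<delta>^2\<close>.\<close>

lemma (in prob_space) second_moment_weighted_sum:
  fixes Z :: "nat \<Rightarrow> 'a \<Rightarrow> complex"
  assumes ind: "indep_vars (\<lambda>_. borel) Z {..<N}"
    and Z: "\<And>j \<omega>. j < N \<Longrightarrow> \<omega> \<in> space M \<Longrightarrow> cmod (Z j \<omega>) = 1"
    and \<delta>: "\<And>j. j < N \<Longrightarrow> cmod (expectation (Z j)) \<le> \<delta>"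
    and a: "\<And>j. j < N \<Longrightarrow> a j \<ge> 0"
  shows "expectation (\<lambda>\<omega>. (cmod (\<Sum>j<N. of_real (a j) * Z j \<omega>))\<^sup>2) \<le> (\<Sum>j<N. (a j)\<^sup>2) + \<delta>\<^sup>2 * (\<Sum>j<N. a j)\<^sup>2"
proof -
  have mZ [measurable]: "Z j \<in> borel_measurable M" if "j < N" for j
    using ind that by (auto simp: indep_vars_def)
  have int: "integrable M (\<lambda>\<omega>. Z i \<omega> * cnj (Z j \<omega>))" if "i < N" "j < N" for i j
    using that by (intro integrable_const_bound[of _ 1]) (auto simp: norm_mult Z intro!: borel_measurable_times mZ measurable_compose[OF mZ borel_measurable_cnj])
  have sq: "complex_of_real ((cmod (\<Sum>j<N. of_real (a j) * Z j \<omega>))\<^sup>2) =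
     (\<Sum>i<N. \<Sum>j<N. of_real (a i * a j) * (Z i \<omega> * cnj (Z j \<omega>)))" for \<omega>
    unfolding complex_norm_square cnj_sum sum_product by (intro sum.cong refl) (simp add: mult_ac)
  \<comment> \<open>The bound \<open>\<delta>^2\<close> is granted to the diagonal as well, so that
    its total is the complete square of \<open>\<Sum>j<N. a j\<close>.\<close>
  have Eij: "cmod (expectation (\<lambda>\<omega>. Z i \<omega> * cnj (Z j \<omega>))) \<le> (if i = j then 1 else 0) + \<delta>\<^sup>2"
    if "i < N" "j < N" for i j
  proof (cases "i = j")
    case True
    have "expectation (\<lambda>\<omega>. Z i \<omega> * cnj (Z j \<omega>)) = expectation (\<lambda>\<omega>. 1)"
      using Z[OF \<open>i < N\<close>] True by (intro Bochner_Integration.integral_cong) (auto simp: complex_norm_square[symmetric])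
    then show ?thesis using True by (simp add: prob_space)
  next
    case False
    let ?Y = "\<lambda>l z. if l = i then z else cnj z"
    have "indep_vars (\<lambda>_. borel) (\<lambda>l \<omega>. ?Y l (Z l \<omega>)) {i, j}"
      using indep_vars_subset[OF ind, of "{i, j}"] that by (intro indep_vars_compose2[where Y = ?Y]) (auto intro: borel_measurable_cnj)
    moreover have "integrable M (\<lambda>\<omega>. ?Y l (Z l \<omega>))" if "l \<in> {i, j}" for l
      using that \<open>i < N\<close> \<open>j < N\<close> by (intro integrable_const_bound[of _ 1]) (auto simp: Z intro: measurable_compose[OF mZ borel_measurable_cnj])
    ultimately have "expectation (\<lambda>\<omega>. \<Prod>l\<in>{i,j}. ?Y l (Z l \<omega>)) = (\<Prod>l\<in>{i,j}. expectation (\<lambda>\<omega>. ?Y l (Z l \<omega>)))"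
      by (intro indep_vars_lebesgue_integral) auto
    then have "expectation (\<lambda>\<omega>. Z i \<omega> * cnj (Z j \<omega>)) = expectation (Z i) * cnj (expectation (Z j))"
      using False by simp
    then have "cmod (expectation (\<lambda>\<omega>. Z i \<omega> * cnj (Z j \<omega>))) = cmod (expectation (Z i)) * cmod (expectation (Z j))"
      by (simp add: norm_mult)
    also have "\<dots> \<le> \<delta> * \<delta>" using \<delta> that by (intro mult_mono) (auto intro: order_trans[OF norm_ge_zero])
    finally show ?thesis using False by (simp add: power2_eq_square)
  qed
  have "complex_of_real (expectation (\<lambda>\<omega>. (cmod (\<Sum>j<N. of_real (a j) * Z j \<omega>))\<^sup>2)) =
     expectation (\<lambda>\<omega>. \<Sum>i<N. \<Sum>j<N. of_real (a i * a j) * (Z i \<omega> * cnj (Z j \<omega>)))"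
    unfolding integral_complex_of_real[symmetric] sq ..
  also have "\<dots> = (\<Sum>i<N. \<Sum>j<N. of_real (a i * a j) * expectation (\<lambda>\<omega>. Z i \<omega> * cnj (Z j \<omega>)))"
    using int by (subst Bochner_Integration.integral_sum, force intro!: Bochner_Integration.integrable_sum,
        intro sum.cong refl, subst Bochner_Integration.integral_sum) auto
  also have "cmod \<dots> \<le> (\<Sum>i<N. \<Sum>j<N. (a i * a j) * ((if i = j then 1 else 0) + \<delta>\<^sup>2))"
  proof (intro sum_norm_le)
    fix i j assume "i \<in> {..<N}" "j \<in> {..<N}"
    then show "cmod (of_real (a i * a j) * expectation (\<lambda>\<omega>. Z i \<omega> * cnj (Z j \<omega>))) \<le> (a i * a j) * ((if i = j then 1 else 0) + \<delta>\<^sup>2)"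
      unfolding norm_mult norm_of_real using a Eij by (intro mult_mono) auto
  qed
  also have "\<dots> = (\<Sum>i<N. (a i)\<^sup>2) + \<delta>\<^sup>2 * (\<Sum>j<N. a j)\<^sup>2"
  proof -
    have "(a i * a j) * ((if i = j then 1 else 0) + \<delta>\<^sup>2) = (if i = j then (a i)\<^sup>2 else 0) + \<delta>\<^sup>2 * (a i * a j)" for i j
      by (simp add: power2_eq_square algebra_simps)
    moreover have "\<delta>\<^sup>2 * (\<Sum>j<N. a j)\<^sup>2 = (\<Sum>i<N. \<Sum>j<N. \<delta>\<^sup>2 * (a i * a j))"
      by (simp only: power2_eq_square[of "\<Sum>j<N. a j"] sum_product) (simp only: sum_distrib_left)
    ultimately show ?thesis
      by (simp add: sum.distrib)
  qed
  finally show ?thesis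
    unfolding norm_of_real by (rule order_trans[OF abs_ge_self])
qed


lemma exp_minus_lipschitz:
  assumes "0 \<le> (x::real)" "0 \<le> y"
  shows "\<bar>exp (- x) - exp (- y)\<bar> \<le> \<bar>x - y\<bar>"
proof -
  have le: "exp (- x) - exp (- y) \<le> y - x" if "x \<le> y" "0 \<le> x" for x y :: real
  proof -
    have "exp (- x) - exp (- y) = exp (- x) * (1 - exp (- (y - x)))"
      by (simp add: right_diff_distrib flip: exp_add)
    also have "\<dots> \<le> 1 * (1 - exp (- (y - x)))"
      using that by (intro mult_right_mono) auto
    also have "\<dots> \<le> y - x" using exp_ge_add_one_self[of "x - y"] by (simp add: algebra_simps)
    finally show ?thesis .
  qed
  show ?thesis
  proof (cases "x \<le> y")
    case True
    then have "exp (- y) \<le> exp (- x)" by simp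
    then show ?thesis using le[OF True assms(1)] True by linarith
  next
    case False
    then have "y \<le> x" by simp
    then have "exp (- x) \<le> exp (- y)" by simp
    then show ?thesis using le[OF \<open>y \<le> x\<close> assms(2)] False by linarith
  qed
qed

lemma Re_squared: "(Re z)\<^sup>2 = (cmod z)\<^sup>2 / 2 + Re (z\<^sup>2) / 2"
  by (simp only: cmod_power2 Re_power2) (simp add: field_simps)

text \<open>\<open>u\<close> carries the randomness of the eigenvectors and \<open>Z\<close> that of
  the eigenvalues. A single \<open>\<delta>\<close> controls all nonzero Fourier coefficients of the
  common law of the \<open>Z j\<close>; when it is small, they are close to those of the uniform law
  on the circle.\<close>

locale weighted_unit_sum = rotation_invariant_vector M N u
  for M :: "'a measure" and N :: nat and u :: "'a \<Rightarrow> nat \<Rightarrow> complex" +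
  fixes Z :: "nat \<Rightarrow> 'a \<Rightarrow> complex" and \<delta> :: real
  assumes indep_Z: "indep_vars (\<lambda>_. borel) Z {..<N}"
    and law_Z: "\<And>j. j < N \<Longrightarrow> distr M borel (Z j) = distr M borel (Z 0)"
    and norm_Z: "\<And>j \<omega>. j < N \<Longrightarrow> \<omega> \<in> space M \<Longrightarrow> cmod (Z j \<omega>) = 1"
    and moment_Z0: "\<And>k. k \<ge> 1 \<Longrightarrow> cmod (expectation (\<lambda>\<omega>. Z 0 \<omega> ^ k)) \<le> \<delta>"
    and indep_uZ: "indep_rv M (PiM {..<N} (\<lambda>_. borel)) (\<lambda>\<omega>. \<lambda>j\<in>{..<N}. u \<omega> j)
       (PiM {..<N} (\<lambda>_. borel)) (\<lambda>\<omega>. \<lambda>j\<in>{..<N}. Z j \<omega>)"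
begin

lemma Z_measurable [measurable]: "j < N \<Longrightarrow> Z j \<in> borel_measurable M"
  using indep_Z by (auto simp: indep_vars_def)

lemma expectation_Z:
  fixes f :: "complex \<Rightarrow> 'b::{banach, second_countable_topology}"
  assumes "j < N" and [measurable]: "f \<in> borel_measurable borel"
  shows "expectation (\<lambda>\<omega>. f (Z j \<omega>)) = expectation (\<lambda>\<omega>. f (Z 0 \<omega>))"
proof -
  have eq: "expectation (\<lambda>\<omega>. f (Z i \<omega>)) = integral\<^sup>L (distr M borel (Z i)) f" if "i < N" for i
    using that by (intro integral_distr[symmetric]) measurable
  show ?thesis unfolding eq[OF assms(1)] eq[OF N] law_Z[OF assms(1)] ..
qed

lemma delta_nonneg: "\<delta> \<ge> 0"
  using moment_Z0[of 1] norm_ge_zero order_trans by blast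

lemma moment_Z:
  assumes "j < N" "k \<ge> 1"
  shows "cmod (expectation (\<lambda>\<omega>. Z j \<omega> ^ k)) \<le> \<delta>" "cmod (expectation (\<lambda>\<omega>. cnj (Z j \<omega>) ^ k)) \<le> \<delta>"
proof -
  show *: "cmod (expectation (\<lambda>\<omega>. Z j \<omega> ^ k)) \<le> \<delta>"
    using moment_Z0[OF assms(2)] expectation_Z[OF assms(1), of "\<lambda>z. z ^ k"] by simp
  have "expectation (\<lambda>\<omega>. cnj (Z j \<omega>) ^ k) = expectation (\<lambda>\<omega>. cnj (Z j \<omega> ^ k))" by simp
  also have "\<dots> = cnj (expectation (\<lambda>\<omega>. Z j \<omega> ^ k))" 
    using assms(1) by (intro integral_bounded_linear[OF bounded_linear_cnj] integrable_const_bound[of _ 1])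
      (auto simp: norm_power norm_Z)
  finally show "cmod (expectation (\<lambda>\<omega>. cnj (Z j \<omega>) ^ k)) \<le> \<delta>" using * by simp
qed

text \<open>On the unit circle \<open>cnj\<close> is inversion, so the product collapses to one
  positive power of \<open>Z j\<close> or of its conjugate.\<close>

lemma mixed_moment_Z:
  assumes "j < N" "k \<noteq> l"
  shows "cmod (expectation (\<lambda>\<omega>. cnj (Z j \<omega>) ^ k * Z j \<omega> ^ l)) \<le> \<delta>"
proof -
  have unit: "cnj z ^ n * z ^ n = 1" if "cmod z = 1" for z n
  proof -
    have "cnj z * z = 1" using complex_norm_square[of z] that by (simp add: mult.commute)
    then show ?thesis by (simp flip: power_mult_distrib)
  qed
  consider "k < l" | "l < k" using assms(2) by linarith
  then show ?thesis
  proof cases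
    case 1
    have "expectation (\<lambda>\<omega>. cnj (Z j \<omega>) ^ k * Z j \<omega> ^ l) = expectation (\<lambda>\<omega>. Z j \<omega> ^ (l - k))"
    proof (rule Bochner_Integration.integral_cong[OF refl])
      fix \<omega> assume "\<omega> \<in> space M"
      have "Z j \<omega> ^ l = Z j \<omega> ^ k * Z j \<omega> ^ (l - k)" using 1 by (simp flip: power_add)
      then have "cnj (Z j \<omega>) ^ k * Z j \<omega> ^ l = (cnj (Z j \<omega>) ^ k * Z j \<omega> ^ k) * Z j \<omega> ^ (l - k)"
        by (simp only: mult.assoc)
      then show "cnj (Z j \<omega>) ^ k * Z j \<omega> ^ l = Z j \<omega> ^ (l - k)"
        using unit[OF norm_Z[OF assms(1) \<open>\<omega> \<in> space M\<close>]] by simp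
    qed
    then show ?thesis using moment_Z(1)[OF assms(1), of "l - k"] 1 by simp
  next
    case 2
    have "expectation (\<lambda>\<omega>. cnj (Z j \<omega>) ^ k * Z j \<omega> ^ l) = expectation (\<lambda>\<omega>. cnj (Z j \<omega>) ^ (k - l))"
    proof (rule Bochner_Integration.integral_cong[OF refl])
      fix \<omega> assume "\<omega> \<in> space M"
      have "cnj (Z j \<omega>) ^ k = cnj (Z j \<omega>) ^ (k - l) * cnj (Z j \<omega>) ^ l" using 2 by (simp flip: power_add)
      then have "cnj (Z j \<omega>) ^ k * Z j \<omega> ^ l = cnj (Z j \<omega>) ^ (k - l) * (cnj (Z j \<omega>) ^ l * Z j \<omega> ^ l)"
        by (simp only: mult.assoc)
      then show "cnj (Z j \<omega>) ^ k * Z j \<omega> ^ l = cnj (Z j \<omega>) ^ (k - l)"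
        using unit[OF norm_Z[OF assms(1) \<open>\<omega> \<in> space M\<close>]] by simp
    qed
    then show ?thesis using moment_Z(2)[OF assms(1), of "k - l"] 2 by simp
  qed
qed

text \<open>The index is shifted: \<open>S k\<close> belongs to the power \<open>Suc k\<close> of
  the variable. Its variance approaches 2, and the factor \<open>1 / sqrt 2\<close> is supplied
  later.\<close>

definition S :: "nat \<Rightarrow> 'a \<Rightarrow> complex" where
  "S k \<omega> = sqrt N * (\<Sum>j<N. w \<omega> j * cnj (Z j \<omega>) ^ Suc k)"

lemma S_measurable [measurable]: "S k \<in> borel_measurable M"
proof -
  have "(\<lambda>\<omega>. cnj (Z j \<omega>)) \<in> borel_measurable M" if "j < N" for j
    using that by (intro measurable_compose[OF Z_measurable borel_measurable_cnj])
  then show ?thesis unfolding S_def[abs_def]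
    by (intro borel_measurable_times borel_measurable_sum borel_measurable_power borel_measurable_of_real w_measurable) auto
qed

lemma norm_S_le:
  assumes "\<omega> \<in> space M"
  shows "cmod (S k \<omega>) \<le> sqrt N"
proof -
  have "cmod (\<Sum>j<N. complex_of_real (w \<omega> j) * cnj (Z j \<omega>) ^ Suc k) \<le> (\<Sum>j<N. w \<omega> j)"
    using assms by (intro sum_norm_le) (simp add: norm_mult norm_power norm_Z w_nonneg)
  then have "cmod (\<Sum>j<N. complex_of_real (w \<omega> j) * cnj (Z j \<omega>) ^ Suc k) \<le> 1"
    by (simp only: sum_w[OF assms])
  then have "sqrt N * cmod (\<Sum>j<N. complex_of_real (w \<omega> j) * cnj (Z j \<omega>) ^ Suc k) \<le> sqrt N * 1"
    by (rule mult_left_mono) simp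
  moreover have "cmod (S k \<omega>) = sqrt N * cmod (\<Sum>j<N. complex_of_real (w \<omega> j) * cnj (Z j \<omega>) ^ Suc k)"
    unfolding S_def norm_mult norm_of_real by simp
  ultimately show ?thesis by simp
qed

lemma integrable_S_square: "integrable M (\<lambda>\<omega>. (cmod (S k \<omega>))\<^sup>2)"
proof (rule integrable_const_bound[of _ "(sqrt N)\<^sup>2"])
  show "AE \<omega> in M. norm ((cmod (S k \<omega>))\<^sup>2) \<le> (sqrt N)\<^sup>2"
  proof (rule AE_I2)
    fix \<omega> assume "\<omega> \<in> space M"
    then have "(cmod (S k \<omega>))\<^sup>2 \<le> (sqrt N)\<^sup>2" by (intro power_mono norm_S_le) auto
    then show "norm ((cmod (S k \<omega>))\<^sup>2) \<le> (sqrt N)\<^sup>2" by simp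
  qed
qed measurable

text \<open>For frozen \<open>u\<close> the conditional second moment is at most
  \<open>N * (\<Sum>j<N. w \<omega> j ^ 2) + N * \<delta>^2\<close>, and the mean of the first term
  is at most 2. No dependence on \<open>k\<close> remains, as the union bound over coefficients
  requires.\<close>

lemma second_moment_S: "expectation (\<lambda>\<omega>. (cmod (S k \<omega>))\<^sup>2) \<le> 2 + N * \<delta>\<^sup>2"
proof -
  let ?f = "\<lambda>(x, y). (cmod (sqrt N * (\<Sum>j<N. complex_of_real ((cmod (x j))\<^sup>2) * cnj (y j) ^ Suc k)))\<^sup>2"
  \<comment> \<open>\<open>indep_rv_integral\<close> asks for a bound on the whole product space.
    Truncation at \<open>N\<close> provides it and changes nothing on actual values, where the
    weights sum to 1 and the \<open>Z j\<close> have modulus 1.\<close>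
  let ?f' = "\<lambda>p. min (?f p) N"
  let ?U = "\<lambda>\<omega>. \<lambda>j\<in>{..<N}. u \<omega> j" and ?Z = "\<lambda>\<omega>. \<lambda>j\<in>{..<N}. Z j \<omega>"
  have f_eq: "?f (?U \<omega>, ?Z \<omega>') = N * (cmod (\<Sum>j<N. of_real (w \<omega> j) * cnj (Z j \<omega>') ^ Suc k))\<^sup>2" for \<omega> \<omega>'
    by (simp add: norm_mult power_mult_distrib w_def)
  have f_le: "?f (?U \<omega>, ?Z \<omega>') \<le> N" if "\<omega> \<in> space M" "\<omega>' \<in> space M" for \<omega> \<omega>'
  proof -
    have "cmod (\<Sum>j<N. complex_of_real (w \<omega> j) * cnj (Z j \<omega>') ^ Suc k) \<le> (\<Sum>j<N. w \<omega> j)"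
      using that by (intro sum_norm_le) (simp add: norm_mult norm_power norm_Z w_nonneg)
    then have "(cmod (\<Sum>j<N. complex_of_real (w \<omega> j) * cnj (Z j \<omega>') ^ Suc k))\<^sup>2 \<le> 1\<^sup>2"
      unfolding sum_w[OF that(1)] by (intro power_mono) auto
    then show ?thesis unfolding f_eq by (intro mult_left_le) auto
  qed
  have m1: "(\<lambda>p. cnj (snd p j)) \<in> borel_measurable (PiM {..<N} (\<lambda>_. borel) \<Otimes>\<^sub>M PiM {..<N} (\<lambda>_. borel))" if "j < N" for j
    using that by (intro measurable_compose[OF _ borel_measurable_cnj]) measurable
  have m: "?f' \<in> borel_measurable (PiM {..<N} (\<lambda>_. borel) \<Otimes>\<^sub>M PiM {..<N} (\<lambda>_. borel))"
    unfolding case_prod_beta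
    by (intro borel_measurable_min borel_measurable_power borel_measurable_norm borel_measurable_times
      borel_measurable_sum m1 borel_measurable_of_real) (auto intro!: borel_measurable_norm)
  have "expectation (\<lambda>\<omega>. (cmod (S k \<omega>))\<^sup>2) = expectation (\<lambda>\<omega>. ?f' (?U \<omega>, ?Z \<omega>))"
    using f_le by (intro Bochner_Integration.integral_cong) (auto simp: S_def w_def)
  also have "\<dots> = expectation (\<lambda>\<omega>. expectation (\<lambda>\<omega>'. ?f' (?U \<omega>, ?Z \<omega>')))"
    by (rule indep_rv_integral(1)[OF indep_uZ m, of N]) auto
  also have "\<dots> \<le> expectation (\<lambda>\<omega>. N * (\<Sum>j<N. w \<omega> j ^ 2) + N * \<delta>\<^sup>2)"
  proof (rule integral_mono)
    have "\<bar>expectation (\<lambda>\<omega>'. ?f' (?U \<omega>, ?Z \<omega>'))\<bar> \<le> N" if "\<omega> \<in> space M" for \<omega>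
    proof -
      have "\<bar>expectation (\<lambda>\<omega>'. ?f' (?U \<omega>, ?Z \<omega>'))\<bar> \<le> expectation (\<lambda>\<omega>'. \<bar>?f' (?U \<omega>, ?Z \<omega>')\<bar>)"
        by (rule integral_abs_bound)
      also have "\<dots> \<le> expectation (\<lambda>\<omega>'. N)"
        by (rule integral_mono_AE') (auto intro!: AE_I2)
      finally show ?thesis by (simp add: prob_space)
    qed
    then show "integrable M (\<lambda>\<omega>. expectation (\<lambda>\<omega>'. ?f' (?U \<omega>, ?Z \<omega>')))"
      by (intro integrable_const_bound[of _ N] indep_rv_integral(2)[OF indep_uZ m, of N]) (auto intro!: AE_I2)
    show "integrable M (\<lambda>\<omega>. N * (\<Sum>j<N. w \<omega> j ^ 2) + N * \<delta>\<^sup>2)"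
      by (intro Bochner_Integration.integrable_add integrable_mult_right Bochner_Integration.integrable_sum integrable_w_power1) auto
    fix \<omega> assume \<omega>: "\<omega> \<in> space M"
    have "expectation (\<lambda>\<omega>'. ?f' (?U \<omega>, ?Z \<omega>')) =
        expectation (\<lambda>\<omega>'. N * (cmod (\<Sum>j<N. of_real (w \<omega> j) * cnj (Z j \<omega>') ^ Suc k))\<^sup>2)"
      using f_le[OF \<omega>] unfolding f_eq[symmetric] by (intro Bochner_Integration.integral_cong) (auto simp: min_absorb1)
    also have "\<dots> = N * expectation (\<lambda>\<omega>'. (cmod (\<Sum>j<N. of_real (w \<omega> j) * cnj (Z j \<omega>') ^ Suc k))\<^sup>2)" by simp
    also have "\<dots> \<le> N * ((\<Sum>j<N. (w \<omega> j)\<^sup>2) + \<delta>\<^sup>2 * (\<Sum>j<N. w \<omega> j)\<^sup>2)"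
    proof (intro mult_left_mono second_moment_weighted_sum)
      show "indep_vars (\<lambda>_. borel) (\<lambda>j \<omega>'. cnj (Z j \<omega>') ^ Suc k) {..<N}"
        by (rule indep_vars_compose2[OF indep_Z, where Y = "\<lambda>j z. cnj z ^ Suc k"])
          (intro borel_measurable_power borel_measurable_cnj)
    qed (use moment_Z(2)[of _ "Suc k"] in \<open>auto simp: norm_mult norm_power norm_Z w_nonneg\<close>)
    finally show "expectation (\<lambda>\<omega>'. ?f' (?U \<omega>, ?Z \<omega>')) \<le> N * (\<Sum>j<N. w \<omega> j ^ 2) + N * \<delta>\<^sup>2"
      by (simp add: sum_w[OF \<omega>] distrib_left)
  qed
  also have "\<dots> = N * expectation (\<lambda>\<omega>. \<Sum>j<N. w \<omega> j ^ 2) + N * \<delta>\<^sup>2"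
  proof -
    have "integrable M (\<lambda>\<omega>. \<Sum>j<N. w \<omega> j ^ 2)"
      by (intro Bochner_Integration.integrable_sum integrable_w_power1) auto
    then show ?thesis by (simp add: prob_space)
  qed
  also have "\<dots> \<le> 2 + N * \<delta>\<^sup>2"
  proof -
    have "real N * (real N * (2 / (real N * (real N + 1)))) \<le> 2" using N by (simp add: divide_simps)
    then show ?thesis unfolding expectation_sum_w_power e_2 by simp
  qed
  finally show ?thesis .
qed


text \<open>For a uniform point on the circle, \<open>H\<close> and \<open>H^2\<close> would have
  mean 0, because they contain only nonzero frequencies of one sign, and \<open>|H|^2\<close> would
  have mean \<open>\<Sum>k<K. |\<beta> k|^2\<close>. Each Fourier coefficient is off by at most
  \<open>\<delta>\<close>, and the sum of the moduli of the coefficients is \<open>b\<close> or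
  \<open>b^2\<close>.\<close>

lemma expectation_trigonometric:
  fixes \<beta> :: "nat \<Rightarrow> complex" and K :: nat
  defines "H \<equiv> \<lambda>z. \<Sum>k<K. \<beta> k * cnj z ^ Suc k" and "b \<equiv> \<Sum>k<K. cmod (\<beta> k)"
  assumes j: "j < N"
  shows "\<omega> \<in> space M \<Longrightarrow> \<bar>Re (H (Z j \<omega>))\<bar> \<le> b"
    and "\<bar>expectation (\<lambda>\<omega>. Re (H (Z j \<omega>)))\<bar> \<le> b * \<delta>"
    and "\<bar>expectation (\<lambda>\<omega>. (Re (H (Z j \<omega>)))\<^sup>2) - (\<Sum>k<K. (cmod (\<beta> k))\<^sup>2) / 2\<bar> \<le> b\<^sup>2 * \<delta>"
proof -
  have mc [measurable]: "(\<lambda>\<omega>. cnj (Z j \<omega>)) \<in> borel_measurable M"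
    using j by (intro measurable_compose[OF Z_measurable borel_measurable_cnj])
  have mZ [measurable]: "Z j \<in> borel_measurable M" using j by simp
  have Hb: "cmod (H (Z j \<omega>)) \<le> b" if "\<omega> \<in> space M" for \<omega>
    unfolding H_def b_def using norm_Z[OF j that] by (intro sum_norm_le) (simp add: norm_mult norm_power)
  then show "\<omega> \<in> space M \<Longrightarrow> \<bar>Re (H (Z j \<omega>))\<bar> \<le> b"
    using abs_Re_le_cmod order_trans by blast
  have mH [measurable]: "(\<lambda>\<omega>. H (Z j \<omega>)) \<in> borel_measurable M"
    unfolding H_def by measurable
  have iH: "integrable M (\<lambda>\<omega>. H (Z j \<omega>))"
    by (rule integrable_const_bound[of _ b]) (use Hb in auto)
  have b: "b \<ge> 0" by (simp add: b_def sum_nonneg)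
  have ip: "integrable M (\<lambda>\<omega>. cnj (Z j \<omega>) ^ k * Z j \<omega> ^ l)" for k l
    by (rule integrable_const_bound[of _ 1]) (use norm_Z[OF j] in \<open>auto simp: norm_mult norm_power\<close>)
  have ip1: "integrable M (\<lambda>\<omega>. cnj (Z j \<omega>) ^ k)" for k
    using ip[of k 0] by simp
  have "expectation (\<lambda>\<omega>. H (Z j \<omega>)) = (\<Sum>k<K. \<beta> k * expectation (\<lambda>\<omega>. cnj (Z j \<omega>) ^ Suc k))"
    unfolding H_def
    by (subst Bochner_Integration.integral_sum, intro integrable_mult_right ip1,
        rule sum.cong[OF refl], rule integral_mult_right_zero)
  also have "cmod \<dots> \<le> (\<Sum>k<K. cmod (\<beta> k) * \<delta>)"
    by (intro sum_norm_le) (simp only: norm_mult, intro mult_left_mono moment_Z(2)[OF j], auto)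
  finally have EH: "cmod (expectation (\<lambda>\<omega>. H (Z j \<omega>))) \<le> b * \<delta>"
    by (simp add: b_def sum_distrib_right)
  have "expectation (\<lambda>\<omega>. Re (H (Z j \<omega>))) = Re (expectation (\<lambda>\<omega>. H (Z j \<omega>)))"
    by (rule integral_Re[OF iH])
  then show "\<bar>expectation (\<lambda>\<omega>. Re (H (Z j \<omega>)))\<bar> \<le> b * \<delta>"
    using EH abs_Re_le_cmod[of "expectation (\<lambda>\<omega>. H (Z j \<omega>))"] by linarith
  have iH2: "integrable M (\<lambda>\<omega>. (H (Z j \<omega>))\<^sup>2)"
    by (rule integrable_const_bound[of _ "b\<^sup>2"]) (use Hb in \<open>auto simp: norm_power intro!: power_mono AE_I2\<close>)
  have iHn: "integrable M (\<lambda>\<omega>. (cmod (H (Z j \<omega>)))\<^sup>2)"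
    by (rule integrable_const_bound[of _ "b\<^sup>2"]) (use Hb in \<open>auto simp: norm_power intro!: power_mono AE_I2\<close>)
  have "expectation (\<lambda>\<omega>. (H (Z j \<omega>))\<^sup>2) =
     expectation (\<lambda>\<omega>. \<Sum>k<K. \<Sum>l<K. \<beta> k * \<beta> l * cnj (Z j \<omega>) ^ (Suc k + Suc l))"
    unfolding H_def power2_eq_square sum_product power_add
    by (intro Bochner_Integration.integral_cong refl sum.cong) (simp only: mult_ac)
  also have "\<dots> = (\<Sum>k<K. \<Sum>l<K. \<beta> k * \<beta> l * expectation (\<lambda>\<omega>. cnj (Z j \<omega>) ^ (Suc k + Suc l)))"
    by (subst Bochner_Integration.integral_sum, intro Bochner_Integration.integrable_sum integrable_mult_right ip1,
        rule sum.cong[OF refl], subst Bochner_Integration.integral_sum, intro integrable_mult_right ip1,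
        rule sum.cong[OF refl], rule integral_mult_right_zero)
  also have "cmod \<dots> \<le> (\<Sum>k<K. \<Sum>l<K. cmod (\<beta> k) * cmod (\<beta> l) * \<delta>)"
    by (intro sum_norm_le) (simp only: norm_mult, intro mult_left_mono moment_Z(2)[OF j], auto)
  also have "\<dots> = b\<^sup>2 * \<delta>"
    by (simp only: b_def power2_eq_square sum_product) (simp only: sum_distrib_right)
  finally have EH2: "cmod (expectation (\<lambda>\<omega>. (H (Z j \<omega>))\<^sup>2)) \<le> b\<^sup>2 * \<delta>" .
  have "complex_of_real (expectation (\<lambda>\<omega>. (cmod (H (Z j \<omega>)))\<^sup>2)) =
     expectation (\<lambda>\<omega>. \<Sum>k<K. \<Sum>l<K. \<beta> k * cnj (\<beta> l) * (cnj (Z j \<omega>) ^ Suc k * Z j \<omega> ^ Suc l))"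
    unfolding integral_complex_of_real[symmetric] complex_norm_square H_def cnj_sum sum_product
    by (intro Bochner_Integration.integral_cong refl sum.cong)
      (simp only: complex_cnj_mult complex_cnj_power complex_cnj_cnj mult_ac)
  also have "\<dots> = (\<Sum>k<K. \<Sum>l<K. \<beta> k * cnj (\<beta> l) * expectation (\<lambda>\<omega>. cnj (Z j \<omega>) ^ Suc k * Z j \<omega> ^ Suc l))"
    by (subst Bochner_Integration.integral_sum, intro Bochner_Integration.integrable_sum integrable_mult_right ip,
        rule sum.cong[OF refl], subst Bochner_Integration.integral_sum, intro integrable_mult_right ip,
        rule sum.cong[OF refl], rule integral_mult_right_zero)
  finally have EN: "complex_of_real (expectation (\<lambda>\<omega>. (cmod (H (Z j \<omega>)))\<^sup>2)) =
     (\<Sum>k<K. \<Sum>l<K. \<beta> k * cnj (\<beta> l) * expectation (\<lambda>\<omega>. cnj (Z j \<omega>) ^ Suc k * Z j \<omega> ^ Suc l))" .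
  have diag: "complex_of_real (\<Sum>k<K. (cmod (\<beta> k))\<^sup>2) = (\<Sum>k<K. \<Sum>l<K. \<beta> k * cnj (\<beta> l) * (if k = l then 1 else 0))"
    by (simp add: if_distrib complex_norm_square flip: of_real_power cong: if_cong)
  have Ekl: "cmod (expectation (\<lambda>\<omega>. cnj (Z j \<omega>) ^ Suc k * Z j \<omega> ^ Suc l) - (if k = l then 1 else 0)) \<le> \<delta>" for k l
  proof (cases "k = l")
    case True
    have "expectation (\<lambda>\<omega>. cnj (Z j \<omega>) ^ Suc k * Z j \<omega> ^ Suc l) = expectation (\<lambda>\<omega>. 1)"
    proof (rule Bochner_Integration.integral_cong[OF refl])
      fix \<omega> assume "\<omega> \<in> space M"
      then have "cnj (Z j \<omega>) * Z j \<omega> = 1"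
        using complex_norm_square[of "Z j \<omega>"] norm_Z[OF j] by (simp add: mult.commute)
      then show "cnj (Z j \<omega>) ^ Suc k * Z j \<omega> ^ Suc l = 1"
        unfolding True power_mult_distrib[symmetric] by simp
    qed
    then show ?thesis using True delta_nonneg by (simp add: prob_space)
  next
    case False
    then show ?thesis using mixed_moment_Z[OF j, of "Suc k" "Suc l"] by simp
  qed
  have "complex_of_real (expectation (\<lambda>\<omega>. (cmod (H (Z j \<omega>)))\<^sup>2) - (\<Sum>k<K. (cmod (\<beta> k))\<^sup>2)) =
     (\<Sum>k<K. \<Sum>l<K. \<beta> k * cnj (\<beta> l) * (expectation (\<lambda>\<omega>. cnj (Z j \<omega>) ^ Suc k * Z j \<omega> ^ Suc l) - (if k = l then 1 else 0)))"
    unfolding of_real_diff EN diag sum_subtractf[symmetric] right_diff_distrib ..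
  also have "cmod \<dots> \<le> (\<Sum>k<K. \<Sum>l<K. cmod (\<beta> k) * cmod (\<beta> l) * \<delta>)"
    by (intro sum_norm_le) (simp only: norm_mult complex_mod_cnj, intro mult_left_mono Ekl, simp)
  also have "\<dots> = b\<^sup>2 * \<delta>"
    by (simp only: b_def power2_eq_square sum_product) (simp only: sum_distrib_right)
  finally have ENb: "\<bar>expectation (\<lambda>\<omega>. (cmod (H (Z j \<omega>)))\<^sup>2) - (\<Sum>k<K. (cmod (\<beta> k))\<^sup>2)\<bar> \<le> b\<^sup>2 * \<delta>"
    unfolding norm_of_real .
  \<comment> \<open>\<open>(Re H)^2\<close> is half of \<open>|H|^2\<close> plus half of the real
    part of \<open>H^2\<close>, so the two errors \<open>b^2 * \<delta>\<close> enter with weight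
    one half each.\<close>
  have "expectation (\<lambda>\<omega>. (Re (H (Z j \<omega>)))\<^sup>2) =
     expectation (\<lambda>\<omega>. (cmod (H (Z j \<omega>)))\<^sup>2) / 2 + Re (expectation (\<lambda>\<omega>. (H (Z j \<omega>))\<^sup>2)) / 2"
    unfolding Re_squared using iHn iH2 integral_Re[OF iH2] by simp
  then show "\<bar>expectation (\<lambda>\<omega>. (Re (H (Z j \<omega>)))\<^sup>2) - (\<Sum>k<K. (cmod (\<beta> k))\<^sup>2) / 2\<bar> \<le> b\<^sup>2 * \<delta>"
    using ENb EH2 abs_Re_le_cmod[of "expectation (\<lambda>\<omega>. (H (Z j \<omega>))\<^sup>2)"] by (simp add: abs_le_iff)
qed

text \<open>The exact second moment simplifies to \<open>4 * (N^2 - N + 6) / D\<close>, which is at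
  most \<open>4 / N\<close>. The first absolute moment follows from the weighted
  arithmetic-geometric mean inequality.\<close>

lemma expectation_abs_sum_w_squared_deviation:
  "integrable M (\<lambda>\<omega>. \<bar>N * (\<Sum>j<N. w \<omega> j ^ 2) - 2\<bar>)"
  "expectation (\<lambda>\<omega>. \<bar>N * (\<Sum>j<N. w \<omega> j ^ 2) - 2\<bar>) \<le> 2 / sqrt N"
proof -
  let ?X = "\<lambda>\<omega>. N * (\<Sum>j<N. w \<omega> j ^ 2) - 2"
  have S1: "integrable M (\<lambda>\<omega>. \<Sum>j<N. w \<omega> j ^ 2)"
    by (intro Bochner_Integration.integrable_sum integrable_w_power1) auto
  then show i1: "integrable M (\<lambda>\<omega>. \<bar>?X \<omega>\<bar>)" by auto
  have [measurable]: "?X \<in> borel_measurable M" using S1 by measurable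
  have i2: "integrable M (\<lambda>\<omega>. (?X \<omega>)\<^sup>2)"
  proof (rule integrable_const_bound[of _ "(real N * real N + 2)\<^sup>2"])
    show "AE \<omega> in M. norm ((?X \<omega>)\<^sup>2) \<le> (real N * real N + 2)\<^sup>2"
    proof (rule AE_I2)
      fix \<omega> assume \<omega>: "\<omega> \<in> space M"
      have "(\<Sum>j<N. w \<omega> j ^ 2) \<le> (\<Sum>j<N. 1)"
        using w_le_1[OF \<omega>] w_nonneg by (intro sum_mono) (simp add: power_le_one)
      then have "N * (\<Sum>j<N. w \<omega> j ^ 2) \<le> real N * real N" by (intro mult_left_mono) auto
      moreover have "N * (\<Sum>j<N. w \<omega> j ^ 2) \<ge> 0" by (intro mult_nonneg_nonneg sum_nonneg) auto
      ultimately have "\<bar>?X \<omega>\<bar> \<le> real N * real N + 2" by linarith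
      then have "\<bar>?X \<omega>\<bar>\<^sup>2 \<le> (real N * real N + 2)\<^sup>2" by (intro power_mono) auto
      then show "norm ((?X \<omega>)\<^sup>2) \<le> (real N * real N + 2)\<^sup>2" by simp
    qed
  qed measurable
  define D where "D = (real N + 1) * (real N + 2) * (real N + 3)"
  have D: "D > 0" by (simp add: D_def)
  have "expectation (\<lambda>\<omega>. (?X \<omega>)\<^sup>2) = 4 * ((real N)\<^sup>2 - N + 6) / D"
  proof -
    have "8 * real N / (real N + 1) = 8 * real N * ((real N + 2) * (real N + 3)) / D"
      by (simp add: D_def)
    moreover have "4 = 4 * D / D" using D by simp
    ultimately have "expectation (\<lambda>\<omega>. (?X \<omega>)\<^sup>2) =
       (4 * (real N)\<^sup>2 * (real N + 5) - 8 * real N * ((real N + 2) * (real N + 3)) + 4 * D) / D"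
      unfolding expectation_sum_w_squared_deviation D_def[symmetric] by (simp only: add_divide_distrib diff_divide_distrib)
    also have "4 * (real N)\<^sup>2 * (real N + 5) - 8 * real N * ((real N + 2) * (real N + 3)) + 4 * D = 4 * ((real N)\<^sup>2 - N + 6)"
      by (simp add: D_def power2_eq_square algebra_simps)
    finally show ?thesis .
  qed
  also have "\<dots> \<le> 4 / N"
  proof -
    have "N * ((real N)\<^sup>2 - N + 6) \<le> D"
      by (simp add: D_def power2_eq_square algebra_simps)
    then show ?thesis using D N by (simp add: field_simps)
  qed
  finally have E2: "expectation (\<lambda>\<omega>. (?X \<omega>)\<^sup>2) \<le> 4 / N" .
  \<comment> \<open>The square root of the bound \<open>4 / N\<close>; with this weight both halves
    of the bound for the mean of \<open>(\<eta> + X^2 / \<eta>) / 2\<close> are equal.\<close>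
  define \<eta> where "\<eta> = 2 / sqrt N"
  have \<eta>: "\<eta> > 0" "4 / N = \<eta> * \<eta>" using N by (auto simp: \<eta>_def)
  have "\<bar>?X \<omega>\<bar> \<le> (\<eta> + (?X \<omega>)\<^sup>2 / \<eta>) / 2" for \<omega>
  proof -
    have "0 \<le> (\<bar>?X \<omega>\<bar> - \<eta>)\<^sup>2" by simp
    then have "2 * \<bar>?X \<omega>\<bar> * \<eta> \<le> \<eta> * \<eta> + (?X \<omega>)\<^sup>2" by (simp add: power2_diff power2_eq_square[of \<eta>])
    then show ?thesis using \<eta>(1) by (simp add: field_simps)
  qed
  then have "expectation (\<lambda>\<omega>. \<bar>?X \<omega>\<bar>) \<le> expectation (\<lambda>\<omega>. (\<eta> + (?X \<omega>)\<^sup>2 / \<eta>) / 2)"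
    using i1 i2 by (intro integral_mono) auto
  also have "\<dots> = (\<eta> + expectation (\<lambda>\<omega>. (?X \<omega>)\<^sup>2) / \<eta>) / 2"
    using i2 by (simp add: prob_space)
  also have "\<dots> \<le> (\<eta> + (\<eta> * \<eta>) / \<eta>) / 2"
    using E2 \<eta> by (intro divide_right_mono add_left_mono) auto
  also have "\<dots> = \<eta>" using \<eta> by simp
  finally show "expectation (\<lambda>\<omega>. \<bar>?X \<omega>\<bar>) \<le> 2 / sqrt N" by (simp add: \<eta>_def)
qed


text \<open>With \<open>u\<close> frozen the linear form is a sum of the independent variables
  \<open>?h (Z j)\<close> with weights \<open>sqrt N * w j\<close>, hence nearly Gaussian with
  characteristic function \<open>exp (- \<sigma> / 2 * Q)\<close>, where \<open>Q\<close> is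
  \<open>N\<close> times the sum of the squared weights. Since \<open>Q\<close> concentrates at 2,
  averaging over \<open>u\<close> gives \<open>exp (- \<sigma>)\<close>.\<close>

theorem char_S_near_gaussian:
  fixes \<beta> :: "nat \<Rightarrow> complex" and K :: nat
  defines "b \<equiv> \<Sum>k<K. cmod (\<beta> k)" and "\<sigma> \<equiv> (\<Sum>k<K. (cmod (\<beta> k))\<^sup>2) / 2"
  shows "cmod (expectation (\<lambda>\<omega>. iexp (Re (\<Sum>k<K. \<beta> k * S k \<omega>))) - exp (- \<sigma>))
    \<le> sqrt N * (b * \<delta>) + b\<^sup>2 * \<delta> + b ^ 3 / sqrt N + 3 * \<sigma>\<^sup>2 / N + \<sigma> / sqrt N"
proof -
  let ?H = "\<lambda>z. \<Sum>k<K. \<beta> k * cnj z ^ Suc k"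
  let ?h = "\<lambda>z. Re (?H z)"
  have \<sigma>: "\<sigma> \<ge> 0" and b: "b \<ge> 0" by (auto simp: \<sigma>_def b_def intro!: sum_nonneg)
  have mh [measurable]: "?h \<in> borel_measurable borel"
    by (intro borel_measurable_continuous_onI continuous_intros)
  let ?P = "PiM {..<N} (\<lambda>_. borel :: complex measure)"
  let ?f = "\<lambda>(x, y). iexp (\<Sum>j<N. sqrt N * (cmod (x j))\<^sup>2 * ?h (y j))"
  let ?U = "\<lambda>\<omega>. \<lambda>j\<in>{..<N}. u \<omega> j" and ?Z = "\<lambda>\<omega>. \<lambda>j\<in>{..<N}. Z j \<omega>"
  have mf: "?f \<in> borel_measurable (?P \<Otimes>\<^sub>M ?P)"
  proof -
    have "(\<lambda>p. snd p j) \<in> borel_measurable (?P \<Otimes>\<^sub>M ?P)" if "j < N" for j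
      using that by (intro measurable_compose[OF measurable_snd measurable_component_singleton]) auto
    then have "(\<lambda>p. ?h (snd p j)) \<in> borel_measurable (?P \<Otimes>\<^sub>M ?P)" if "j < N" for j
      using that by (intro measurable_compose[OF _ mh])
    moreover have "(\<lambda>p. fst p j) \<in> borel_measurable (?P \<Otimes>\<^sub>M ?P)" if "j < N" for j
      using that by (intro measurable_compose[OF measurable_fst measurable_component_singleton]) auto
    ultimately have "(\<lambda>p. sqrt N * (cmod (fst p j))\<^sup>2 * ?h (snd p j)) \<in> borel_measurable (?P \<Otimes>\<^sub>M ?P)" if "j < N" for j
      using that by (intro borel_measurable_times borel_measurable_power borel_measurable_norm borel_measurable_const) auto
    then have "(\<lambda>p. \<Sum>j<N. sqrt N * (cmod (fst p j))\<^sup>2 * ?h (snd p j)) \<in> borel_measurable (?P \<Otimes>\<^sub>M ?P)"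
      by (intro borel_measurable_sum) (simp only: lessThan_iff)
    then show ?thesis unfolding case_prod_beta by measurable
  qed
  have f_eq: "?f (?U \<omega>, ?Z \<omega>') = iexp (\<Sum>j<N. sqrt N * w \<omega> j * ?h (Z j \<omega>'))" for \<omega> \<omega>'
    by (simp add: w_def)
  define G where "G \<omega> = expectation (\<lambda>\<omega>'. ?f (?U \<omega>, ?Z \<omega>'))" for \<omega>
  have mG: "G \<in> borel_measurable M"
    unfolding G_def by (rule indep_rv_integral(2)[OF indep_uZ mf, of 1]) (simp add: case_prod_beta)
  have Gb: "cmod (G \<omega>) \<le> 1" for \<omega>
  proof -
    have "cmod (G \<omega>) \<le> expectation (\<lambda>\<omega>'. cmod (?f (?U \<omega>, ?Z \<omega>')))"
      unfolding G_def by (rule integral_norm_bound)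
    also have "\<dots> = 1" by (simp add: prob_space)
    finally show ?thesis .
  qed
  have iG: "integrable M G" by (rule integrable_const_bound[of _ 1, OF _ mG]) (simp add: Gb)
  have "expectation (\<lambda>\<omega>. iexp (Re (\<Sum>k<K. \<beta> k * S k \<omega>))) = expectation (\<lambda>\<omega>. ?f (?U \<omega>, ?Z \<omega>))"
  proof (rule Bochner_Integration.integral_cong[OF refl])
    fix \<omega>
    have "(\<Sum>k<K. \<beta> k * S k \<omega>) = (\<Sum>k<K. \<Sum>j<N. of_real (sqrt N * w \<omega> j) * (\<beta> k * cnj (Z j \<omega>) ^ Suc k))"
      unfolding S_def sum_distrib_left by (intro sum.cong refl) (simp add: mult_ac)
    also have "\<dots> = (\<Sum>j<N. of_real (sqrt N * w \<omega> j) * ?H (Z j \<omega>))"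
      by (subst sum.swap) (simp only: sum_distrib_left)
    finally have "Re (\<Sum>k<K. \<beta> k * S k \<omega>) = (\<Sum>j<N. sqrt N * w \<omega> j * ?h (Z j \<omega>))"
      by (simp only: Re_sum Re_complex_of_real times_complex.sel Im_complex_of_real mult_zero_left diff_zero)
    then show "iexp (Re (\<Sum>k<K. \<beta> k * S k \<omega>)) = ?f (?U \<omega>, ?Z \<omega>)"
      unfolding f_eq by (simp only:)
  qed
  also have "\<dots> = expectation G"
    unfolding G_def by (rule indep_rv_integral(1)[OF indep_uZ mf, of 1]) (simp add: case_prod_beta)
  finally have EG: "expectation (\<lambda>\<omega>. iexp (Re (\<Sum>k<K. \<beta> k * S k \<omega>))) = expectation G" .
  let ?Q = "\<lambda>\<omega>. N * (\<Sum>j<N. w \<omega> j ^ 2)"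
  \<comment> \<open>In order: bias of the mean, error of the variance, cubic and quartic Taylor
    terms, and the cost of replacing the random \<open>?Q \<omega>\<close> by 2.\<close>
  let ?E = "\<lambda>\<omega>. sqrt N * (b * \<delta>) + ?Q \<omega> * (b\<^sup>2 * \<delta>) / 2 +
      sqrt N ^ 3 * (\<Sum>j<N. w \<omega> j ^ 3) * b ^ 3 / 6 + N\<^sup>2 * (\<Sum>j<N. w \<omega> j ^ 4) * \<sigma>\<^sup>2 / 8 + \<sigma> / 2 * \<bar>?Q \<omega> - 2\<bar>"
  have pw: "cmod (G \<omega> - exp (- \<sigma>)) \<le> ?E \<omega>" if \<omega>: "\<omega> \<in> space M" for \<omega>
  proof -
    let ?s = "\<lambda>j. sqrt N * w \<omega> j"
    have s2: "(\<Sum>j<N. (?s j)\<^sup>2) = ?Q \<omega>"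
      by (simp add: power_mult_distrib sum_distrib_left)
    have s1: "(\<Sum>j<N. ?s j) = sqrt N" using sum_w[OF \<omega>] by (simp add: sum_distrib_left[symmetric])
    have s3: "(\<Sum>j<N. ?s j ^ 3) = sqrt N ^ 3 * (\<Sum>j<N. w \<omega> j ^ 3)"
      by (simp add: power_mult_distrib sum_distrib_left)
    have "sqrt N ^ 4 = (real N)\<^sup>2"
      using power_mult[of "sqrt N" 2 2] by simp
    then have s4: "(\<Sum>j<N. ?s j ^ 4) = N\<^sup>2 * (\<Sum>j<N. w \<omega> j ^ 4)"
      by (simp add: power_mult_distrib sum_distrib_left)
    have "cmod (expectation (\<lambda>\<omega>'. iexp (\<Sum>j<N. ?s j * ?h (Z j \<omega>'))) - exp (- (\<sigma> / 2 * (\<Sum>j<N. (?s j)\<^sup>2))))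
      \<le> (\<Sum>j<N. ?s j) * (b * \<delta>) + (\<Sum>j<N. (?s j)\<^sup>2) * (b\<^sup>2 * \<delta>) / 2 + (\<Sum>j<N. ?s j ^ 3) * b ^ 3 / 6 + (\<Sum>j<N. ?s j ^ 4) * \<sigma>\<^sup>2 / 8"
    proof (rule weighted_char_near_gaussian)
      show "indep_vars (\<lambda>_. borel) (\<lambda>j \<omega>'. ?h (Z j \<omega>')) {..<N}"
        by (rule indep_vars_compose2[OF indep_Z mh])
    qed (use \<sigma> w_nonneg expectation_trigonometric[where K = K and \<beta> = \<beta>, folded b_def \<sigma>_def] in auto)
    then have 1: "cmod (G \<omega> - exp (- (\<sigma> / 2 * ?Q \<omega>))) \<le>
       sqrt N * (b * \<delta>) + ?Q \<omega> * (b\<^sup>2 * \<delta>) / 2 + sqrt N ^ 3 * (\<Sum>j<N. w \<omega> j ^ 3) * b ^ 3 / 6 + N\<^sup>2 * (\<Sum>j<N. w \<omega> j ^ 4) * \<sigma>\<^sup>2 / 8"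
      unfolding s1 s2 s3 s4 G_def f_eq by (simp only: mult.assoc)
    have "?Q \<omega> \<ge> 0" by (intro mult_nonneg_nonneg sum_nonneg) auto
    then have "\<bar>exp (- (\<sigma> / 2 * ?Q \<omega>)) - exp (- \<sigma>)\<bar> \<le> \<bar>\<sigma> / 2 * ?Q \<omega> - \<sigma>\<bar>"
      using \<sigma> by (intro exp_minus_lipschitz) auto
    also have "\<sigma> / 2 * ?Q \<omega> - \<sigma> = \<sigma> / 2 * (?Q \<omega> - 2)" by (simp add: algebra_simps)
    also have "\<bar>\<sigma> / 2 * (?Q \<omega> - 2)\<bar> = \<sigma> / 2 * \<bar>?Q \<omega> - 2\<bar>" using \<sigma> by (simp add: abs_mult)
    finally have "cmod (complex_of_real (exp (- (\<sigma> / 2 * ?Q \<omega>))) - complex_of_real (exp (- \<sigma>))) \<le> \<sigma> / 2 * \<bar>?Q \<omega> - 2\<bar>"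
      unfolding of_real_diff[symmetric] norm_of_real .
    then show ?thesis
      using 1 norm_triangle_ineq[of "G \<omega> - exp (- (\<sigma> / 2 * ?Q \<omega>))" "complex_of_real (exp (- (\<sigma> / 2 * ?Q \<omega>))) - exp (- \<sigma>)"]
      by simp
  qed
  have iw: "integrable M (\<lambda>\<omega>. \<Sum>j<N. w \<omega> j ^ k)" for k
    by (intro Bochner_Integration.integrable_sum integrable_w_power1) auto
  have iE: "integrable M ?E"
    using iw expectation_abs_sum_w_squared_deviation(1)
    by (intro Bochner_Integration.integrable_add integrable_mult_right integrable_mult_left integrable_divide) auto
  have "expectation G - exp (- \<sigma>) = expectation (\<lambda>\<omega>. G \<omega> - exp (- \<sigma>))"
    using iG by (simp add: prob_space)
  also have "cmod \<dots> \<le> expectation (\<lambda>\<omega>. cmod (G \<omega> - exp (- \<sigma>)))" by (rule integral_norm_bound)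
  also have "\<dots> \<le> expectation ?E"
    using iG iE pw by (intro integral_mono) auto
  also have "\<dots> = sqrt N * (b * \<delta>) + N * (N * e 2) * (b\<^sup>2 * \<delta>) / 2 +
      sqrt N ^ 3 * (N * e 3) * b ^ 3 / 6 + N\<^sup>2 * (N * e 4) * \<sigma>\<^sup>2 / 8 + \<sigma> / 2 * expectation (\<lambda>\<omega>. \<bar>?Q \<omega> - 2\<bar>)"
    unfolding expectation_sum_w_power[symmetric]
    using iw expectation_abs_sum_w_squared_deviation(1)
    by (simp add: prob_space del: Bochner_Integration.integral_sum)
  also have "\<dots> \<le> sqrt N * (b * \<delta>) + b\<^sup>2 * \<delta> + b ^ 3 / sqrt N + 3 * \<sigma>\<^sup>2 / N + \<sigma> / sqrt N"
  proof (intro add_mono order_refl)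
    have "N * (N * e 2) \<le> 2" using N by (simp add: e_2 divide_simps)
    then have "N * (N * e 2) * (b\<^sup>2 * \<delta>) \<le> 2 * (b\<^sup>2 * \<delta>)"
      using delta_nonneg by (intro mult_right_mono) auto
    then show "N * (N * e 2) * (b\<^sup>2 * \<delta>) / 2 \<le> b\<^sup>2 * \<delta>" by simp
    \<comment> \<open>As \<open>e 3\<close> is of order N^-3, the cubic term is of order N^(-1/2);
      multiplying by \<open>sqrt N\<close> avoids fractional powers in the estimate.\<close>
    have "sqrt N ^ 3 * (N * e 3) \<le> 6 / sqrt N"
    proof -
      have "sqrt N * (sqrt N ^ 3 * (N * e 3)) = sqrt N ^ 4 * (N * e 3)"
        by (simp add: eval_nat_numeral)
      also have "\<dots> = (real N)\<^sup>2 * (N * e 3)"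
        using power_mult[of "sqrt N" 2 2] by simp
      also have "\<dots> = 6 * ((real N)\<^sup>2 / ((real N + 1) * (real N + 2)))"
        using N by (simp add: e_3)
      also have "\<dots> \<le> 6 * 1"
      proof (intro mult_left_mono)
        have "(real N + 1) * (real N + 2) > 0" by (intro mult_pos_pos) auto
        moreover have "(real N)\<^sup>2 \<le> (real N + 1) * (real N + 2)" by (simp add: power2_eq_square algebra_simps)
        ultimately show "(real N)\<^sup>2 / ((real N + 1) * (real N + 2)) \<le> 1" by (subst divide_le_eq_1_pos)
      qed simp
      finally show ?thesis using N by (simp add: field_simps)
    qed
    then have "sqrt N ^ 3 * (N * e 3) * b ^ 3 \<le> 6 / sqrt N * b ^ 3" using b by (intro mult_right_mono) auto
    then show "sqrt N ^ 3 * (N * e 3) * b ^ 3 / 6 \<le> b ^ 3 / sqrt N" by (simp add: mult.commute)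
    have "N\<^sup>2 * (N * e 4) \<le> 24 / N"
    proof -
      have "N * (N\<^sup>2 * (N * e 4)) = 24 * ((real N * real N * real N) / ((real N + 1) * (real N + 2) * (real N + 3)))"
        using N by (simp add: e_4 power2_eq_square mult_ac)
      also have "\<dots> \<le> 24 * 1"
      proof (intro mult_left_mono)
        have "(real N + 1) * (real N + 2) * (real N + 3) > 0" by (intro mult_pos_pos) auto
        moreover have "real N * real N * real N \<le> (real N + 1) * (real N + 2) * (real N + 3)"
          by (intro mult_mono) auto
        ultimately show "real N * real N * real N / ((real N + 1) * (real N + 2) * (real N + 3)) \<le> 1"
          by (subst divide_le_eq_1_pos)
      qed simp
      finally show ?thesis using N by (simp add: field_simps)
    qed
    then have "N\<^sup>2 * (N * e 4) * \<sigma>\<^sup>2 \<le> 24 / N * \<sigma>\<^sup>2" by (intro mult_right_mono) auto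
    then show "N\<^sup>2 * (N * e 4) * \<sigma>\<^sup>2 / 8 \<le> 3 * \<sigma>\<^sup>2 / N" by simp
    have "\<sigma> / 2 * expectation (\<lambda>\<omega>. \<bar>?Q \<omega> - 2\<bar>) \<le> \<sigma> / 2 * (2 / sqrt N)"
      using \<sigma> by (intro mult_left_mono expectation_abs_sum_w_squared_deviation(2)) auto
    then show "\<sigma> / 2 * expectation (\<lambda>\<omega>. \<bar>?Q \<omega> - 2\<bar>) \<le> \<sigma> / sqrt N" by simp
  qed
  finally show ?thesis unfolding EG .
qed

end

subsection \<open>Standard complex Gaussian variables\<close>

text \<open>Lebesgue measure is determined by its values on boxes, and a complex box is a product of
  two intervals. This makes planar densities accessible coordinate by coordinate.\<close>

lemma lborel_complex_eq_distr_pair: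
  "(lborel :: complex measure) = distr (lborel \<Otimes>\<^sub>M lborel) borel (\<lambda>(x, y). Complex x y)"
proof (rule lborel_eqI)
  have [measurable]: "(\<lambda>(x, y). Complex x y) \<in> borel_measurable (borel \<Otimes>\<^sub>M borel)"
    unfolding borel_prod Complex_eq case_prod_beta by (intro borel_measurable_continuous_onI continuous_intros)
  fix l u :: complex assume le: "\<And>b. b \<in> Basis \<Longrightarrow> l \<bullet> b \<le> u \<bullet> b"
  then have le': "Re l \<le> Re u" "Im l \<le> Im u"
    using le[of 1] le[of \<i>] by (simp_all add: Basis_complex_def inner_complex_def)
  have "(\<lambda>(x, y). Complex x y) -` box l u \<inter> space (lborel \<Otimes>\<^sub>M lborel) = {Re l<..<Re u} \<times> {Im l<..<Im u}"
    by (auto simp: box_def Basis_complex_def inner_complex_def space_pair_measure)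
  then show "emeasure (distr (lborel \<Otimes>\<^sub>M lborel) borel (\<lambda>(x, y). Complex x y)) (box l u) = (\<Prod>b\<in>Basis. (u - l) \<bullet> b)"
    using le' by (subst emeasure_distr)
      (auto simp: lborel.emeasure_pair_measure_Times ennreal_mult[symmetric] Basis_complex_def inner_complex_def
        complex_eq_iff)
qed simp

text \<open>The centred normal law of variance 1/2, which is the law of the real and of the
  imaginary part of a standard complex Gaussian.\<close>

definition half_normal :: "real measure" where
  "half_normal = density lborel (normal_density 0 (1 / sqrt 2))"

lemma prob_space_half_normal: "prob_space half_normal"
  unfolding half_normal_def by (rule prob_space_normal_density) simp

lemma char_half_normal: "(\<integral>x. iexp (p * x) \<partial>half_normal) = exp (- p\<^sup>2 / 4)"
proof -
  interpret N: prob_space std_normal_distribution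
    by (rule prob_space_normal_density) simp
  have "distributed std_normal_distribution lborel (\<lambda>x. x) (normal_density 0 1)"
    unfolding distributed_def by (simp add: distr_id2)
  then have "distributed std_normal_distribution lborel (\<lambda>x. 0 + (1 / sqrt 2) * x) (normal_density (0 + (1 / sqrt 2) * 0) (\<bar>1 / sqrt 2\<bar> * 1))"
    by (rule N.normal_density_affine) auto
  then have hn: "half_normal = distr std_normal_distribution lborel (\<lambda>x. (1 / sqrt 2) * x)"
    by (simp add: half_normal_def distributed_def)
  have "(\<integral>x. iexp (p * x) \<partial>half_normal) = (\<integral>x. iexp (p * ((1 / sqrt 2) * x)) \<partial>std_normal_distribution)"
    unfolding hn by (rule integral_distr) measurable
  also have "\<dots> = char std_normal_distribution (p / sqrt 2)"
    unfolding char_def by simp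
  also have "\<dots> = exp (- p\<^sup>2 / 4)"
    by (simp only: char_std_normal_distribution) (simp add: power_divide del: exp_of_real)
  finally show ?thesis .
qed

text \<open>The density \<open>exp (- |z|^2) / pi\<close> is the product of two normal densities of
  variance 1/2, so the real and imaginary parts are independent.\<close>

lemma distr_std_complex_gaussian:
  assumes "std_complex_gaussian Q X"
  shows "X \<in> borel_measurable Q"
    and "distr Q borel X = distr (half_normal \<Otimes>\<^sub>M half_normal) borel (\<lambda>(x, y). Complex x y)"
proof -
  have D: "distributed Q lborel X (\<lambda>z. ennreal (exp (- (cmod z)\<^sup>2) / pi))"
    using assms by (simp add: std_complex_gaussian_def)
  then show "X \<in> borel_measurable Q" by (simp add: distributed_def)
  have C [measurable]: "(\<lambda>(x, y). Complex x y) \<in> borel_measurable (borel \<Otimes>\<^sub>M borel)"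
    unfolding borel_prod Complex_eq case_prod_beta by (intro borel_measurable_continuous_onI continuous_intros)
  have C': "(\<lambda>(x, y). Complex x y) \<in> borel_measurable (lborel \<Otimes>\<^sub>M lborel)"
    using C by (simp cong: measurable_cong_sets add: lborel_prod)
  have nd: "normal_density 0 (1 / sqrt 2) x * normal_density 0 (1 / sqrt 2) y = exp (- (cmod (Complex x y))\<^sup>2) / pi" for x y
    by (simp add: normal_density_def cmod_power2 power_divide exp_add[symmetric] real_sqrt_divide algebra_simps)
  interpret hn: prob_space half_normal by (rule prob_space_half_normal)
  have "distr Q borel X = distr Q lborel X" by (rule distr_cong) auto
  also have "\<dots> = density lborel (\<lambda>z. ennreal (exp (- (cmod z)\<^sup>2) / pi))"
    using D by (simp add: distributed_def)
  also have "\<dots> = density (distr (lborel \<Otimes>\<^sub>M lborel) borel (\<lambda>(x, y). Complex x y)) (\<lambda>z. ennreal (exp (- (cmod z)\<^sup>2) / pi))"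
    by (simp only: lborel_complex_eq_distr_pair)
  also have "\<dots> = distr (density (lborel \<Otimes>\<^sub>M lborel) (\<lambda>p. ennreal (exp (- (cmod (case p of (x, y) \<Rightarrow> Complex x y))\<^sup>2) / pi))) borel (\<lambda>(x, y). Complex x y)"
    by (rule density_distr[OF _ C']) measurable
  also have "density (lborel \<Otimes>\<^sub>M lborel) (\<lambda>p. ennreal (exp (- (cmod (case p of (x, y) \<Rightarrow> Complex x y))\<^sup>2) / pi)) = half_normal \<Otimes>\<^sub>M half_normal"
  proof -
    have "half_normal \<Otimes>\<^sub>M half_normal = density (lborel \<Otimes>\<^sub>M lborel)
       (\<lambda>(x, y). ennreal (normal_density 0 (1 / sqrt 2) x) * ennreal (normal_density 0 (1 / sqrt 2) y))"
      unfolding half_normal_def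
      by (rule pair_measure_density)
        (use prob_space_half_normal[unfolded half_normal_def] in \<open>auto intro: prob_space_imp_sigma_finite lborel.sigma_finite_measure_axioms\<close>)
    also have "\<dots> = density (lborel \<Otimes>\<^sub>M lborel) (\<lambda>p. ennreal (exp (- (cmod (case p of (x, y) \<Rightarrow> Complex x y))\<^sup>2) / pi))"
      by (intro arg_cong[where f = "density _"] ext) (auto simp: nd[symmetric] ennreal_mult)
    finally show ?thesis ..
  qed
  finally show "distr Q borel X = distr (half_normal \<Otimes>\<^sub>M half_normal) borel (\<lambda>(x, y). Complex x y)" .
qed

lemma char_std_complex_gaussian:
  assumes X: "std_complex_gaussian Q X"
  shows "(\<integral>\<omega>. iexp (Re (\<alpha> * X \<omega>)) \<partial>Q) = exp (- (cmod \<alpha>)\<^sup>2 / 4)"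
proof -
  note mX [measurable] = distr_std_complex_gaussian(1)[OF X]
  interpret hn: prob_space half_normal by (rule prob_space_half_normal)
  interpret pp: pair_prob_space half_normal half_normal ..
  have [simp, measurable_cong]: "sets half_normal = sets borel" by (simp add: half_normal_def)
  have [measurable]: "(\<lambda>(x, y). Complex x y) \<in> borel_measurable (borel \<Otimes>\<^sub>M borel)"
    unfolding borel_prod Complex_eq case_prod_beta by (intro borel_measurable_continuous_onI continuous_intros)
  have "(\<integral>\<omega>. iexp (Re (\<alpha> * X \<omega>)) \<partial>Q) = (\<integral>z. iexp (Re (\<alpha> * z)) \<partial>distr Q borel X)"
    by (rule integral_distr[symmetric]) measurable
  also have "\<dots> = (\<integral>p. iexp (Re (\<alpha> * (case p of (x, y) \<Rightarrow> Complex x y))) \<partial>(half_normal \<Otimes>\<^sub>M half_normal))"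
    unfolding distr_std_complex_gaussian(2)[OF X] by (rule integral_distr) measurable
  also have "\<dots> = (\<integral>p. iexp (Re \<alpha> * fst p) * iexp (- Im \<alpha> * snd p) \<partial>(half_normal \<Otimes>\<^sub>M half_normal))"
    by (intro Bochner_Integration.integral_cong refl) (auto simp: exp_add[symmetric] algebra_simps)
  also have "\<dots> = (\<integral>x. \<integral>y. iexp (Re \<alpha> * x) * iexp (- Im \<alpha> * y) \<partial>half_normal \<partial>half_normal)"
  proof -
    have "integrable (half_normal \<Otimes>\<^sub>M half_normal) (\<lambda>p. iexp (Re \<alpha> * fst p) * iexp (- Im \<alpha> * snd p))"
      by (rule pp.integrable_const_bound[of _ 1]) (auto simp: norm_mult)
    from pp.integral_fst'[OF this] show ?thesis by simp
  qed
  also have "\<dots> = exp (- (Re \<alpha>)\<^sup>2 / 4) * exp (- (- Im \<alpha>)\<^sup>2 / 4)"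
    by (simp only: integral_mult_right_zero integral_mult_left_zero char_half_normal) (simp only: of_real_mult)
  also have "\<dots> = exp (- (cmod \<alpha>)\<^sup>2 / 4)"
    by (simp only: of_real_mult[symmetric] exp_add[symmetric])
      (simp add: cmod_power2 add_divide_distrib[symmetric] del: exp_of_real)
  finally show ?thesis by simp
qed

text \<open>The second moment is not evaluated. It is written as one integral independent of
  \<open>X\<close>, which gives the same bound for all coefficients.\<close>

lemma integrable_std_complex_gaussian_square:
  assumes X: "std_complex_gaussian Q X"
  shows "integrable Q (\<lambda>\<omega>. (cmod (X \<omega>))\<^sup>2)"
    and "(\<integral>\<omega>. (cmod (X \<omega>))\<^sup>2 \<partial>Q) = (\<integral>z. (cmod z)\<^sup>2 \<partial>distr (half_normal \<Otimes>\<^sub>M half_normal) borel (\<lambda>(x, y). Complex x y))"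
proof -
  note mX [measurable] = distr_std_complex_gaussian(1)[OF X]
  interpret hn: prob_space half_normal by (rule prob_space_half_normal)
  interpret pp: pair_prob_space half_normal half_normal ..
  have [simp, measurable_cong]: "sets half_normal = sets borel" by (simp add: half_normal_def)
  have [measurable]: "(\<lambda>(x, y). Complex x y) \<in> borel_measurable (borel \<Otimes>\<^sub>M borel)"
    unfolding borel_prod Complex_eq case_prod_beta by (intro borel_measurable_continuous_onI continuous_intros)
  show "(\<integral>\<omega>. (cmod (X \<omega>))\<^sup>2 \<partial>Q) = (\<integral>z. (cmod z)\<^sup>2 \<partial>distr (half_normal \<Otimes>\<^sub>M half_normal) borel (\<lambda>(x, y). Complex x y))"
    unfolding distr_std_complex_gaussian(2)[OF X, symmetric] by (rule integral_distr[symmetric]) measurable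
  have "integrable half_normal (\<lambda>x. x\<^sup>2)"
    using integrable_normal_moment[of "1 / sqrt 2" 0 2]
    unfolding half_normal_def by (subst integrable_density) auto
  then have fin: "(\<integral>\<^sup>+x. ennreal (x\<^sup>2) \<partial>half_normal) < \<infinity>"
    by (auto simp: integrable_iff_bounded)
  have "(\<integral>\<^sup>+p. ennreal ((fst p)\<^sup>2) + ennreal ((snd p)\<^sup>2) \<partial>(half_normal \<Otimes>\<^sub>M half_normal)) =
     (\<integral>\<^sup>+x. \<integral>\<^sup>+y. ennreal (x\<^sup>2) + ennreal (y\<^sup>2) \<partial>half_normal \<partial>half_normal)"
    by (subst hn.nn_integral_fst[symmetric]) auto
  also have "\<dots> = (\<integral>\<^sup>+x. ennreal (x\<^sup>2) \<partial>half_normal) + (\<integral>\<^sup>+x. ennreal (x\<^sup>2) \<partial>half_normal)"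
    by (simp add: nn_integral_add hn.emeasure_space_1)
  also have "\<dots> < \<infinity>" using fin by simp
  finally have "integrable (half_normal \<Otimes>\<^sub>M half_normal) (\<lambda>p. (cmod (case p of (x, y) \<Rightarrow> Complex x y))\<^sup>2)"
    by (auto simp: integrable_iff_bounded cmod_power2 case_prod_beta)
  then have "integrable (distr (half_normal \<Otimes>\<^sub>M half_normal) borel (\<lambda>(x, y). Complex x y)) (\<lambda>z. (cmod z)\<^sup>2)"
    by (subst integrable_distr_eq) auto
  then show "integrable Q (\<lambda>\<omega>. (cmod (X \<omega>))\<^sup>2)"
    unfolding distr_std_complex_gaussian(2)[OF X, symmetric] by (subst (asm) integrable_distr_eq) auto
qed

lemma char_indep_std_complex_gaussian:
  assumes "prob_space Q" and c: "\<And>k. k \<ge> 1 \<Longrightarrow> std_complex_gaussian Q (c k)"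
    and ind: "prob_space.indep_vars Q (\<lambda>_. borel) c {1..}"
  shows "(\<integral>\<omega>. iexp (Re (\<Sum>k<K. \<alpha> k * c (Suc k) \<omega>)) \<partial>Q) = exp (- (\<Sum>k<K. (cmod (\<alpha> k))\<^sup>2) / 4)"
proof -
  interpret Q: prob_space Q by fact
  let ?I = "Suc ` {..<K}"
  have mc [measurable]: "c (Suc k) \<in> borel_measurable Q" for k using distr_std_complex_gaussian(1)[OF c] by simp
  have sub: "Q.indep_vars (\<lambda>_. borel) c ?I"
    by (rule Q.indep_vars_subset[OF ind]) auto
  have ind': "Q.indep_vars (\<lambda>_. borel) (\<lambda>k \<omega>. iexp (Re (\<alpha> (k - 1) * c k \<omega>))) ?I"
    by (rule Q.indep_vars_compose2[OF sub, where Y = "\<lambda>k z. iexp (Re (\<alpha> (k - 1) * z))"]) measurable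
  have "(\<integral>\<omega>. iexp (Re (\<Sum>k<K. \<alpha> k * c (Suc k) \<omega>)) \<partial>Q) = (\<integral>\<omega>. (\<Prod>k\<in>?I. iexp (Re (\<alpha> (k - 1) * c k \<omega>))) \<partial>Q)"
    by (subst prod.reindex) (auto simp: exp_sum[symmetric] sum_distrib_left Re_sum simp del: times_complex.sel)
  also have "\<dots> = (\<Prod>k\<in>?I. \<integral>\<omega>. iexp (Re (\<alpha> (k - 1) * c k \<omega>)) \<partial>Q)"
    by (rule Q.indep_vars_lebesgue_integral[OF _ ind']) (auto intro!: Q.integrable_const_bound[of _ 1])
  also have "\<dots> = (\<Prod>k<K. complex_of_real (exp (- (cmod (\<alpha> k))\<^sup>2 / 4)))"
    using c by (subst prod.reindex) (auto simp: char_std_complex_gaussian simp del: times_complex.sel)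
  also have "\<dots> = exp (- (\<Sum>k<K. (cmod (\<alpha> k))\<^sup>2) / 4)"
    by (simp add: exp_sum[symmetric] sum_negf sum_divide_distrib flip: of_real_prod)
  finally show ?thesis .
qed

subsection \<open>Characteristic polynomials of rank one perturbations\<close>

lemma dim_mat_diag [simp]: "dim_row (mat_diag n d) = n" "dim_col (mat_diag n d) = n"
  by (simp_all add: mat_diag_def)

lemma det_mat_diag: "det (mat_diag n d :: 'a::comm_ring_1 mat) = (\<Prod>i<n. d i)"
proof -
  have "det (mat_diag n d) = prod_list (diag_mat (mat_diag n d))"
    by (rule det_upper_triangular[of _ n]) (auto simp: mat_diag_def)
  also have "\<dots> = (\<Prod>i<n. d i)"
    unfolding prod_list_diag_prod by (rule prod.cong) (auto simp: mat_diag_def)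
  finally show ?thesis .
qed

text \<open>The matrix determinant lemma, by factoring the bordered matrix
  \<open>(D, -x; y\<^sup>T, 1)\<close> in two ways.\<close>

lemma det_diag_plus_rank_one:
  fixes d x y :: "nat \<Rightarrow> 'a::field"
  assumes d: "\<And>i. i < n \<Longrightarrow> d i \<noteq> 0"
  shows "det (mat n n (\<lambda>(i, j). (if i = j then d i else 0) + x i * y j)) =
    (\<Prod>i<n. d i) * (1 + (\<Sum>i<n. x i * y i / d i))"
proof -
  let ?D = "mat_diag n d" and ?X = "mat n 1 (\<lambda>(i, j). - x i)" and ?Y = "mat 1 n (\<lambda>(i, j). y j)"
  let ?A = "mat n n (\<lambda>(i, j). (if i = j then d i else 0) + x i * y j)"
  \<comment> \<open>\<open>?W\<close> is minus the inverse of \<open>?D\<close> applied to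
    \<open>x\<close>; it clears the block \<open>?X\<close> and leaves the scalar Schur complement
    \<open>?S\<close> in the corner.\<close>
  let ?W = "mat n 1 (\<lambda>(i, j). - x i / d i)"
  let ?S = "mat 1 1 (\<lambda>(i, j). 1 + (\<Sum>i<n. x i * y i / d i))"
  have "four_block_mat ?A ?X (0\<^sub>m 1 n) (1\<^sub>m 1) * four_block_mat (1\<^sub>m n) (0\<^sub>m n 1) ?Y (1\<^sub>m 1) =
     four_block_mat (?A * 1\<^sub>m n + ?X * ?Y) (?A * 0\<^sub>m n 1 + ?X * 1\<^sub>m 1) (0\<^sub>m 1 n * 1\<^sub>m n + 1\<^sub>m 1 * ?Y) (0\<^sub>m 1 n * 0\<^sub>m n 1 + 1\<^sub>m 1 * 1\<^sub>m 1)"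
    by (rule mult_four_block_mat) auto
  moreover have "?A * 1\<^sub>m n + ?X * ?Y = ?D"
    by (rule eq_matI) (auto simp: mat_diag_def scalar_prod_def)
  moreover have "?A * 0\<^sub>m n 1 + ?X * 1\<^sub>m 1 = ?X" by simp
  moreover have "0\<^sub>m 1 n * 1\<^sub>m n + 1\<^sub>m 1 * ?Y = ?Y" by simp
  moreover have "0\<^sub>m 1 n * 0\<^sub>m n 1 + 1\<^sub>m 1 * 1\<^sub>m 1 = (1\<^sub>m 1 :: 'a mat)" by simp
  ultimately have f1: "four_block_mat ?D ?X ?Y (1\<^sub>m 1) =
     four_block_mat ?A ?X (0\<^sub>m 1 n) (1\<^sub>m 1) * four_block_mat (1\<^sub>m n) (0\<^sub>m n 1) ?Y (1\<^sub>m 1)"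
    by simp
  have "four_block_mat ?D (0\<^sub>m n 1) ?Y ?S * four_block_mat (1\<^sub>m n) ?W (0\<^sub>m 1 n) (1\<^sub>m 1) =
     four_block_mat (?D * 1\<^sub>m n + 0\<^sub>m n 1 * 0\<^sub>m 1 n) (?D * ?W + 0\<^sub>m n 1 * 1\<^sub>m 1) (?Y * 1\<^sub>m n + ?S * 0\<^sub>m 1 n) (?Y * ?W + ?S * 1\<^sub>m 1)"
    by (rule mult_four_block_mat[of _ n n _ 1 _ 1]) auto
  moreover have "?D * 1\<^sub>m n + 0\<^sub>m n 1 * 0\<^sub>m 1 n = ?D" by (simp add: mat_diag_def)
  moreover have "?D * ?W + 0\<^sub>m n 1 * 1\<^sub>m 1 = ?X"
    by (rule eq_matI) (use d in \<open>auto simp: mat_diag_mult_left[of _ n 1]\<close>)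
  moreover have "?Y * 1\<^sub>m n + ?S * 0\<^sub>m 1 n = ?Y" by simp
  moreover have "?Y * ?W + ?S * 1\<^sub>m 1 = 1\<^sub>m 1"
    by (rule eq_matI) (auto simp: scalar_prod_def sum_negf lessThan_atLeast0 mult.commute)
  ultimately have f2: "four_block_mat ?D ?X ?Y (1\<^sub>m 1) =
     four_block_mat ?D (0\<^sub>m n 1) ?Y ?S * four_block_mat (1\<^sub>m n) ?W (0\<^sub>m 1 n) (1\<^sub>m 1)"
    by simp
  have "det (four_block_mat ?D ?X ?Y (1\<^sub>m 1)) =
     det (four_block_mat ?A ?X (0\<^sub>m 1 n) (1\<^sub>m 1)) * det (four_block_mat (1\<^sub>m n) (0\<^sub>m n 1) ?Y (1\<^sub>m 1))"
    unfolding f1 by (rule det_mult[of _ "n + 1"]) auto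
  also have "det (four_block_mat ?A ?X (0\<^sub>m 1 n) (1\<^sub>m 1)) = det ?A * det (1\<^sub>m 1)"
    by (rule det_four_block_mat_lower_left_zero) auto
  also have "det (four_block_mat (1\<^sub>m n) (0\<^sub>m n 1) ?Y (1\<^sub>m 1)) = det (1\<^sub>m n) * det (1\<^sub>m 1)"
    by (rule det_four_block_mat_upper_right_zero) auto
  finally have 1: "det (four_block_mat ?D ?X ?Y (1\<^sub>m 1)) = det ?A" by simp
  have "det (four_block_mat ?D ?X ?Y (1\<^sub>m 1)) =
     det (four_block_mat ?D (0\<^sub>m n 1) ?Y ?S) * det (four_block_mat (1\<^sub>m n) ?W (0\<^sub>m 1 n) (1\<^sub>m 1))"
    unfolding f2 by (rule det_mult[of _ "n + 1"]) (auto simp: mat_diag_def)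
  also have "det (four_block_mat ?D (0\<^sub>m n 1) ?Y ?S) = det ?D * det ?S"
    by (rule det_four_block_mat_upper_right_zero) (auto simp: mat_diag_def)
  also have "det (four_block_mat (1\<^sub>m n) ?W (0\<^sub>m 1 n) (1\<^sub>m 1)) = det (1\<^sub>m n) * det (1\<^sub>m 1)"
    by (rule det_four_block_mat_lower_left_zero) auto
  also have "det ?S = 1 + (\<Sum>i<n. x i * y i / d i)" by (subst det_single) auto
  finally show ?thesis using 1 by (simp add: det_mat_diag)
qed

lemma mat_adjoint_index [simp]:
  "i < dim_col A \<Longrightarrow> j < dim_row A \<Longrightarrow> mat_adjoint A $$ (i, j) = conjugate (A $$ (j, i))"
  by (simp add: mat_adjoint_def mat_of_rows_index)

lemma dim_mat_adjoint [simp]: "dim_row (mat_adjoint A) = dim_col A" "dim_col (mat_adjoint A) = dim_row A"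
  by (simp_all add: mat_adjoint_def)

lemma mat_adjoint_carrier [simp]: "A \<in> carrier_mat n m \<Longrightarrow> mat_adjoint A \<in> carrier_mat m n"
  by (auto simp: mat_adjoint_def)

lemma unitary_groupD:
  assumes "V \<in> unitary_group N"
  shows "V \<in> carrier_mat N N" "mat_adjoint V \<in> carrier_mat N N"
    "V * mat_adjoint V = 1\<^sub>m N" "mat_adjoint V * V = 1\<^sub>m N"
  using assms by (auto simp: unitary_group_def)

lemma unitary_entries:
  assumes V: "V \<in> unitary_group N" and "i < N" "j < N"
  shows "(\<Sum>k<N. V $$ (i, k) * cnj (V $$ (j, k))) = (if i = j then 1 else 0)"
    and "(\<Sum>k<N. cnj (V $$ (k, i)) * V $$ (k, j)) = (if i = j then 1 else 0)"
proof -
  note c = unitary_groupD[OF V]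
  have "(V * mat_adjoint V) $$ (i, j) = (\<Sum>k<N. V $$ (i, k) * cnj (V $$ (j, k)))"
    using c(1,2) assms by (auto simp: scalar_prod_def lessThan_atLeast0 intro!: sum.cong)
  then show "(\<Sum>k<N. V $$ (i, k) * cnj (V $$ (j, k))) = (if i = j then 1 else 0)"
    using c(3) assms by simp
  have "(mat_adjoint V * V) $$ (i, j) = (\<Sum>k<N. cnj (V $$ (k, i)) * V $$ (k, j))"
    using c(1,2) assms by (auto simp: scalar_prod_def lessThan_atLeast0 intro!: sum.cong)
  then show "(\<Sum>k<N. cnj (V $$ (k, i)) * V $$ (k, j)) = (if i = j then 1 else 0)"
    using c(4) assms by simp
qed

definition adjoint_apply :: "nat \<Rightarrow> complex mat \<Rightarrow> complex vec \<Rightarrow> nat \<Rightarrow> complex" where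
  "adjoint_apply N V v j = (\<Sum>i<N. cnj (V $$ (i, j)) * v $ i)"

lemma unit_sphere_sum:
  "v \<in> unit_sphere N \<Longrightarrow> (\<Sum>i<N. (cmod (v $ i))\<^sup>2) = 1"
  by (auto simp: unit_sphere_def cvec_norm_def L2_set_def)

lemma apply_adjoint_apply:
  assumes V: "V \<in> unitary_group N" and "i < N"
  shows "(\<Sum>k<N. V $$ (i, k) * adjoint_apply N V v k) = v $ i"
proof -
  have "(\<Sum>k<N. V $$ (i, k) * adjoint_apply N V v k) = (\<Sum>k<N. \<Sum>j<N. V $$ (i, k) * cnj (V $$ (j, k)) * v $ j)"
    by (simp add: adjoint_apply_def sum_distrib_left mult.assoc)
  also have "\<dots> = (\<Sum>j<N. (\<Sum>k<N. V $$ (i, k) * cnj (V $$ (j, k))) * v $ j)"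
    by (subst sum.swap) (simp only: sum_distrib_right)
  also have "\<dots> = (\<Sum>j<N. (if i = j then 1 else 0) * v $ j)"
    using unitary_entries(1)[OF V \<open>i < N\<close>] by (intro sum.cong refl arg_cong2[where f = "(*)"]) auto
  also have "\<dots> = v $ i" using \<open>i < N\<close> by (simp add: if_distrib[of "\<lambda>x. x * _"] cong: if_cong)
  finally show ?thesis .
qed

lemma norm_adjoint_apply:
  assumes V: "V \<in> unitary_group N" and v: "v \<in> unit_sphere N"
  shows "(\<Sum>k<N. (cmod (adjoint_apply N V v k))\<^sup>2) = 1"
proof -
  have "complex_of_real (\<Sum>k<N. (cmod (adjoint_apply N V v k))\<^sup>2) = (\<Sum>k<N. adjoint_apply N V v k * cnj (adjoint_apply N V v k))"
    unfolding of_real_sum complex_norm_square ..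
  also have "\<dots> = (\<Sum>k<N. \<Sum>i<N. cnj (v $ i) * (V $$ (i, k) * adjoint_apply N V v k))"
    unfolding adjoint_apply_def[of N V v, THEN arg_cong[where f = cnj]] cnj_sum sum_distrib_left
    by (intro sum.cong refl) (simp add: mult_ac)
  also have "\<dots> = (\<Sum>i<N. cnj (v $ i) * (\<Sum>k<N. V $$ (i, k) * adjoint_apply N V v k))"
    by (subst sum.swap) (simp only: sum_distrib_left)
  also have "\<dots> = (\<Sum>i<N. complex_of_real ((cmod (v $ i))\<^sup>2))"
    unfolding complex_norm_square using apply_adjoint_apply[OF V] by (intro sum.cong refl) (simp add: mult.commute)
  also have "\<dots> = 1" unfolding of_real_sum[symmetric] unit_sphere_sum[OF v] by simp
  finally show ?thesis by (simp only: of_real_eq_1_iff)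
qed

text \<open>Conjugation by \<open>V\<close> replaces \<open>v\<close> by \<open>u\<close>, the
  adjoint of \<open>V\<close> applied to \<open>v\<close>, and the matrix by a diagonal one times a
  rank one perturbation of the identity. Then \<open>z\<close> minus this matrix is diagonal plus
  rank one, and the determinant lemma applies.\<close>

lemma char_poly_perturbed:
  fixes Z :: "nat \<Rightarrow> complex"
  assumes V: "V \<in> unitary_group N" and v: "v \<in> unit_sphere N" and z: "\<And>i. i < N \<Longrightarrow> z \<noteq> Z i"
  shows "poly (char_poly (V * mat_diag N Z * mat_adjoint V * (1\<^sub>m N - s \<cdot>\<^sub>m outer_self v))) z =
    (\<Prod>i<N. z - Z i) * (1 + s * (\<Sum>i<N. Z i * (cmod (adjoint_apply N V v i))\<^sup>2 / (z - Z i)))"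
proof -
  let ?U = "mat_adjoint V" and ?D = "mat_diag N Z"
  define u where "u = adjoint_apply N V v"
  note c = unitary_groupD[OF V]
  have cv: "dim_vec v = N" using v by (auto simp: unit_sphere_def)
  let ?Ou = "mat N N (\<lambda>(i, j). u i * cnj (u j))" and ?Ov = "outer_self v"
  let ?B = "?D * (1\<^sub>m N - s \<cdot>\<^sub>m ?Ou)"
  have cD: "?D \<in> carrier_mat N N" by (simp add: mat_diag_def)
  have cOv: "?Ov \<in> carrier_mat N N" using cv by (simp add: outer_self_def)
  have cOu: "?Ou \<in> carrier_mat N N" by simp
  \<comment> \<open>This intertwining relation moves the rank one projection through the adjoint of
    \<open>V\<close>; it rests on \<open>V\<close> mapping \<open>u\<close> back to
    \<open>v\<close>.\<close>
  have UO: "?U * ?Ov = ?Ou * ?U"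
  proof (rule eq_matI)
    fix i j assume "i < dim_row (?Ou * ?U)" "j < dim_col (?Ou * ?U)"
    then have ij: "i < N" "j < N" using c by auto
    have "(?U * ?Ov) $$ (i, j) = (\<Sum>k<N. cnj (V $$ (k, i)) * (v $ k * cnj (v $ j)))"
      using c(1,2) cOv ij by (auto simp: scalar_prod_def lessThan_atLeast0 outer_self_def cv intro!: sum.cong)
    also have "\<dots> = u i * cnj (v $ j)"
      by (simp add: u_def adjoint_apply_def sum_distrib_right mult.assoc)
    also have "\<dots> = u i * cnj (\<Sum>k<N. V $$ (j, k) * u k)"
      using apply_adjoint_apply[OF V ij(2)] by (simp add: u_def)
    also have "\<dots> = (\<Sum>k<N. u i * cnj (u k) * cnj (V $$ (j, k)))"
      by (simp add: sum_distrib_left mult_ac)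
    also have "\<dots> = (?Ou * ?U) $$ (i, j)"
      using c(1,2) ij by (auto simp: scalar_prod_def lessThan_atLeast0 intro!: sum.cong)
    finally show "(?U * ?Ov) $$ (i, j) = (?Ou * ?U) $$ (i, j)" .
  qed (use c(1,2) cOv in auto)
  let ?Au = "1\<^sub>m N - s \<cdot>\<^sub>m ?Ou" and ?Av = "1\<^sub>m N - s \<cdot>\<^sub>m ?Ov"
  have cAu: "?Au \<in> carrier_mat N N" and cAv: "?Av \<in> carrier_mat N N" using cOv by auto
  note cU = c(2) and cV = c(1)
  have "?U * (1\<^sub>m N - s \<cdot>\<^sub>m ?Ov) = ?U * 1\<^sub>m N - ?U * (s \<cdot>\<^sub>m ?Ov)"
    using cOv by (intro mult_minus_distrib_mat[OF cU]) auto
  also have "?U * (s \<cdot>\<^sub>m ?Ov) = s \<cdot>\<^sub>m (?Ou * ?U)"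
    unfolding mult_smult_distrib[OF cU cOv] UO ..
  also have "\<dots> = (s \<cdot>\<^sub>m ?Ou) * ?U"
    by (rule mult_smult_assoc_mat[OF cOu cU, symmetric])
  also have "?U * 1\<^sub>m N - (s \<cdot>\<^sub>m ?Ou) * ?U = (1\<^sub>m N - s \<cdot>\<^sub>m ?Ou) * ?U"
    by (subst minus_mult_distrib_mat[OF _ _ cU]) (auto simp: left_mult_one_mat[OF cU] right_mult_one_mat[OF cU])
  finally have UA: "?U * (1\<^sub>m N - s \<cdot>\<^sub>m ?Ov) = (1\<^sub>m N - s \<cdot>\<^sub>m ?Ou) * ?U" .
  have cB: "?B \<in> carrier_mat N N" using cD cAu by (rule mult_carrier_mat)
  have cVD: "V * ?D \<in> carrier_mat N N" using cV cD by (rule mult_carrier_mat)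
  have "V * ?D * ?U * (1\<^sub>m N - s \<cdot>\<^sub>m ?Ov) = V * ?D * (?U * (1\<^sub>m N - s \<cdot>\<^sub>m ?Ov))"
    by (rule assoc_mult_mat[OF cVD cU cAv])
  also have "\<dots> = V * ?D * (1\<^sub>m N - s \<cdot>\<^sub>m ?Ou) * ?U"
    unfolding UA by (rule assoc_mult_mat[OF cVD cAu cU, symmetric])
  also have "V * ?D * (1\<^sub>m N - s \<cdot>\<^sub>m ?Ou) = V * ?B"
    by (rule assoc_mult_mat[OF cV cD cAu])
  finally have eq: "V * ?D * ?U * (1\<^sub>m N - s \<cdot>\<^sub>m ?Ov) = V * ?B * ?U" .
  have "similar_mat (V * ?D * ?U * (1\<^sub>m N - s \<cdot>\<^sub>m ?Ov)) ?B"
    unfolding eq using c cB mult_carrier_mat[OF mult_carrier_mat[OF cV cB] cU]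
    by (intro similar_matI[of _ _ V ?U N]) auto
  then have "poly (char_poly (V * ?D * ?U * (1\<^sub>m N - s \<cdot>\<^sub>m ?Ov))) z = det (- char_matrix ?B z)"
    by (simp only: char_poly_similar char_poly_matrix[OF cB])
  also have "- char_matrix ?B z = mat N N (\<lambda>(i, j). (if i = j then z - Z i else 0) + (s * Z i * u i) * cnj (u j))"
  proof (rule eq_matI)
    fix i j assume "i < dim_row (mat N N (\<lambda>(i, j). (if i = j then z - Z i else 0) + (s * Z i * u i) * cnj (u j)))"
      "j < dim_col (mat N N (\<lambda>(i, j). (if i = j then z - Z i else 0) + (s * Z i * u i) * cnj (u j)))"
    then have ij: "i < N" "j < N" by auto
    have "?B $$ (i, j) = Z i * ((if i = j then 1 else 0) - s * (u i * cnj (u j)))"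
      using ij by (subst mat_diag_mult_left[of _ N N]) auto
    then show "(- char_matrix ?B z) $$ (i, j) = mat N N (\<lambda>(i, j). (if i = j then z - Z i else 0) + (s * Z i * u i) * cnj (u j)) $$ (i, j)"
      using ij cB by (auto simp: char_matrix_def algebra_simps)
  qed (use cB in \<open>auto simp: char_matrix_def\<close>)
  also have "det \<dots> = (\<Prod>i<N. z - Z i) * (1 + (\<Sum>i<N. (s * Z i * u i) * cnj (u i) / (z - Z i)))"
    using z by (intro det_diag_plus_rank_one) auto
  also have "(\<Sum>i<N. (s * Z i * u i) * cnj (u i) / (z - Z i)) = s * (\<Sum>i<N. Z i * (cmod (u i))\<^sup>2 / (z - Z i))"
    unfolding sum_distrib_left complex_norm_square[symmetric] of_real_power[symmetric]
    by (intro sum.cong refl) (simp add: complex_norm_square flip: of_real_power)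
  finally show ?thesis unfolding u_def .
qed


text \<open>Coefficients of \<open>c - (\<Sum>k. y k * z ^ Suc k)\<close>, the common shape of the
  series of the perturbed matrix and of its Gaussian limit.\<close>

definition cons_coeff :: "complex \<Rightarrow> (nat \<Rightarrow> complex) \<Rightarrow> nat \<Rightarrow> complex" where
  "cons_coeff c y k = (case k of 0 \<Rightarrow> c | Suc j \<Rightarrow> - y j)"

lemma pser_cons_coeff_sums:
  assumes "(\<lambda>k. y k * z ^ Suc k) sums L"
  shows "(\<lambda>k. cons_coeff c y k * z ^ k) sums (c - L)"
proof -
  have "(\<lambda>k. cons_coeff c y (Suc k) * z ^ Suc k) sums (- L)"
    using sums_minus[OF assms] by (simp add: cons_coeff_def)
  then have "(\<lambda>k. cons_coeff c y k * z ^ k) sums (- L + cons_coeff c y 0 * z ^ 0)"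
    by (rule sums_Suc)
  then show ?thesis by (simp add: cons_coeff_def)
qed

lemma pser_cons_coeff:
  "(\<lambda>k. y k * z ^ Suc k) sums L \<Longrightarrow> pser (cons_coeff c y) z = c - L"
  using pser_cons_coeff_sums[of y z L c] by (simp add: pser_def sums_iff)

lemma cons_coeff_weighted_cube:
  assumes "y \<in> weighted_cube \<rho> C" "\<rho> \<ge> 0" "\<rho> \<le> 1"
  shows "cons_coeff c y \<in> weighted_cube \<rho> (max (cmod c) C)"
  unfolding weighted_cube_def
proof safe
  fix k
  show "cmod (cons_coeff c y k) * \<rho> ^ k \<le> max (cmod c) C"
  proof (cases k)
    case 0
    then show ?thesis by (simp add: cons_coeff_def)
  next
    case (Suc j)
    have "cmod (y j) * \<rho> ^ Suc j \<le> cmod (y j) * \<rho> ^ j"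
      using assms by (intro mult_left_mono power_decreasing) auto
    also have "\<dots> \<le> C" using assms(1) by (auto simp: weighted_cube_def)
    finally show ?thesis using Suc by (simp add: cons_coeff_def del: power_Suc)
  qed
qed

text \<open>The spectral moments appear with \<open>cnj (Z i) = 1 / Z i\<close> because the resolvent is expanded
  at the origin, inside the unit circle.\<close>

lemma char_poly_perturbed_pser:
  fixes Z :: "nat \<Rightarrow> complex" and a s :: complex and N :: nat
  defines "s \<equiv> 1 - a * complex_of_real (real N powr (- 1 / 2))"
  assumes V: "V \<in> unitary_group N" and v: "v \<in> unit_sphere N" and Z: "\<And>i. i < N \<Longrightarrow> cmod (Z i) = 1"
    and N: "N > 0" and z: "z \<in> ball 0 1"
  shows "poly (char_poly (V * mat_diag N Z * mat_adjoint V * (1\<^sub>m N - s \<cdot>\<^sub>m outer_self v))) z =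
    (\<Prod>i<N. z - Z i) * (sqrt 2 / sqrt N) *
    pser (cons_coeff (a / sqrt 2) (\<lambda>k. s * sqrt N / sqrt 2 *
       (\<Sum>i<N. (cmod (adjoint_apply N V v i))\<^sup>2 * cnj (Z i) ^ Suc k))) z"
proof -
  define w where "w i = (cmod (adjoint_apply N V v i))\<^sup>2" for i
  have zZ: "z \<noteq> Z i" if "i < N" for i using Z[OF that] z by auto
  have ZZ: "Z i * cnj (Z i) = 1" if "i < N" for i
    using complex_norm_square[of "Z i"] Z[OF that] by simp
  have lt: "cmod (z * cnj (Z i)) < 1" if "i < N" for i
    using Z[OF that] z by (simp add: norm_mult)
  have ne: "1 - z * cnj (Z i) \<noteq> 0" if "i < N" for i
    using lt[OF that] by (metis eq_iff_diff_eq_0 norm_one less_irrefl)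
  define L where "L = (\<Sum>i<N. w i * (z * cnj (Z i) / (1 - z * cnj (Z i))))"
  have "(\<lambda>k. w i * (z * cnj (Z i)) ^ Suc k) sums (w i * (z * cnj (Z i) / (1 - z * cnj (Z i))))" if "i < N" for i
  proof -
    have "(\<lambda>k. (z * cnj (Z i)) * (z * cnj (Z i)) ^ k) sums ((z * cnj (Z i)) * (1 / (1 - z * cnj (Z i))))"
      by (intro sums_mult geometric_sums lt that)
    then show ?thesis by (intro sums_mult) simp
  qed
  then have "(\<lambda>k. \<Sum>i<N. w i * (z * cnj (Z i)) ^ Suc k) sums L"
    unfolding L_def by (intro sums_sum) auto
  moreover have "(\<Sum>i<N. w i * (z * cnj (Z i)) ^ Suc k) = (\<Sum>i<N. w i * cnj (Z i) ^ Suc k) * z ^ Suc k" for k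
    unfolding sum_distrib_right power_mult_distrib by (intro sum.cong refl) (simp only: mult_ac)
  ultimately have Ls: "(\<lambda>k. (\<Sum>i<N. w i * cnj (Z i) ^ Suc k) * z ^ Suc k) sums L"
    by (simp only:)
  have "(\<lambda>k. s * sqrt N / sqrt 2 * ((\<Sum>i<N. w i * cnj (Z i) ^ Suc k) * z ^ Suc k)) sums (s * sqrt N / sqrt 2 * L)"
    by (rule sums_mult[OF Ls])
  then have ps: "pser (cons_coeff (a / sqrt 2) (\<lambda>k. s * sqrt N / sqrt 2 * (\<Sum>i<N. w i * cnj (Z i) ^ Suc k))) z =
     a / sqrt 2 - s * sqrt N / sqrt 2 * L"
    by (intro pser_cons_coeff) (simp only: mult.assoc)
  \<comment> \<open>\<open>Z i / (z - Z i) = - 1 - z * cnj (Z i) / (1 - z * cnj (Z i))\<close>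
    because \<open>Z i\<close> is unimodular; as the weights sum to 1, the constants add up to
    -1.\<close>
  have "(\<Sum>i<N. Z i * (cmod (adjoint_apply N V v i))\<^sup>2 / (z - Z i)) = (\<Sum>i<N. - of_real (w i) - w i * (z * cnj (Z i) / (1 - z * cnj (Z i))))"
  proof (intro sum.cong refl)
    fix i assume "i \<in> {..<N}"
    then have i: "i < N" by simp
    have "z - Z i = - Z i * (1 - z * cnj (Z i))" using ZZ[OF i] by (simp add: algebra_simps)
    moreover have "Z i \<noteq> 0" using Z[OF i] by auto
    moreover have "Z i / (- Z i * d) = - 1 / d" if "Z i \<noteq> 0" for d using that by simp
    ultimately have "Z i / (z - Z i) = - 1 / (1 - z * cnj (Z i))" by (simp only: not_False_eq_True)
    also have "\<dots> = - 1 - z * cnj (Z i) / (1 - z * cnj (Z i))" using ne[OF i] by (simp add: field_simps)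
    finally have "of_real (w i) * (Z i / (z - Z i)) = of_real (w i) * (- 1 - z * cnj (Z i) / (1 - z * cnj (Z i)))" by (simp only:)
    then show "Z i * (cmod (adjoint_apply N V v i))\<^sup>2 / (z - Z i) = - of_real (w i) - w i * (z * cnj (Z i) / (1 - z * cnj (Z i)))"
      unfolding w_def by (simp add: algebra_simps)
  qed
  also have "\<dots> = - 1 - L"
    using norm_adjoint_apply[OF V v] by (simp add: sum_subtractf sum_negf L_def w_def flip: of_real_sum of_real_power)
  finally have S: "(\<Sum>i<N. Z i * (cmod (adjoint_apply N V v i))\<^sup>2 / (z - Z i)) = - 1 - L" .
  \<comment> \<open>The terms of order 1 cancel and leave \<open>1 - s = a / sqrt N\<close>.
    Extracting \<open>sqrt 2 / sqrt N\<close> then exposes the constant term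
    \<open>a / sqrt 2\<close>.\<close>
  have sum_eq: "1 + s * (\<Sum>i<N. Z i * (cmod (adjoint_apply N V v i))\<^sup>2 / (z - Z i)) = (1 - s) - s * L"
    unfolding S by (simp add: algebra_simps)
  have "real N powr (- (1 / 2)) = 1 / sqrt N"
    unfolding powr_minus_divide by (simp add: powr_half_sqrt)
  then have "1 - s = a / sqrt N" by (simp add: s_def)
  moreover have "a / q - s * L = (p / q) * (a / p - s * q / p * L)" if "p \<noteq> 0" "q \<noteq> 0" for p q :: complex
    using that by (simp add: field_simps)
  ultimately have fin: "(1 - s) - s * L = (complex_of_real (sqrt 2) / sqrt N) * (a / sqrt 2 - s * sqrt N / sqrt 2 * L)"
    using N by simp
  show ?thesis
    using char_poly_perturbed[where Z = Z and z = z and s = s, OF V v zZ]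
    unfolding sum_eq fin ps[unfolded w_def] by (simp only: of_real_divide mult.assoc)
qed

text \<open>Splitting off the full power of \<open>z - w\<close> from \<open>p\<close> leaves a
  cofactor nonzero at \<open>w\<close>. Division by the zero free \<open>h\<close> keeps it analytic
  and nonzero, so the same exponent is the order of \<open>f\<close>.\<close>

lemma order_eq_zorder:
  assumes p: "p \<noteq> 0" and U: "open U" "w \<in> U" and h: "h holomorphic_on U" "\<And>z. z \<in> U \<Longrightarrow> h z \<noteq> 0"
    and eq: "\<And>z. z \<in> U \<Longrightarrow> poly p z = h z * f z"
  shows "zorder f w = int (Polynomial.order w p)"
proof -
  obtain q where q: "p = [:- w, 1:] ^ Polynomial.order w p * q" "\<not> [:- w, 1:] dvd q"
    using order_decomp[OF p] by blast
  show ?thesis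
  proof (rule zorder_eqI[OF U])
    show "(\<lambda>z. poly q z / h z) holomorphic_on U"
      using h by (intro holomorphic_intros) auto
    show "poly q w / h w \<noteq> 0"
      using q(2) h(2)[OF U(2)] by (simp add: poly_eq_0_iff_dvd)
    fix z assume z: "z \<in> U" "z \<noteq> w"
    have "h z * f z = (z - w) ^ Polynomial.order w p * poly q z"
      using eq[OF z(1)] arg_cong[OF q(1), of "\<lambda>p. poly p z"] by (simp add: poly_power)
    then show "f z = poly q z / h z * (z - w) powi int (Polynomial.order w p)"
      using h(2)[OF z(1)] by (simp add: field_simps power_int_of_nat)
  qed
qed

section \<open>Integrals against eigenvalue measures as sums over zeros\<close>

lemma integral_disk_point_measure:
  fixes g :: "complex \<Rightarrow> real"
  assumes g: "continuous_on (ball 0 1) g" and fin: "finite {w \<in> ball 0 1. m w \<noteq> 0 \<and> g w \<noteq> 0}"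
  shows "(\<integral>z. g z \<partial>disk_point_measure m) = (\<Sum>w\<in>{w \<in> ball 0 1. m w \<noteq> 0 \<and> g w \<noteq> 0}. real (m w) * g w)"
proof -
  have mg: "g \<in> borel_measurable (restrict_space borel (ball 0 1))"
    by (rule borel_measurable_continuous_on_restrict[OF g])
  have "(\<integral>z. g z \<partial>disk_point_measure m) = (\<integral>z. g z \<partial>point_measure (ball 0 1) (\<lambda>w. of_nat (m w)))"
    unfolding disk_point_measure_def
    by (rule integral_distr[OF _ mg]) (auto simp: measurable_def space_point_measure space_restrict_space sets_point_measure)
  also have "\<dots> = (\<integral>z. real (m z) *\<^sub>R g z \<partial>count_space (ball 0 1))"
    unfolding point_measure_def ennreal_of_nat_eq_real_of_nat
    by (rule integral_density) auto
  also have "\<dots> = (\<Sum>w\<in>{w \<in> ball 0 1. real (m w) *\<^sub>R g w \<noteq> 0}. real (m w) *\<^sub>R g w)"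
    by (rule lebesgue_integral_count_space_finite_support) (use fin in simp)
  finally show ?thesis by simp
qed

text \<open>Inside the disk the eigenvalues are the zeros of \<open>f\<close> with the same
  multiplicities because \<open>h\<close> has no zeros, and \<open>g\<close> vanishes off
  \<open>K\<close>, which allows the smaller radius \<open>\<rho>\<close>.\<close>

lemma integral_eigenvalue_measure:
  fixes g :: "complex \<Rightarrow> real"
  assumes A: "A \<in> carrier_mat n n"
    and h: "h holomorphic_on ball 0 1" "\<And>z. z \<in> ball 0 1 \<Longrightarrow> h z \<noteq> 0"
    and eq: "\<And>z. z \<in> ball 0 1 \<Longrightarrow> poly (char_poly A) z = h z * f z"
    and g: "continuous_on (ball 0 1) g" and K: "\<And>z. z \<in> ball 0 1 - K \<Longrightarrow> g z = 0" "K \<subseteq> ball 0 \<rho>" "\<rho> \<le> 1"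
  shows "(\<integral>z. g z \<partial>eigenvalue_measure A) = zero_sum g (ball 0 \<rho>) f"
proof -
  have p: "char_poly A \<noteq> 0" using degree_monic_char_poly[OF A] by auto
  let ?m = "\<lambda>w. if w \<in> spectrum A then Polynomial.order w (char_poly A) else 0"
  have spec: "w \<in> spectrum A \<longleftrightarrow> f w = 0" if "w \<in> ball 0 1" for w
    using spectrum_root_char_poly[OF A] eq[OF that] h(2)[OF that] by auto
  have m0: "?m w \<noteq> 0 \<longleftrightarrow> f w = 0" if "w \<in> ball 0 1" for w
    using spec[OF that] order_root[of "char_poly A" w] p spectrum_root_char_poly[OF A] by auto
  have "finite {w. poly (char_poly A) w = 0}" by (rule poly_roots_finite[OF p])
  then have fin: "finite {w \<in> ball 0 1. ?m w \<noteq> 0 \<and> g w \<noteq> 0}"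
    by (rule finite_subset[rotated]) (auto simp: spectrum_root_char_poly[OF A] split: if_splits)
  have set_eq: "{w \<in> ball 0 1. ?m w \<noteq> 0 \<and> g w \<noteq> 0} = {w \<in> ball 0 \<rho>. f w = 0 \<and> g w \<noteq> 0}"
  proof (intro Collect_cong iffI)
    fix w assume "w \<in> ball 0 1 \<and> ?m w \<noteq> 0 \<and> g w \<noteq> 0"
    then show "w \<in> ball 0 \<rho> \<and> f w = 0 \<and> g w \<noteq> 0" using m0[of w] K by blast
  next
    fix w assume w: "w \<in> ball 0 \<rho> \<and> f w = 0 \<and> g w \<noteq> 0"
    then have "w \<in> ball 0 1" using K(3) by auto
    then show "w \<in> ball 0 1 \<and> ?m w \<noteq> 0 \<and> g w \<noteq> 0" using m0[of w] w by blast
  qed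
  have "(\<integral>z. g z \<partial>eigenvalue_measure A) = (\<Sum>w\<in>{w \<in> ball 0 1. ?m w \<noteq> 0 \<and> g w \<noteq> 0}. real (?m w) * g w)"
    unfolding eigenvalue_measure_def by (rule integral_disk_point_measure[OF g fin])
  also have "\<dots> = zero_sum g (ball 0 \<rho>) f"
    unfolding set_eq zero_sum_def
  proof (intro sum.cong refl)
    fix w assume w: "w \<in> {w \<in> ball 0 \<rho>. f w = 0 \<and> g w \<noteq> 0}"
    then have w1: "w \<in> ball 0 1" using K(3) by auto
    show "real (?m w) * g w = of_int (zorder f w) * g w"
      using order_eq_zorder[OF p open_ball w1 h eq] spec[OF w1] w by simp
  qed
  finally show ?thesis .
qed

subsection \<open>Zeros of random power series\<close>

text \<open>For the exceptional coefficient sequences, where the function is either not holomorphic,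
  so that the measure vanishes by convention, or has no zeros.\<close>

lemma zero_measure_eq_zero:
  assumes "\<And>w. w \<in> ball 0 1 \<Longrightarrow> f holomorphic_on ball 0 1 \<Longrightarrow> f w \<noteq> 0"
    and g: "continuous_on (ball 0 1) g"
  shows "(\<integral>z. g z \<partial>zero_measure f) = (0::real)"
proof -
  define m where "m = (\<lambda>w. if f holomorphic_on ball 0 1 \<and> f w = 0 then nat (zorder f w) else 0)"
  have m0: "m w = 0" if "w \<in> ball 0 1" for w
  proof (cases "f holomorphic_on ball 0 1 \<and> f w = 0")
    case True
    then show ?thesis using assms(1)[OF that] by blast
  next
    case False
    then show ?thesis unfolding m_def by (simp only: if_False)
  qed
  have e: "{w \<in> ball 0 1. m w \<noteq> 0 \<and> g w \<noteq> 0} = {}"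
  proof (rule equals0I)
    fix w assume "w \<in> {w \<in> ball 0 1. m w \<noteq> 0 \<and> g w \<noteq> 0}"
    then show False using m0[of w] by simp
  qed
  have "(\<integral>z. g z \<partial>disk_point_measure m) = (\<Sum>w\<in>{w \<in> ball 0 1. m w \<noteq> 0 \<and> g w \<noteq> 0}. real (m w) * g w)"
    by (rule integral_disk_point_measure[OF g]) (simp only: e finite.emptyI)
  then show ?thesis unfolding zero_measure_def m_def[symmetric] e sum.empty .
qed

lemma integral_zero_measure:
  fixes g :: "complex \<Rightarrow> real"
  assumes f: "f holomorphic_on ball 0 1" "\<exists>w\<in>ball 0 1. f w \<noteq> 0"
    and g: "continuous_on (ball 0 1) g" and K: "compact K" "\<And>z. z \<in> ball 0 1 - K \<Longrightarrow> g z = 0" "K \<subseteq> ball 0 \<rho>" "\<rho> \<le> 1"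
    and f': "\<And>z. z \<in> ball 0 \<rho> \<Longrightarrow> f z = f' z"
  shows "(\<integral>z. g z \<partial>zero_measure f) = zero_sum g (ball 0 \<rho>) f'"
proof -
  let ?m = "\<lambda>w. if f holomorphic_on ball 0 1 \<and> f w = 0 then nat (zorder f w) else 0"
  have K1: "K \<subseteq> ball 0 1" using K by (meson order_trans subset_ball)
  have pos: "f w = 0 \<Longrightarrow> zorder f w > 0" if "w \<in> ball 0 1" for w
    using zorder_exist_zero[OF f(1) open_ball connected_ball that f(2)] by auto
  have set_eq: "{w \<in> ball 0 1. ?m w \<noteq> 0 \<and> g w \<noteq> 0} = {w \<in> ball 0 \<rho>. f' w = 0 \<and> g w \<noteq> 0}"
  proof (intro Collect_cong iffI)
    fix w assume w: "w \<in> ball 0 1 \<and> ?m w \<noteq> 0 \<and> g w \<noteq> 0"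
    then have "w \<in> K" using K(2) by blast
    then have "w \<in> ball 0 \<rho>" using K(3) by blast
    moreover have "f w = 0" using w by (auto split: if_splits)
    ultimately show "w \<in> ball 0 \<rho> \<and> f' w = 0 \<and> g w \<noteq> 0" using f' w by auto
  next
    fix w assume w: "w \<in> ball 0 \<rho> \<and> f' w = 0 \<and> g w \<noteq> 0"
    then have "w \<in> ball 0 1" using K(4) by auto
    then show "w \<in> ball 0 1 \<and> ?m w \<noteq> 0 \<and> g w \<noteq> 0" using pos[of w] w f'[of w] f(1) by auto
  qed
  have "finite {w \<in> K. f w = 0}"
    by (rule finite_zeros_compact[OF f(1) open_ball connected_ball K(1) K1 f(2)])
  then have fin: "finite {w \<in> ball 0 1. ?m w \<noteq> 0 \<and> g w \<noteq> 0}"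
    by (rule finite_subset[rotated]) (use K(2) in \<open>auto split: if_splits\<close>)
  have "(\<integral>z. g z \<partial>zero_measure f) = (\<Sum>w\<in>{w \<in> ball 0 1. ?m w \<noteq> 0 \<and> g w \<noteq> 0}. real (?m w) * g w)"
    unfolding zero_measure_def by (rule integral_disk_point_measure[OF g fin])
  also have "\<dots> = zero_sum g (ball 0 \<rho>) f'"
    unfolding set_eq zero_sum_def
  proof (intro sum.cong refl)
    \<comment> \<open>\<open>f\<close> and \<open>f'\<close> agree on the smaller disk only; it is a
      neighbourhood of \<open>w\<close>, and the order of a zero is local.\<close>
    fix w assume w: "w \<in> {w \<in> ball 0 \<rho>. f' w = 0 \<and> g w \<noteq> 0}"
    then have w1: "w \<in> ball 0 1" using K(4) by auto
    have "\<forall>\<^sub>F z in nhds w. z \<in> ball 0 \<rho>"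
      using w by (intro eventually_nhds_in_open) auto
    then have "\<forall>\<^sub>F z in at w. f z = f' z"
      unfolding eventually_at_filter by eventually_elim (use f' in auto)
    then have "zorder f w = zorder f' w" by (intro zorder_cong) auto
    moreover have "f w = 0" using w f' by auto
    ultimately show "real (?m w) * g w = of_int (zorder f' w) * g w"
      using pos[OF w1] f(1) by auto
  qed
  finally show ?thesis .
qed

text \<open>A power series with radius of convergence below 1 diverges on an annulus inside the disk, where
  \<open>suminf\<close> takes one fixed junk value. If the resulting function is holomorphic on the disk it is
  therefore constant, and equal to its value \<open>c\<close> at the origin.\<close>

lemma divergent_series_constant:
  fixes c :: complex and y :: "nat \<Rightarrow> complex"
  defines "f \<equiv> \<lambda>z. c - (\<Sum>k. y k * z ^ Suc k)"
  assumes \<rho>: "0 < \<rho>" "\<rho> < 1" and y: "\<And>C. y \<notin> weighted_cube \<rho> C"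
    and hol: "f holomorphic_on ball 0 1" and w: "w \<in> ball 0 1"
  shows "f w = c"
proof -
  \<comment> \<open>Convergence at a point of modulus above \<open>\<rho>\<close> bounds the terms
    there, and this would place \<open>y\<close> in a weighted cube of radius
    \<open>\<rho>\<close>.\<close>
  have div: "\<not> summable (\<lambda>k. y k * z ^ Suc k)" if z: "cmod z > \<rho>" for z
  proof
    assume "summable (\<lambda>k. y k * z ^ Suc k)"
    then have "Bseq (\<lambda>k. y k * z ^ Suc k)"
      by (rule convergent_imp_Bseq[OF convergentI[OF summable_LIMSEQ_zero]])
    then obtain C where C: "\<And>k. cmod (y k * z ^ Suc k) \<le> C" by (auto simp: Bseq_def)
    have "cmod (y k) * \<rho> ^ k \<le> C / \<rho>" for k
    proof -
      have "cmod (y k) * \<rho> ^ Suc k \<le> cmod (y k) * cmod z ^ Suc k"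
        using z \<rho> by (intro mult_left_mono power_mono) auto
      also have "\<dots> \<le> C" using C[of k] by (simp add: norm_mult norm_power)
      finally show ?thesis using \<rho> by (simp add: field_simps)
    qed
    then show False using y[of "C / \<rho>"] by (simp add: weighted_cube_def)
  qed
  define J :: complex where "J = (THE s. False)"
  have fJ: "f z = c - J" if "cmod z > \<rho>" for z
  proof -
    have "(sums) (\<lambda>k. y k * z ^ Suc k) = (\<lambda>s. False)"
      using div[OF that] sums_summable by (intro ext) blast
    then show ?thesis unfolding f_def suminf_def J_def by (simp only:)
  qed
  define S where "S = ball 0 1 - cball (0::complex) \<rho>"
  have S: "open S" "S \<subseteq> ball 0 1" by (auto simp: S_def)
  have "of_real ((\<rho> + 1) / 2) \<in> S" using \<rho> by (simp add: S_def del: of_real_divide of_real_add)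
  then have "S \<noteq> {}" by blast
  have const: "f z = c - J" if "z \<in> ball 0 1" for z
  proof (rule analytic_continuation_open[where s = S and s' = "ball 0 1" and f = f and g = "\<lambda>_. c - J"])
    show "f z = c - J" if "z \<in> S" for z using that by (intro fJ) (auto simp: S_def)
  qed (use S hol \<open>S \<noteq> {}\<close> that in auto)
  have "f 0 = c" by (simp add: f_def)
  then show ?thesis using const[of 0] const[OF w] by simp
qed

subsection \<open>Haar unitary matrices and independence\<close>

lemma space_mat_borel [simp]: "space (mat_borel N) = carrier_mat N N"
  by (simp add: mat_borel_def)

lemma space_unitary_borel [simp]: "space (unitary_borel N) = unitary_group N"
  by (auto simp: unitary_borel_def space_restrict_space unitary_group_def)

lemma space_sphere_borel [simp]: "space (sphere_borel N) = unit_sphere N"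
  by (auto simp: sphere_borel_def vec_borel_def space_restrict_space unit_sphere_def)

lemma measurable_mat_entry:
  assumes "i < N" "j < N"
  shows "(\<lambda>A. A $$ (i, j)) \<in> borel_measurable (mat_borel N)"
proof -
  let ?I = "{..<N} \<times> {..<N}"
  let ?F = "\<lambda>A :: complex mat. \<lambda>(i, j)\<in>?I. A $$ (i, j)"
  have "?F \<in> measurable (mat_borel N) (PiM ?I (\<lambda>_. borel))"
    unfolding mat_borel_def by (rule measurable_vimage_algebra1) (auto simp: space_PiM)
  moreover have "(\<lambda>x. x (i, j)) \<in> borel_measurable (PiM ?I (\<lambda>_. borel))"
    using assms by (intro measurable_component_singleton) auto
  ultimately have "(\<lambda>A. ?F A (i, j)) \<in> borel_measurable (mat_borel N)"
    by (rule measurable_compose)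
  then show ?thesis using assms by simp
qed

lemma measurable_mat_borelI:
  assumes "\<And>\<omega>. \<omega> \<in> space M \<Longrightarrow> f \<omega> \<in> carrier_mat N N"
    and "\<And>i j. i < N \<Longrightarrow> j < N \<Longrightarrow> (\<lambda>\<omega>. f \<omega> $$ (i, j)) \<in> borel_measurable M"
  shows "f \<in> measurable M (mat_borel N)"
  unfolding mat_borel_def
proof (rule measurable_vimage_algebra2)
  show "f \<in> space M \<rightarrow> carrier_mat N N" using assms(1) by auto
  show "(\<lambda>\<omega>. \<lambda>(i, j)\<in>{..<N} \<times> {..<N}. f \<omega> $$ (i, j)) \<in> measurable M (PiM ({..<N} \<times> {..<N}) (\<lambda>_. borel))"
    by (rule measurable_restrict) (clarify, simp add: assms(2))
qed

lemma measurable_unitary_entry: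
  assumes "i < N" "j < N"
  shows "(\<lambda>A. A $$ (i, j)) \<in> borel_measurable (unitary_borel N)"
  unfolding unitary_borel_def by (intro measurable_restrict_space1 measurable_mat_entry assms)

lemma measurable_sphere_entry:
  assumes "i < N"
  shows "(\<lambda>v. v $ i) \<in> borel_measurable (sphere_borel N)"
proof -
  let ?F = "\<lambda>v :: complex vec. \<lambda>i\<in>{..<N}. v $ i"
  have "?F \<in> measurable (vec_borel N) (PiM {..<N} (\<lambda>_. borel))"
    unfolding vec_borel_def by (rule measurable_vimage_algebra1) (auto simp: space_PiM)
  moreover have "(\<lambda>x. x i) \<in> borel_measurable (PiM {..<N} (\<lambda>_. borel))"
    using assms by (intro measurable_component_singleton) auto
  ultimately have "(\<lambda>v. ?F v i) \<in> borel_measurable (vec_borel N)"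
    by (rule measurable_compose)
  then show ?thesis
    unfolding sphere_borel_def using assms by (intro measurable_restrict_space1) simp
qed

lemma measurable_adjoint_apply:
  "j < N \<Longrightarrow> (\<lambda>V. adjoint_apply N V v j) \<in> borel_measurable (unitary_borel N)"
  unfolding adjoint_apply_def
  by (intro borel_measurable_sum borel_measurable_times measurable_compose[OF measurable_unitary_entry borel_measurable_cnj]) auto

text \<open>The columns \<open>i\<close> and \<open>j\<close> are the normalised vectors (1,
  \<open>cnj \<tau>\<close>) and (\<open>- \<tau>\<close>, 1). The conjugate is chosen because
  \<open>adjoint_apply\<close> conjugates entries: multiplying \<open>V\<close> on the right sends
  \<open>u_i\<close> to \<open>(u_i + \<tau> * u_j) / sqrt (1 + |\<tau>|^2)\<close>.\<close>

definition plane_rotation :: "nat \<Rightarrow> nat \<Rightarrow> nat \<Rightarrow> complex \<Rightarrow> complex mat" where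
  "plane_rotation N i j \<tau> = mat N N (\<lambda>(l, k).
     if k = i then (if l = i then 1 else if l = j then cnj \<tau> else 0) / sqrt (1 + (cmod \<tau>)\<^sup>2)
     else if k = j then (if l = i then - \<tau> else if l = j then 1 else 0) / sqrt (1 + (cmod \<tau>)\<^sup>2)
     else if l = k then 1 else 0)"

lemma sum_two_plus_rest:
  fixes f :: "nat \<Rightarrow> 'a::comm_monoid_add"
  assumes "i < N" "j < N" "i \<noteq> j"
  shows "(\<Sum>l<N. f l) = f i + (f j + (\<Sum>l\<in>{..<N} - {i, j}. f l))"
proof -
  have eq: "{..<N} = insert i (insert j ({..<N} - {i, j}))" using assms by auto
  have "(\<Sum>l<N. f l) = (\<Sum>l\<in>insert i (insert j ({..<N} - {i, j})). f l)"
    by (rule sum.cong[OF eq refl])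
  also have "\<dots> = f i + (f j + (\<Sum>l\<in>{..<N} - {i, j}. f l))"
    using assms by (subst sum.insert, simp, simp, subst sum.insert) auto
  finally show ?thesis .
qed

lemma plane_rotation_unitary:
  assumes ij: "i < N" "j < N" "i \<noteq> j"
  shows "plane_rotation N i j \<tau> \<in> unitary_group N"
proof -
  let ?R = "plane_rotation N i j \<tau>"
  define r where "r = complex_of_real (sqrt (1 + (cmod \<tau>)\<^sup>2))"
  have pos: "1 + (cmod \<tau>)\<^sup>2 > 0" by (simp add: add_pos_nonneg)
  have rr: "r * r = 1 + \<tau> * cnj \<tau>"
    unfolding r_def of_real_mult[symmetric] complex_norm_square[symmetric] using pos by simp
  have r0: "r \<noteq> 0" using pos by (simp add: r_def)
  have cr: "cnj r = r" by (simp add: r_def)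
  have R: "?R \<in> carrier_mat N N" by (simp add: plane_rotation_def)
  have e: "?R $$ (l, k) = (if k = i then (if l = i then 1 else if l = j then cnj \<tau> else 0) / r
     else if k = j then (if l = i then - \<tau> else if l = j then 1 else 0) / r else if l = k then 1 else 0)"
    if "l < N" "k < N" for l k
    using that by (simp add: plane_rotation_def r_def)
  have "mat_adjoint ?R * ?R = 1\<^sub>m N"
  proof (rule eq_matI)
    fix p q assume "p < dim_row (1\<^sub>m N)" "q < dim_col (1\<^sub>m N)"
    then have pq: "p < N" "q < N" by auto
    have "(mat_adjoint ?R * ?R) $$ (p, q) = (\<Sum>l<N. cnj (?R $$ (l, p)) * ?R $$ (l, q))"
      using R pq by (auto simp: scalar_prod_def lessThan_atLeast0 intro!: sum.cong)
    also have "\<dots> = cnj (?R $$ (i, p)) * ?R $$ (i, q) + (cnj (?R $$ (j, p)) * ?R $$ (j, q) +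
        (\<Sum>l\<in>{..<N} - {i, j}. cnj (?R $$ (l, p)) * ?R $$ (l, q)))"
      by (rule sum_two_plus_rest[OF ij])
    also have "(\<Sum>l\<in>{..<N} - {i, j}. cnj (?R $$ (l, p)) * ?R $$ (l, q)) = (if p \<in> {i, j} then 0 else if p = q then 1 else 0)"
    proof -
      have "(\<Sum>l\<in>{..<N} - {i, j}. cnj (?R $$ (l, p)) * ?R $$ (l, q)) =
         (\<Sum>l\<in>{..<N} - {i, j}. if l = p then (if p = q then 1 else 0) else 0)"
        using pq ij by (intro sum.cong refl) (auto simp: e)
      then show ?thesis using pq by simp
    qed
    also have "cnj (?R $$ (i, p)) * ?R $$ (i, q) + (cnj (?R $$ (j, p)) * ?R $$ (j, q) + (if p \<in> {i, j} then 0 else if p = q then 1 else 0)) = (if p = q then 1 else 0)"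
    proof -
      have 1: "1 / (r * r) + \<tau> * cnj \<tau> / (r * r) = 1"
        using rr r0 by (simp add: add_divide_distrib[symmetric] del: mult_eq_0_iff) (simp flip: rr)
      show ?thesis
        using pq ij 1 by (auto simp: e cr mult.commute add.commute)
    qed
    finally show "(mat_adjoint ?R * ?R) $$ (p, q) = 1\<^sub>m N $$ (p, q)" using pq by simp
  qed (use R in auto)
  moreover from this have "?R * mat_adjoint ?R = 1\<^sub>m N"
    by (rule mat_mult_left_right_inverse[OF mat_adjoint_carrier[OF R] R])
  ultimately show ?thesis using R by (simp add: unitary_group_def)
qed

lemma unitary_group_mult:
  assumes "U \<in> unitary_group N" "V \<in> unitary_group N"
  shows "U * V \<in> unitary_group N"
proof -
  note u = unitary_groupD[OF assms(1)] and v = unitary_groupD[OF assms(2)]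
  have UV: "U * V \<in> carrier_mat N N" using u(1) v(1) by (rule mult_carrier_mat)
  have adj: "mat_adjoint (U * V) = mat_adjoint V * mat_adjoint U"
    by (rule eq_matI) (use u(1) v(1) in \<open>auto simp: scalar_prod_def mult.commute intro!: sum.cong\<close>)
  have "mat_adjoint (U * V) * (U * V) = mat_adjoint V * (mat_adjoint U * (U * V))"
    unfolding adj by (rule assoc_mult_mat[OF v(2) u(2) UV])
  also have "mat_adjoint U * (U * V) = (mat_adjoint U * U) * V"
    by (rule assoc_mult_mat[OF u(2) u(1) v(1), symmetric])
  also have "\<dots> = V" unfolding u(4) by (rule left_mult_one_mat[OF v(1)])
  finally have 1: "mat_adjoint (U * V) * (U * V) = 1\<^sub>m N" using v(4) by simp
  then have "(U * V) * mat_adjoint (U * V) = 1\<^sub>m N"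
    by (rule mat_mult_left_right_inverse[OF mat_adjoint_carrier[OF UV] UV])
  with 1 UV show ?thesis by (simp add: unitary_group_def)
qed

text \<open>Right invariance of Haar measure under \<open>plane_rotation\<close> equates the moments
  of coordinate \<open>i\<close> before and after the rotation; clearing the normalising factor
  gives \<open>rotate_u\<close>.\<close>

lemma haar_vector_rotation_invariant:
  assumes P: "prob_space P" and N: "N > 0" and V: "V \<in> measurable P (unitary_borel N)"
    and haar: "haar_unitary N (distr P (unitary_borel N) V)" and v: "v \<in> unit_sphere N"
  shows "rotation_invariant_vector P N (\<lambda>\<omega>. adjoint_apply N (V \<omega>) v)"
proof -
  interpret prob_space P by fact
  have VU: "V \<omega> \<in> unitary_group N" if "\<omega> \<in> space P" for \<omega>
    using measurable_space[OF V that] by simp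
  show ?thesis
  proof
    show "0 < N" by fact
    show "(\<lambda>\<omega>. adjoint_apply N (V \<omega>) v j) \<in> borel_measurable P" if "j < N" for j
      by (rule measurable_compose[OF V measurable_adjoint_apply[OF that]])
    show "(\<Sum>j<N. (cmod (adjoint_apply N (V \<omega>) v j))\<^sup>2) = 1" if "\<omega> \<in> space P" for \<omega>
      by (rule norm_adjoint_apply[OF VU[OF that] v])
    fix i j \<tau> k assume ij: "i < N" "j < N" "i \<noteq> j"
    let ?R = "plane_rotation N i j \<tau>"
    have RU: "?R \<in> unitary_group N" by (rule plane_rotation_unitary[OF ij])
    note R = unitary_groupD(1)[OF RU]
    define r where "r = sqrt (1 + (cmod \<tau>)\<^sup>2)"
    have r: "r > 0" "r\<^sup>2 = 1 + (cmod \<tau>)\<^sup>2" by (auto simp: r_def add_pos_nonneg)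
    let ?f = "\<lambda>X. cmod (adjoint_apply N X v i) ^ (2 * k)"
    have mf: "?f \<in> borel_measurable (unitary_borel N)"
    proof -
      note measurable_adjoint_apply[OF ij(1), measurable]
      show ?thesis by measurable
    qed
    have mR: "(\<lambda>X. X * ?R) \<in> measurable (unitary_borel N) (unitary_borel N)"
    proof -
      have "(\<lambda>X. X * ?R) \<in> measurable (unitary_borel N) (mat_borel N)"
      proof (rule measurable_mat_borelI)
        show "X * ?R \<in> carrier_mat N N" if "X \<in> space (unitary_borel N)" for X
          using that R by (auto simp: unitary_group_def)
        fix p q assume pq: "p < N" "q < N"
        have "(\<lambda>X. \<Sum>l<N. X $$ (p, l) * ?R $$ (l, q)) \<in> borel_measurable (unitary_borel N)"
          using pq by (intro borel_measurable_sum borel_measurable_times measurable_unitary_entry) auto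
        also have "?this \<longleftrightarrow> (\<lambda>X. (X * ?R) $$ (p, q)) \<in> borel_measurable (unitary_borel N)"
          using pq R by (intro measurable_cong) (auto simp: scalar_prod_def unitary_group_def lessThan_atLeast0 intro!: sum.cong)
        finally show "(\<lambda>X. (X * ?R) $$ (p, q)) \<in> borel_measurable (unitary_borel N)" .
      qed
      then show ?thesis
        unfolding unitary_borel_def[of N]
        by (rule measurable_restrict_space2[rotated])
          (use unitary_group_mult[OF _ RU] in \<open>auto simp: unitary_borel_def[symmetric]\<close>)
    qed
    have "distr (distr P (unitary_borel N) V) (unitary_borel N) (\<lambda>X. X * ?R) = distr P (unitary_borel N) V"
      using haar RU by (auto simp: haar_unitary_def)
    then have eq: "distr P (unitary_borel N) (\<lambda>\<omega>. V \<omega> * ?R) = distr P (unitary_borel N) V"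
      by (simp add: distr_distr[OF mR V] comp_def)
    have rot: "adjoint_apply N (V \<omega> * ?R) v i = (adjoint_apply N (V \<omega>) v i + \<tau> * adjoint_apply N (V \<omega>) v j) / r"
      if "\<omega> \<in> space P" for \<omega>
    proof -
      have c: "V \<omega> \<in> carrier_mat N N" using VU[OF that] by (simp add: unitary_group_def)
      have "(V \<omega> * ?R) $$ (p, i) = (V \<omega> $$ (p, i) + cnj \<tau> * V \<omega> $$ (p, j)) / r" if "p < N" for p
      proof -
        have "(V \<omega> * ?R) $$ (p, i) = (\<Sum>l<N. V \<omega> $$ (p, l) * ?R $$ (l, i))"
          using c R that ij by (auto simp: scalar_prod_def lessThan_atLeast0 intro!: sum.cong)
        also have "\<dots> = V \<omega> $$ (p, i) * ?R $$ (i, i) + (V \<omega> $$ (p, j) * ?R $$ (j, i) + (\<Sum>l\<in>{..<N} - {i, j}. V \<omega> $$ (p, l) * ?R $$ (l, i)))"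
          by (rule sum_two_plus_rest[OF ij])
        also have "(\<Sum>l\<in>{..<N} - {i, j}. V \<omega> $$ (p, l) * ?R $$ (l, i)) = 0"
          using ij by (intro sum.neutral) (auto simp: plane_rotation_def)
        finally show ?thesis using ij r by (simp add: plane_rotation_def r_def field_simps)
      qed
      then have "adjoint_apply N (V \<omega> * ?R) v i = (\<Sum>p<N. (cnj (V \<omega> $$ (p, i)) * v $ p + \<tau> * (cnj (V \<omega> $$ (p, j)) * v $ p)) / r)"
        unfolding adjoint_apply_def by (intro sum.cong refl) (simp add: algebra_simps)
      also have "\<dots> = (adjoint_apply N (V \<omega>) v i + \<tau> * adjoint_apply N (V \<omega>) v j) / r"
        by (simp only: adjoint_apply_def sum_divide_distrib[symmetric] sum.distrib sum_distrib_left)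
      finally show ?thesis .
    qed
    have "expectation (\<lambda>\<omega>. ?f (V \<omega>)) = integral\<^sup>L (distr P (unitary_borel N) V) ?f"
      by (rule integral_distr[OF V mf, symmetric])
    also have "\<dots> = integral\<^sup>L (distr P (unitary_borel N) (\<lambda>\<omega>. V \<omega> * ?R)) ?f" by (simp only: eq)
    also have "\<dots> = expectation (\<lambda>\<omega>. ?f (V \<omega> * ?R))"
      by (rule integral_distr[OF measurable_compose[OF V mR] mf])
    also have "\<dots> = expectation (\<lambda>\<omega>. cmod (adjoint_apply N (V \<omega>) v i + \<tau> * adjoint_apply N (V \<omega>) v j) ^ (2 * k) / (1 + (cmod \<tau>)\<^sup>2) ^ k)"
    proof (intro Bochner_Integration.integral_cong refl)
      fix \<omega> assume "\<omega> \<in> space P"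
      have "r ^ (2 * k) = (1 + (cmod \<tau>)\<^sup>2) ^ k" by (simp only: power_mult r(2))
      then show "?f (V \<omega> * ?R) = cmod (adjoint_apply N (V \<omega>) v i + \<tau> * adjoint_apply N (V \<omega>) v j) ^ (2 * k) / (1 + (cmod \<tau>)\<^sup>2) ^ k"
        using r(1) unfolding rot[OF \<open>\<omega> \<in> space P\<close>] by (simp add: norm_divide power_divide)
    qed
    finally have E: "expectation (\<lambda>\<omega>. ?f (V \<omega>)) =
       expectation (\<lambda>\<omega>. cmod (adjoint_apply N (V \<omega>) v i + \<tau> * adjoint_apply N (V \<omega>) v j) ^ (2 * k) / (1 + (cmod \<tau>)\<^sup>2) ^ k)" .
    show "expectation (\<lambda>\<omega>. cmod (adjoint_apply N (V \<omega>) v i + \<tau> * adjoint_apply N (V \<omega>) v j) ^ (2 * k)) =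
       (1 + (cmod \<tau>)\<^sup>2) ^ k * expectation (\<lambda>\<omega>. cmod (adjoint_apply N (V \<omega>) v i) ^ (2 * k))"
    proof -
      define c where "c = (1 + (cmod \<tau>)\<^sup>2) ^ k"
      have "c > 0" by (simp add: c_def add_pos_nonneg)
      then show ?thesis unfolding E c_def[symmetric] by simp
    qed
  qed
qed

lemma preimages_compose_subset:
  assumes X: "X \<in> measurable M S" and f: "f \<in> measurable S S'"
  shows "{(\<lambda>\<omega>. f (X \<omega>)) -` A \<inter> space M |A. A \<in> sets S'} \<subseteq> {X -` A \<inter> space M |A. A \<in> sets S}"
proof (rule subsetI)
  fix B assume "B \<in> {(\<lambda>\<omega>. f (X \<omega>)) -` A \<inter> space M |A. A \<in> sets S'}"
  then obtain A where A: "A \<in> sets S'" and B: "B = (\<lambda>\<omega>. f (X \<omega>)) -` A \<inter> space M" by blast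
  have "B = X -` (f -` A \<inter> space S) \<inter> space M"
    unfolding B by (rule Set.set_eqI) (simp, use measurable_space[OF X] in blast)
  moreover have "f -` A \<inter> space S \<in> sets S" by (rule measurable_sets[OF f A])
  ultimately show "B \<in> {X -` A \<inter> space M |A. A \<in> sets S}" by blast
qed

lemma (in prob_space) indep_set_subset:
  assumes "indep_set A' B'" "A \<subseteq> A'" "B \<subseteq> B'"
  shows "indep_set A B"
  using assms(1) unfolding indep_set_def
  by (rule indep_sets_mono_sets) (use assms(2,3) in \<open>simp split: bool.split\<close>)

lemma (in prob_space) indep_rv_compose:
  assumes "indep_rv M S X T Y" and f: "f \<in> measurable S S'" and g: "g \<in> measurable T T'"
  shows "indep_rv M S' (\<lambda>\<omega>. f (X \<omega>)) T' (\<lambda>\<omega>. g (Y \<omega>))"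
proof -
  have X: "X \<in> measurable M S" and Y: "Y \<in> measurable M T"
    and ind: "indep_set {X -` A \<inter> space M |A. A \<in> sets S} {Y -` B \<inter> space M |B. B \<in> sets T}"
    using assms(1) by (simp_all add: indep_rv_def)
  from indep_set_subset[OF ind preimages_compose_subset[OF X f] preimages_compose_subset[OF Y g]]
  show ?thesis
    using measurable_compose[OF X f] measurable_compose[OF Y g] unfolding indep_rv_def by (intro conjI)
qed

lemma (in prob_space) indep_rv_sym:
  assumes "indep_rv M S X T Y"
  shows "indep_rv M T Y S X"
proof -
  have ind: "indep_set {X -` A \<inter> space M |A. A \<in> sets S} {Y -` B \<inter> space M |B. B \<in> sets T}"
    using assms by (simp add: indep_rv_def)
  have "indep_set B A" if "indep_set A B" for A B
    unfolding indep_sets2_eq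
  proof (intro conjI ballI)
    show "A \<subseteq> events" "B \<subseteq> events" using that by (simp_all add: indep_sets2_eq)
    fix b a assume "b \<in> B" "a \<in> A"
    then show "prob (b \<inter> a) = prob b * prob a"
      using indep_setD[OF that] by (simp add: Int_commute mult.commute)
  qed
  from this[OF ind] show ?thesis using assms by (simp add: indep_rv_def)
qed

text \<open>\<open>indep_var\<close> concerns the generated sigma-algebras and
  \<open>indep_rv\<close> the families of preimages, which they contain.\<close>

lemma (in prob_space) indep_var_imp_indep_rv:
  assumes "indep_var S X T Y"
  shows "indep_rv M S X T Y"
proof -
  have X: "random_variable S X" and Y: "random_variable T Y" and
    ind: "indep_set (sigma_sets (space M) {X -` A \<inter> space M |A. A \<in> sets S}) (sigma_sets (space M) {Y -` A \<inter> space M |A. A \<in> sets T})"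
    using assms by (simp_all add: indep_var_eq)
  have "A \<subseteq> sigma_sets (space M) A" for A by (intro subsetI sigma_sets.Basic)
  from indep_set_subset[OF ind this this] X Y show ?thesis by (simp add: indep_rv_def)
qed

subsection \<open>The Gaussian limit\<close>

text \<open>\<open>char_S_near_gaussian\<close> identifies the limits of the joint characteristic
  functions and \<open>second_moment_S\<close> gives the uniform moment bound; together they feed
  \<open>sequence_functional_convergence\<close>.\<close>

theorem gaussian_limit:
  fixes P :: "nat \<Rightarrow> 'a measure" and U :: "nat \<Rightarrow> 'a \<Rightarrow> nat \<Rightarrow> complex"
    and Q :: "'b measure" and c :: "nat \<Rightarrow> 'b \<Rightarrow> complex" and s :: "nat \<Rightarrow> complex"
    and F :: "(nat \<Rightarrow> complex) \<Rightarrow> real"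
  assumes W: "\<And>N. N \<ge> 1 \<Longrightarrow> weighted_unit_sum (P N) N (U N) (Z N) (\<delta> N)"
    and \<delta>: "(\<lambda>N. sqrt N * \<delta> N) \<longlonglongrightarrow> 0" and s: "s \<longlonglongrightarrow> 1"
    and Q: "prob_space Q" and c: "\<And>k. k \<ge> 1 \<Longrightarrow> std_complex_gaussian Q (c k)"
    and ind: "prob_space.indep_vars Q (\<lambda>_. borel) c {1..}"
    and \<rho>: "0 < \<rho>" "\<rho> < 1" and F: "\<And>C. continuous_on (weighted_cube \<rho> C) F"
    and mF: "F \<in> borel_measurable borel" and bF: "\<And>x. \<bar>F x\<bar> \<le> B"
  shows "(\<lambda>N. \<integral>\<omega>. F (\<lambda>k. s N * sqrt N / sqrt 2 * (\<Sum>j<N. (cmod (U N \<omega> j))\<^sup>2 * cnj (Z N j \<omega>) ^ Suc k)) \<partial>P N)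
    \<longlonglongrightarrow> (\<integral>\<omega>. F (\<lambda>k. c (Suc k) \<omega>) \<partial>Q)"
proof -
  define T where "T N k \<omega> = sqrt N * (\<Sum>j<N. (cmod (U N \<omega> j))\<^sup>2 * cnj (Z N j \<omega>) ^ Suc k)" for N k \<omega>
  define X where "X N \<omega> k = s N / sqrt 2 * T N k \<omega>" for N \<omega> k
  have TS: "T N k = weighted_unit_sum.S N (U N) (Z N) k" if "N \<ge> 1" for N k
  proof -
    interpret weighted_unit_sum "P N" N "U N" "Z N" "\<delta> N" by (rule W[OF that])
    show ?thesis by (rule ext) (simp only: T_def S_def w_def)
  qed
  have mT: "T N k \<in> borel_measurable (P N)" if "N \<ge> 1" for N k
    unfolding TS[OF that] by (rule weighted_unit_sum.S_measurable[OF W[OF that]])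
  have mX: "(\<lambda>\<omega>. X N \<omega> k) \<in> borel_measurable (P N)" if "N \<ge> 1" for N k
    unfolding X_def using mT[OF that] by (intro borel_measurable_times) auto
  have iX: "integrable (P N) (\<lambda>\<omega>. (cmod (X N \<omega> k))\<^sup>2)" if "N \<ge> 1" for N k
    unfolding X_def norm_mult power_mult_distrib TS[OF that]
    by (intro integrable_mult_right weighted_unit_sum.integrable_S_square[OF W[OF that]])
  have PP: "prob_space (P N)" if "N \<ge> 1" for N
    using W[OF that] by (simp add: weighted_unit_sum_def rotation_invariant_vector_def)
  have \<delta>0: "\<delta> N \<ge> 0" if "N \<ge> 1" for N by (rule weighted_unit_sum.delta_nonneg[OF W[OF that]])
  have ev1: "\<forall>\<^sub>F N in sequentially. N \<ge> 1" by (rule eventually_ge_at_top)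
  \<comment> \<open>For \<open>N \<ge> 1\<close> the nonnegative \<open>\<delta> N\<close> is at
    most \<open>sqrt N * \<delta> N\<close>.\<close>
  have \<delta>lim: "\<delta> \<longlonglongrightarrow> 0"
  proof (rule tendsto_sandwich[OF _ _ tendsto_const \<delta>])
    show "\<forall>\<^sub>F N in sequentially. 0 \<le> \<delta> N" using ev1 by eventually_elim (rule \<delta>0)
    show "\<forall>\<^sub>F N in sequentially. \<delta> N \<le> sqrt N * \<delta> N"
      using ev1
    proof eventually_elim
      case (elim N)
      then have "1 * \<delta> N \<le> sqrt N * \<delta> N" using \<delta>0[OF elim] by (intro mult_right_mono) auto
      then show ?case by simp
    qed
  qed
  have inv_sqrt: "(\<lambda>N. 1 / sqrt (real N)) \<longlonglongrightarrow> 0" by real_asymp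
  have inv: "(\<lambda>N. 1 / real N) \<longlonglongrightarrow> 0" by real_asymp
  have slim: "(\<lambda>N. cmod (s N)) \<longlonglongrightarrow> 1" using tendsto_norm[OF s] by simp
  have char: "(\<lambda>N. \<integral>\<omega>. iexp (Re (\<Sum>k<K. \<alpha> k * X N \<omega> k)) \<partial>P N)
     \<longlonglongrightarrow> (\<integral>\<omega>. iexp (Re (\<Sum>k<K. \<alpha> k * c (Suc k) \<omega>)) \<partial>Q)" for K \<alpha>
  proof -
    \<comment> \<open>The factor \<open>s N / sqrt 2\<close> is moved into the coefficients of the
      linear form. In the limit this halves the squares and gives
      \<open>\<sigma>0 = (\<Sum>k<K. |\<alpha> k|^2) / 4\<close>, the exponent of the Gaussian
      side.\<close>
    let ?\<beta> = "\<lambda>N k. \<alpha> k * (s N / sqrt 2)"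
    define b where "b N = (\<Sum>k<K. cmod (?\<beta> N k))" for N
    define \<sigma> where "\<sigma> N = (\<Sum>k<K. (cmod (?\<beta> N k))\<^sup>2) / 2" for N
    define b0 where "b0 = (\<Sum>k<K. cmod (\<alpha> k) * (1 / sqrt 2))"
    define \<sigma>0 where "\<sigma>0 = (\<Sum>k<K. (cmod (\<alpha> k) * (1 / sqrt 2))\<^sup>2) / 2"
    let ?E = "\<lambda>N. \<integral>\<omega>. iexp (Re (\<Sum>k<K. \<alpha> k * X N \<omega> k)) \<partial>P N"
    let ?err = "\<lambda>N. b N * (sqrt N * \<delta> N) + (b N)\<^sup>2 * \<delta> N + (b N) ^ 3 * (1 / sqrt N) + 3 * (\<sigma> N)\<^sup>2 * (1 / N) + \<sigma> N * (1 / sqrt N)"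
    have blim: "b \<longlonglongrightarrow> b0"
      unfolding b_def[abs_def] b0_def norm_mult norm_divide norm_of_real
      by (intro tendsto_intros slim) auto
    have \<sigma>lim: "\<sigma> \<longlonglongrightarrow> \<sigma>0"
      unfolding \<sigma>_def[abs_def] \<sigma>0_def norm_mult norm_divide norm_of_real
      by (intro tendsto_intros slim) auto
    have near: "cmod (?E N - exp (- \<sigma> N)) \<le> ?err N" if "N \<ge> 1" for N
    proof -
      interpret weighted_unit_sum "P N" N "U N" "Z N" "\<delta> N" by (rule W[OF that])
      have "?E N = expectation (\<lambda>\<omega>. iexp (Re (\<Sum>k<K. ?\<beta> N k * S k \<omega>)))"
        by (simp only: X_def TS[OF that] mult.assoc)
      moreover have "cmod (expectation (\<lambda>\<omega>. iexp (Re (\<Sum>k<K. ?\<beta> N k * S k \<omega>))) - exp (- \<sigma> N)) \<le>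
         sqrt N * (b N * \<delta> N) + (b N)\<^sup>2 * \<delta> N + b N ^ 3 / sqrt N + 3 * (\<sigma> N)\<^sup>2 / N + \<sigma> N / sqrt N"
        unfolding b_def \<sigma>_def by (rule char_S_near_gaussian)
      ultimately show ?thesis by (simp add: mult_ac)
    qed
    have "?err \<longlonglongrightarrow> b0 * 0 + b0\<^sup>2 * 0 + b0 ^ 3 * 0 + 3 * \<sigma>0\<^sup>2 * 0 + \<sigma>0 * 0"
      by (intro tendsto_intros blim \<sigma>lim \<delta> \<delta>lim inv inv_sqrt)
    then have err: "?err \<longlonglongrightarrow> 0" by simp
    have "(\<lambda>N. ?E N - exp (- \<sigma> N)) \<longlonglongrightarrow> 0"
      by (rule Lim_null_comparison[OF _ err]) (use ev1 in eventually_elim, rule near)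
    moreover have "(\<lambda>N. complex_of_real (exp (- \<sigma> N))) \<longlonglongrightarrow> complex_of_real (exp (- \<sigma>0))"
      by (intro tendsto_intros \<sigma>lim)
    ultimately have "(\<lambda>N. (?E N - exp (- \<sigma> N)) + exp (- \<sigma> N)) \<longlonglongrightarrow> 0 + complex_of_real (exp (- \<sigma>0))"
      by (rule tendsto_add)
    then have "?E \<longlonglongrightarrow> complex_of_real (exp (- \<sigma>0))" by simp
    also have "complex_of_real (exp (- \<sigma>0)) = (\<integral>\<omega>. iexp (Re (\<Sum>k<K. \<alpha> k * c (Suc k) \<omega>)) \<partial>Q)"
    proof -
      have "- \<sigma>0 = - (\<Sum>k<K. (cmod (\<alpha> k))\<^sup>2) / 4"
        by (simp add: \<sigma>0_def power_mult_distrib power_divide sum_divide_distrib[symmetric])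
      then show ?thesis
        using char_indep_std_complex_gaussian[where c = c and K = K and \<alpha> = \<alpha>, OF Q c ind] by (simp only:)
    qed
    finally show ?thesis .
  qed
  define m0 where "m0 = (\<integral>z. (cmod z)\<^sup>2 \<partial>distr (half_normal \<Otimes>\<^sub>M half_normal) borel (\<lambda>(x, y). Complex x y))"
  \<comment> \<open>The constant 6 is \<open>2^2 / 2 * 3\<close>: eventually
    \<open>|s N| < 2\<close>, and the second moment of \<open>T\<close> is at most
    \<open>2 + 1\<close> once \<open>sqrt N * \<delta> N < 1\<close>.\<close>
  define m where "m = max m0 6"
  have mom: "\<forall>\<^sub>F N in sequentially. \<forall>k. (\<integral>\<omega>. (cmod (X N \<omega> k))\<^sup>2 \<partial>P N) \<le> m"
  proof -
    have "\<forall>\<^sub>F N in sequentially. cmod (s N) < 2" by (rule order_tendstoD(2)[OF slim]) simp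
    moreover have "\<forall>\<^sub>F N in sequentially. sqrt N * \<delta> N < 1" by (rule order_tendstoD(2)[OF \<delta>]) simp
    ultimately show ?thesis using ev1
    proof eventually_elim
      case (elim N)
      show ?case
      proof
        fix k
        have "(sqrt N * \<delta> N)\<^sup>2 \<le> 1\<^sup>2" using elim \<delta>0[OF elim(3)] by (intro power_mono) auto
        then have "N * (\<delta> N)\<^sup>2 \<le> 1" by (simp add: power_mult_distrib)
        then have ET: "(\<integral>\<omega>. (cmod (T N k \<omega>))\<^sup>2 \<partial>P N) \<le> 3"
          using weighted_unit_sum.second_moment_S[OF W[OF elim(3)], of k] unfolding TS[OF elim(3)] by linarith
        have "(\<integral>\<omega>. (cmod (X N \<omega> k))\<^sup>2 \<partial>P N) = (cmod (s N))\<^sup>2 / 2 * (\<integral>\<omega>. (cmod (T N k \<omega>))\<^sup>2 \<partial>P N)"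
          unfolding X_def norm_mult power_mult_distrib by (simp add: norm_divide power_divide)
        also have "\<dots> \<le> 2\<^sup>2 / 2 * 3"
          using elim(1) ET by (intro mult_mono divide_right_mono power_mono) auto
        finally show "(\<integral>\<omega>. (cmod (X N \<omega> k))\<^sup>2 \<partial>P N) \<le> m" by (simp add: m_def)
      qed
    qed
  qed
  \<comment> \<open>The sequence is shifted by one because the hypotheses are given for
    \<open>N \<ge> 1\<close>, whereas the general theorem speaks about every index.\<close>
  have "(\<lambda>N. \<integral>\<omega>. F (X (Suc N) \<omega>) \<partial>P (Suc N)) \<longlonglongrightarrow> (\<integral>\<omega>. F (\<lambda>k. c (Suc k) \<omega>) \<partial>Q)"
  proof (rule sequence_functional_convergence[where X = "\<lambda>N. X (Suc N)" and Y = "\<lambda>\<omega> k. c (Suc k) \<omega>" and P = "\<lambda>N. P (Suc N)", OF _ Q _ _ _ _ _ _ _ \<rho> _ mF bF])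
    show "prob_space (P (Suc N))" for N by (rule PP) simp
    show "(\<lambda>\<omega>. X (Suc N) \<omega> k) \<in> borel_measurable (P (Suc N))" for N k by (rule mX) simp
    show "(\<lambda>\<omega>. c (Suc k) \<omega>) \<in> borel_measurable Q" for k
      using distr_std_complex_gaussian(1)[OF c[of "Suc k"]] by simp
    show "(\<lambda>N. \<integral>\<omega>. iexp (Re (\<Sum>k<K. \<alpha> k * X (Suc N) \<omega> k)) \<partial>P (Suc N))
       \<longlonglongrightarrow> (\<integral>\<omega>. iexp (Re (\<Sum>k<K. \<alpha> k * c (Suc k) \<omega>)) \<partial>Q)" for K \<alpha>
      by (rule LIMSEQ_Suc[OF char])
    show "integrable (P (Suc N)) (\<lambda>\<omega>. (cmod (X (Suc N) \<omega> k))\<^sup>2)" for N k by (rule iX) simp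
    show "integrable Q (\<lambda>\<omega>. (cmod (c (Suc k) \<omega>))\<^sup>2)" for k
      by (rule integrable_std_complex_gaussian_square(1)[OF c]) simp
    show "\<forall>\<^sub>F N in sequentially. \<forall>k. (\<integral>\<omega>. (cmod (X (Suc N) \<omega> k))\<^sup>2 \<partial>P (Suc N)) \<le> m"
      by (rule eventually_compose_filterlim[OF mom filterlim_Suc])
    show "(\<integral>\<omega>. (cmod (c (Suc k) \<omega>))\<^sup>2 \<partial>Q) \<le> m" for k
      using integrable_std_complex_gaussian_square(2)[OF c[of "Suc k"]] by (simp add: m_def m0_def)
    show "continuous_on {x. \<forall>k. cmod (x k) * \<rho> ^ k \<le> C} F" for C
      using F[of C] by (simp only: weighted_cube_def)
  qed
  then have "(\<lambda>N. \<integral>\<omega>. F (X N \<omega>) \<partial>P N) \<longlonglongrightarrow> (\<integral>\<omega>. F (\<lambda>k. c (Suc k) \<omega>) \<partial>Q)"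
    by (rule LIMSEQ_imp_Suc)
  moreover have "X N \<omega> = (\<lambda>k. s N * sqrt N / sqrt 2 * (\<Sum>j<N. (cmod (U N \<omega> j))\<^sup>2 * cnj (Z N j \<omega>) ^ Suc k))" for N \<omega>
    by (rule ext) (simp add: X_def T_def)
  ultimately show ?thesis by (simp only:)
qed

section \<open>Coefficients as measurable functions of the matrix and the vector\<close>

primrec adjoint_iterate :: "nat \<Rightarrow> complex mat \<Rightarrow> complex vec \<Rightarrow> nat \<Rightarrow> nat \<Rightarrow> complex" where
  "adjoint_iterate N A v 0 = (\<lambda>i. v $ i)"
| "adjoint_iterate N A v (Suc k) = (\<lambda>i. \<Sum>j<N. cnj (A $$ (j, i)) * adjoint_iterate N A v k j)"

text \<open>The quadratic form at \<open>v\<close> of the k-th power of the adjoint of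
  \<open>A\<close>. It uses only entries of \<open>A\<close> and \<open>v\<close>, so the
  coefficients become functions of the pair (M, v), whose independence is assumed, without reference
  to a diagonalisation.\<close>

definition spectral_moment :: "nat \<Rightarrow> complex mat \<Rightarrow> complex vec \<Rightarrow> nat \<Rightarrow> complex" where
  "spectral_moment N A v k = (\<Sum>i<N. cnj (v $ i) * adjoint_iterate N A v k i)"

lemma conjugated_diag_index:
  assumes V: "V \<in> unitary_group N" and "j < N" "i < N"
  shows "(V * mat_diag N Z * mat_adjoint V) $$ (j, i) = (\<Sum>p<N. V $$ (j, p) * Z p * cnj (V $$ (i, p)))"
proof -
  note c = unitary_groupD(1,2)[OF V]
  have VD: "V * mat_diag N Z = mat N N (\<lambda>(j, p). V $$ (j, p) * Z p)"
    using c(1) by (subst mat_diag_mult_right[of _ N N]) auto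
  show ?thesis unfolding VD
    using c assms(2,3) by (auto simp: scalar_prod_def lessThan_atLeast0 intro!: sum.cong)
qed

text \<open>By induction, the k-th iterate of \<open>v\<close> is \<open>V\<close> applied to the
  vector with entries \<open>cnj (Z l) ^ k * u l\<close>; orthonormality of the columns of
  \<open>V\<close> collapses the double sum at each step.\<close>

lemma spectral_moment_conjugated_diag:
  assumes V: "V \<in> unitary_group N"
  shows "spectral_moment N (V * mat_diag N Z * mat_adjoint V) v k =
    (\<Sum>l<N. (cmod (adjoint_apply N V v l))\<^sup>2 * cnj (Z l) ^ k)"
proof -
  define u where "u = adjoint_apply N V v"
  let ?A = "V * mat_diag N Z * mat_adjoint V"
  have it: "adjoint_iterate N ?A v k i = (\<Sum>l<N. V $$ (i, l) * (cnj (Z l) ^ k * u l))" if "i < N" for i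
    using that
  proof (induction k arbitrary: i)
    case 0
    then show ?case using apply_adjoint_apply[OF V 0, of v] by (simp add: u_def)
  next
    case (Suc k)
    have "adjoint_iterate N ?A v (Suc k) i =
       (\<Sum>j<N. (\<Sum>p<N. cnj (V $$ (j, p)) * (cnj (Z p) * V $$ (i, p))) * (\<Sum>l<N. V $$ (j, l) * (cnj (Z l) ^ k * u l)))"
      unfolding adjoint_iterate.simps
    proof (intro sum.cong refl arg_cong2[where f = "(*)"])
      fix j assume "j \<in> {..<N}"
      then have "j < N" by simp
      show "cnj (?A $$ (j, i)) = (\<Sum>p<N. cnj (V $$ (j, p)) * (cnj (Z p) * V $$ (i, p)))"
        unfolding conjugated_diag_index[OF V \<open>j < N\<close> Suc.prems] by (simp add: mult.assoc)
      show "adjoint_iterate N ?A v k j = (\<Sum>l<N. V $$ (j, l) * (cnj (Z l) ^ k * u l))"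
        by (rule Suc.IH[OF \<open>j < N\<close>])
    qed
    also have "\<dots> = (\<Sum>j<N. \<Sum>p<N. \<Sum>l<N. (cnj (Z p) * V $$ (i, p) * (cnj (Z l) ^ k * u l)) * (cnj (V $$ (j, p)) * V $$ (j, l)))"
      unfolding sum_product by (intro sum.cong refl) (simp only: mult_ac)
    also have "\<dots> = (\<Sum>p<N. \<Sum>l<N. \<Sum>j<N. (cnj (Z p) * V $$ (i, p) * (cnj (Z l) ^ k * u l)) * (cnj (V $$ (j, p)) * V $$ (j, l)))"
      by (rule trans[OF sum.swap], rule sum.cong[OF refl], rule sum.swap)
    also have "\<dots> = (\<Sum>p<N. \<Sum>l<N. (cnj (Z p) * V $$ (i, p) * (cnj (Z l) ^ k * u l)) * (if p = l then 1 else 0))"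
      unfolding sum_distrib_left[symmetric]
      by (intro sum.cong refl arg_cong2[where f = "(*)"] unitary_entries(2)[OF V]) auto
    also have "\<dots> = (\<Sum>p<N. V $$ (i, p) * (cnj (Z p) ^ Suc k * u p))"
    proof (intro sum.cong refl)
      fix p assume "p \<in> {..<N}"
      then show "(\<Sum>l<N. (cnj (Z p) * V $$ (i, p) * (cnj (Z l) ^ k * u l)) * (if p = l then 1 else 0)) = V $$ (i, p) * (cnj (Z p) ^ Suc k * u p)"
        by (simp add: if_distrib[of "\<lambda>x. _ * x"] mult_ac cong: if_cong)
    qed
    finally show ?case .
  qed
  have "spectral_moment N ?A v k = (\<Sum>i<N. \<Sum>l<N. (cnj (Z l) ^ k * u l) * (V $$ (i, l) * cnj (v $ i)))"
    unfolding spectral_moment_def using it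
    by (intro sum.cong refl) (simp add: sum_distrib_left mult_ac)
  also have "\<dots> = (\<Sum>l<N. (cnj (Z l) ^ k * u l) * cnj (u l))"
    by (subst sum.swap) (simp add: sum_distrib_left[symmetric] u_def adjoint_apply_def)
  also have "\<dots> = (\<Sum>l<N. (cmod (u l))\<^sup>2 * cnj (Z l) ^ k)"
    unfolding complex_norm_square by (intro sum.cong refl) (simp add: mult_ac)
  finally show ?thesis unfolding u_def .
qed

lemma spectral_moment_measurable:
  "(\<lambda>p. spectral_moment N (fst p) (snd p) k) \<in> borel_measurable (mat_borel N \<Otimes>\<^sub>M sphere_borel N)"
proof -
  have mA: "(\<lambda>p. cnj (fst p $$ (j, i))) \<in> borel_measurable (mat_borel N \<Otimes>\<^sub>M sphere_borel N)" if "i < N" "j < N" for i j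
    by (rule measurable_compose[OF measurable_compose[OF measurable_fst measurable_mat_entry[OF that(2,1)]] borel_measurable_cnj])
  have mv: "(\<lambda>p. snd p $ i) \<in> borel_measurable (mat_borel N \<Otimes>\<^sub>M sphere_borel N)" if "i < N" for i
    by (rule measurable_compose[OF measurable_snd measurable_sphere_entry[OF that]])
  have mi: "(\<lambda>p. adjoint_iterate N (fst p) (snd p) k i) \<in> borel_measurable (mat_borel N \<Otimes>\<^sub>M sphere_borel N)" if "i < N" for i
    using that
  proof (induction k arbitrary: i)
    case 0
    then show ?case using mv by simp
  next
    case (Suc k)
    then show ?case
      unfolding adjoint_iterate.simps by (intro borel_measurable_sum borel_measurable_times mA) auto
  qed
  show ?thesis
    unfolding spectral_moment_def
    by (intro borel_measurable_sum borel_measurable_times mi measurable_compose[OF mv borel_measurable_cnj]) auto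
qed

definition perturbation_coeff :: "complex \<Rightarrow> nat \<Rightarrow> complex mat \<Rightarrow> complex vec \<Rightarrow> nat \<Rightarrow> complex" where
  "perturbation_coeff a N A v k =
     (1 - a * complex_of_real (real N powr (- 1 / 2))) * sqrt N / sqrt 2 * spectral_moment N A v (Suc k)"

text \<open>For fixed \<open>N\<close> all coefficients share one bound since the weights sum to 1,
  and the constant term is nonzero. So the sequence avoids the default case of
  \<open>zero_functional\<close>.\<close>

lemma integral_eigenvalue_measure_perturbed:
  fixes Z :: "nat \<Rightarrow> complex" and a :: complex and g :: "complex \<Rightarrow> real" and N :: nat
  defines "A \<equiv> \<lambda>v. 1\<^sub>m N - (1 - a * complex_of_real (real N powr (- 1 / 2))) \<cdot>\<^sub>m outer_self v"
  assumes V: "V \<in> unitary_group N" and v: "v \<in> unit_sphere N" and Z: "\<And>i. i < N \<Longrightarrow> cmod (Z i) = 1"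
    and N: "N > 0" and "a \<noteq> 0"
    and g: "continuous_on (ball 0 1) g" and K: "\<And>z. z \<in> ball 0 1 - K \<Longrightarrow> g z = 0" "K \<subseteq> ball 0 \<rho>"
    and \<rho>: "0 < \<rho>" "\<rho> < 1"
  shows "(\<integral>z. g z \<partial>eigenvalue_measure (V * mat_diag N Z * mat_adjoint V * A v)) =
    zero_functional g \<rho> (cons_coeff (a / sqrt 2) (perturbation_coeff a N (V * mat_diag N Z * mat_adjoint V) v))"
proof -
  let ?M = "V * mat_diag N Z * mat_adjoint V"
  let ?s = "1 - a * complex_of_real (real N powr (- 1 / 2))"
  let ?x = "cons_coeff (a / sqrt 2) (perturbation_coeff a N ?M v)"
  note c = unitary_groupD(1,2)[OF V]
  have x: "perturbation_coeff a N ?M v = (\<lambda>k. ?s * sqrt N / sqrt 2 * (\<Sum>i<N. (cmod (adjoint_apply N V v i))\<^sup>2 * cnj (Z i) ^ Suc k))"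
    unfolding perturbation_coeff_def spectral_moment_conjugated_diag[OF V] ..
  have "perturbation_coeff a N ?M v \<in> weighted_cube \<rho> (cmod (?s * sqrt N / sqrt 2))"
    unfolding weighted_cube_def
  proof safe
    fix k
    have "cmod (\<Sum>i<N. complex_of_real ((cmod (adjoint_apply N V v i))\<^sup>2) * cnj (Z i) ^ Suc k) \<le> (\<Sum>i<N. (cmod (adjoint_apply N V v i))\<^sup>2)"
      by (intro sum_norm_le) (simp add: norm_mult norm_power Z)
    then have "cmod (\<Sum>i<N. complex_of_real ((cmod (adjoint_apply N V v i))\<^sup>2) * cnj (Z i) ^ Suc k) \<le> 1"
      by (simp only: norm_adjoint_apply[OF V v])
    then have "cmod (perturbation_coeff a N ?M v k) \<le> cmod (?s * sqrt N / sqrt 2) * 1"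
      unfolding x norm_mult[of "?s * sqrt N / sqrt 2"] by (intro mult_left_mono) auto
    moreover have "\<rho> ^ k \<le> 1" using \<rho> by (intro power_le_one) auto
    ultimately have "cmod (perturbation_coeff a N ?M v k) * \<rho> ^ k \<le> (cmod (?s * sqrt N / sqrt 2) * 1) * 1"
      using \<rho> by (intro mult_mono) auto
    then show "cmod (perturbation_coeff a N ?M v k) * \<rho> ^ k \<le> cmod (?s * sqrt N / sqrt 2)" by simp
  qed
  then have "?x \<in> weighted_cube \<rho> (max (cmod (a / sqrt 2)) (cmod (?s * sqrt N / sqrt 2)))"
    using \<rho> by (intro cons_coeff_weighted_cube) auto
  then have cube: "?x \<in> (\<Union>n::nat. weighted_cube \<rho> n)" by (rule weighted_cube_nat)
  have "?x 0 \<noteq> 0" using \<open>a \<noteq> 0\<close> by (simp add: cons_coeff_def)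
  then have nz: "?x \<noteq> (\<lambda>_. 0)" by (metis (full_types))
  have "A v \<in> carrier_mat N N"
    using v unfolding A_def outer_self_def unit_sphere_def by auto
  then have car: "?M * A v \<in> carrier_mat N N"
    using c by (intro mult_carrier_mat[of _ N N]) (auto intro: mult_carrier_mat)
  have "(\<integral>z. g z \<partial>eigenvalue_measure (?M * A v)) = zero_sum g (ball 0 \<rho>) (pser ?x)"
  proof (rule integral_eigenvalue_measure[OF car _ _ _ g K])
    show "(\<lambda>z. (\<Prod>i<N. z - Z i) * (sqrt 2 / sqrt N)) holomorphic_on ball 0 1"
      by (intro holomorphic_intros)
    show "(\<Prod>i<N. z - Z i) * (sqrt 2 / sqrt N) \<noteq> 0" if "z \<in> ball 0 1" for z
    proof -
      have "z - Z i \<noteq> 0" if "i < N" for i using Z[OF that] \<open>z \<in> ball 0 1\<close> by auto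
      then show ?thesis using N by simp
    qed
    show "poly (char_poly (?M * A v)) z = (\<Prod>i<N. z - Z i) * (sqrt 2 / sqrt N) * pser ?x z" if "z \<in> ball 0 1" for z
      unfolding A_def x by (rule char_poly_perturbed_pser[OF V v Z N that])
    show "\<rho> \<le> 1" using \<rho> by simp
  qed
  also have "\<dots> = zero_functional g \<rho> ?x"
    unfolding zero_functional_def using cube nz by simp
  finally show ?thesis .
qed

subsection \<open>Test functions\<close>

text \<open>The continuous step function makes the unbounded sum over zeros a bounded functional,
  and such steps determine convergence in distribution.\<close>

definition step_functional :: "(complex \<Rightarrow> real) \<Rightarrow> real \<Rightarrow> complex \<Rightarrow> real \<Rightarrow> real \<Rightarrow> (nat \<Rightarrow> complex) \<Rightarrow> real" where
  "step_functional g \<rho> c x y X = cts_step x y (zero_functional g \<rho> (cons_coeff c X))"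

lemma cts_step_continuous: "x < y \<Longrightarrow> continuous_on UNIV (cts_step x y)"
  by (intro uniformly_continuous_imp_continuous cts_step_uniformly_continuous)

lemma cts_step_bounded: "x < y \<Longrightarrow> \<bar>cts_step x y t\<bar> \<le> 1"
  by (auto simp: cts_step_def divide_simps)

lemma cons_coeff_continuous: "continuous_on S (cons_coeff c)"
proof (rule continuous_on_coordinatewise_then_product)
  fix k
  have "continuous_on UNIV (\<lambda>X :: nat \<Rightarrow> complex. X j)" for j by (rule continuous_on_product_coordinates)
  then have "continuous_on S (\<lambda>X :: nat \<Rightarrow> complex. X j)" for j by (rule continuous_on_subset) simp
  then show "continuous_on S (\<lambda>X. cons_coeff c X k)"
    by (cases k) (auto simp: cons_coeff_def intro: continuous_on_minus)
qed

lemma zero_functional_cons_measurable: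
  assumes "\<rho> > 0" and "continuous_on (ball 0 \<rho>) g"
    and "compact K" "K \<subseteq> ball 0 \<rho>" "\<And>z. z \<in> ball 0 \<rho> - K \<Longrightarrow> g z = 0"
  shows "(\<lambda>X. zero_functional g \<rho> (cons_coeff c X)) \<in> borel_measurable borel"
  by (rule measurable_compose[OF borel_measurable_continuous_onI[OF cons_coeff_continuous] zero_functional_measurable[OF assms]])

lemma step_functional_measurable:
  assumes "\<rho> > 0" and "continuous_on (ball 0 \<rho>) g"
    and "compact K" "K \<subseteq> ball 0 \<rho>" "\<And>z. z \<in> ball 0 \<rho> - K \<Longrightarrow> g z = 0" and "x < y"
  shows "step_functional g \<rho> c x y \<in> borel_measurable borel"
  unfolding step_functional_def[abs_def]
  by (rule measurable_compose[OF zero_functional_cons_measurable[OF assms(1-5)] borel_measurable_continuous_onI[OF cts_step_continuous[OF assms(6)]]])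

lemma step_functional_continuous:
  assumes \<rho>: "0 < \<rho>" "\<rho> \<le> 1" and g: "continuous_on (ball 0 \<rho>) g"
    and K: "compact K" "K \<subseteq> ball 0 \<rho>" "\<And>z. z \<in> ball 0 \<rho> - K \<Longrightarrow> g z = 0" and "x < y" "c \<noteq> 0"
  shows "continuous_on (weighted_cube \<rho> C) (step_functional g \<rho> c x y)"
proof -
  let ?C = "max (cmod c) C"
  have "cons_coeff c X \<noteq> (\<lambda>_. 0)" for X
  proof
    assume "cons_coeff c X = (\<lambda>_. 0)"
    then have "cons_coeff c X 0 = 0" by simp
    then show False using \<open>c \<noteq> 0\<close> by (simp add: cons_coeff_def)
  qed
  then have sub: "cons_coeff c ` weighted_cube \<rho> C \<subseteq> weighted_cube \<rho> ?C - {\<lambda>_. 0}"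
    using cons_coeff_weighted_cube[of _ \<rho> C c] \<rho> by auto
  have "continuous_on (weighted_cube \<rho> ?C - {\<lambda>_. 0}) (zero_functional g \<rho>)"
  proof -
    have "zero_functional g \<rho> x = zero_sum g (ball 0 \<rho>) (pser x)" if "x \<in> weighted_cube \<rho> ?C - {\<lambda>_. 0}" for x
      using that weighted_cube_nat[of x \<rho> ?C] unfolding zero_functional_def by simp
    then show ?thesis
      using zero_sum_pser_continuous[OF \<rho>(1) g K, of ?C] by (subst continuous_on_cong[OF refl]) auto
  qed
  from continuous_on_compose2[OF this cons_coeff_continuous sub]
  have "continuous_on (weighted_cube \<rho> C) (\<lambda>X. zero_functional g \<rho> (cons_coeff c X))" .
  then show ?thesis
    unfolding step_functional_def[abs_def]
    by (rule continuous_on_compose2[OF cts_step_continuous[OF \<open>x < y\<close>]]) simp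
qed

lemma weighted_cube_antimono:
  assumes "0 \<le> \<rho>" "\<rho> \<le> \<rho>'" "x \<in> weighted_cube \<rho>' C"
  shows "x \<in> weighted_cube \<rho> C"
  unfolding weighted_cube_def
proof safe
  fix k
  have "cmod (x k) * \<rho> ^ k \<le> cmod (x k) * \<rho>' ^ k" using assms by (intro mult_left_mono power_mono) auto
  also have "\<dots> \<le> C" using assms(3) by (simp add: weighted_cube_def)
  finally show "cmod (x k) * \<rho> ^ k \<le> C" .
qed

text \<open>A countable description of convergence on the whole unit disk: the radii start at 1/2,
  so all are positive, and increase to 1. Countability makes the set Borel.\<close>

definition disk_coeffs :: "(nat \<Rightarrow> complex) set" where
  "disk_coeffs = (\<Inter>n::nat. \<Union>m::nat. weighted_cube (1 - 1 / (real n + 2)) m)"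

lemma disk_coeffs_measurable: "disk_coeffs \<in> sets borel"
proof -
  have "range (\<lambda>m::nat. weighted_cube (1 - 1 / (real n + 2)) m) \<subseteq> sets borel" for n
    using borel_closed[OF closed_weighted_cube] by blast
  then have "(\<Union>m::nat. weighted_cube (1 - 1 / (real n + 2)) m) \<in> sets borel" for n
    by (rule sets.countable_UN)
  then show ?thesis unfolding disk_coeffs_def by (intro sets.countable_INT) auto
qed

lemma disk_coeffsD:
  assumes "x \<in> disk_coeffs" "0 \<le> \<rho>" "\<rho> < 1"
  obtains C where "x \<in> weighted_cube \<rho> C"
proof -
  obtain n :: nat where n: "1 / (1 - \<rho>) < n" using reals_Archimedean2 by blast
  have "1 / (real n + 2) \<le> 1 - \<rho>"
  proof -
    have "1 < real n * (1 - \<rho>)" using n assms(3) by (simp add: divide_less_eq)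
    also have "\<dots> \<le> (real n + 2) * (1 - \<rho>)" using assms(3) by (intro mult_right_mono) auto
    finally show ?thesis by (simp add: divide_le_eq mult.commute)
  qed
  then have le: "\<rho> \<le> 1 - 1 / (real n + 2)" by simp
  obtain m :: nat where "x \<in> weighted_cube (1 - 1 / (real n + 2)) m"
    using assms(1) unfolding disk_coeffs_def by blast
  then show ?thesis by (rule that[OF weighted_cube_antimono[OF assms(2) le]])
qed

text \<open>The formula holds for every sequence. Outside \<open>disk_coeffs\<close> the function is
  either not holomorphic or equal to the nonzero constant \<open>c\<close>, so the measure vanishes;
  hence measurability requires no exceptional event.\<close>

lemma integral_zero_measure_power_series:
  fixes x :: "nat \<Rightarrow> complex" and c :: complex and g :: "complex \<Rightarrow> real"
  defines "f \<equiv> \<lambda>z. c - (\<Sum>k. x k * z ^ Suc k)"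
  assumes "c \<noteq> 0" and g: "continuous_on (ball 0 1) g"
    and K: "compact K" "\<And>z. z \<in> ball 0 1 - K \<Longrightarrow> g z = 0" "K \<subseteq> ball 0 \<rho>" and \<rho>: "0 < \<rho>" "\<rho> < 1"
  shows "(\<integral>z. g z \<partial>zero_measure f) = (if x \<in> disk_coeffs then zero_functional g \<rho> (cons_coeff c x) else 0)"
proof (cases "x \<in> disk_coeffs")
  case True
  have x0: "cons_coeff c x 0 \<noteq> 0" using \<open>c \<noteq> 0\<close> by (simp add: cons_coeff_def)
  have cube: "\<exists>C. x \<in> weighted_cube r C \<and> cons_coeff c x \<in> weighted_cube r (max (cmod c) C)" if r: "0 \<le> r" "r < 1" for r
  proof -
    obtain C where C: "x \<in> weighted_cube r C" by (rule disk_coeffsD[OF True r])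
    then have "cons_coeff c x \<in> weighted_cube r (max (cmod c) C)" using r by (intro cons_coeff_weighted_cube) auto
    with C show ?thesis by blast
  qed
  have f_eq: "f z = pser (cons_coeff c x) z" if z: "z \<in> ball 0 1" for z
  proof -
    define r where "r = (1 + cmod z) / 2"
    have r: "0 \<le> r" "r < 1" "z \<in> ball 0 r" using z by (auto simp: r_def)
    obtain C where C: "x \<in> weighted_cube r C" using cube[OF r(1,2)] by blast
    have "(\<lambda>k. x k * z ^ k * z) sums (pser x z * z)"
      by (rule sums_mult2[OF pser_sums[OF C r(3)]])
    then have s: "(\<lambda>k. x k * z ^ Suc k) sums (pser x z * z)" by (simp add: mult_ac)
    show ?thesis
      unfolding f_def pser_cons_coeff[OF s] using s by (simp add: sums_iff)
  qed
  have hol: "f holomorphic_on ball 0 1"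
  proof -
    have "(\<lambda>z. pser (cons_coeff c x) z) holomorphic_on (\<Union>r\<in>{0..<1}. ball 0 r)"
      using cube pser_holomorphic by (intro holomorphic_on_UN_open) auto
    moreover have "(\<Union>r\<in>{0..<1::real}. ball 0 r) = ball (0::complex) 1"
    proof (intro equalityI subsetI)
      fix z :: complex assume "z \<in> ball 0 1"
      then have "(1 + cmod z) / 2 \<in> {0..<1}" "z \<in> ball 0 ((1 + cmod z) / 2)" by auto
      then show "z \<in> (\<Union>r\<in>{0..<1}. ball 0 r)" by blast
    qed auto
    ultimately have "(\<lambda>z. pser (cons_coeff c x) z) holomorphic_on ball 0 1" by simp
    then show ?thesis by (rule holomorphic_transform) (simp add: f_eq)
  qed
  have "(\<integral>z. g z \<partial>zero_measure f) = zero_sum g (ball 0 \<rho>) (pser (cons_coeff c x))"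
  proof (rule integral_zero_measure[OF hol _ g K])
    have "f 0 \<noteq> 0" using \<open>c \<noteq> 0\<close> by (simp add: f_def)
    then show "\<exists>w\<in>ball 0 1. f w \<noteq> 0" by (intro bexI[of _ 0]) auto
    show "f z = pser (cons_coeff c x) z" if "z \<in> ball 0 \<rho>" for z using that \<rho> by (intro f_eq) auto
  qed (use \<rho> in auto)
  also have "\<dots> = zero_functional g \<rho> (cons_coeff c x)"
  proof -
    obtain C where "cons_coeff c x \<in> weighted_cube \<rho> (max (cmod c) C)" using cube[of \<rho>] \<rho> by auto
    then have "cons_coeff c x \<in> (\<Union>n::nat. weighted_cube \<rho> n)" by (rule weighted_cube_nat)
    moreover have "cons_coeff c x \<noteq> (\<lambda>_. 0)" using x0 by (rule contrapos_nn) simp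
    ultimately show ?thesis by (simp add: zero_functional_def)
  qed
  finally show ?thesis using True by simp
next
  case False
  then obtain n :: nat where n: "x \<notin> (\<Union>m::nat. weighted_cube (1 - 1 / (real n + 2)) m)"
    unfolding disk_coeffs_def by blast
  have not_cube: "x \<notin> weighted_cube (1 - 1 / (real n + 2)) C" for C
    using n weighted_cube_nat by blast
  have r: "0 < 1 - 1 / (real n + 2)" "1 - 1 / (real n + 2) < 1" by (simp_all add: field_simps)
  have "f w = c" if "f holomorphic_on ball 0 1" "w \<in> ball 0 1" for w
    using divergent_series_constant[OF r not_cube that(1)[unfolded f_def] that(2)] by (simp only: f_def)
  then have "(\<integral>z. g z \<partial>zero_measure f) = 0"
    using \<open>c \<noteq> 0\<close> by (intro zero_measure_eq_zero g) simp
  then show ?thesis using False by simp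
qed

text \<open>Lying outside all cubes of a given radius implies exceeding each size, so its
  probability is below every bound of order 1 / size^2 and is therefore 0. Countably many radii
  suffice.\<close>

lemma (in prob_space) AE_disk_coeffs:
  fixes X :: "'a \<Rightarrow> nat \<Rightarrow> complex"
  assumes mX: "\<And>k. (\<lambda>\<omega>. X \<omega> k) \<in> borel_measurable M"
    and int: "\<And>k. integrable M (\<lambda>\<omega>. (cmod (X \<omega> k))\<^sup>2)"
    and m: "\<And>k. expectation (\<lambda>\<omega>. (cmod (X \<omega> k))\<^sup>2) \<le> m"
  shows "AE \<omega> in M. X \<omega> \<in> disk_coeffs"
proof -
  have mX': "X \<in> borel_measurable M"
    using measurable_coordinatewise_then_product[of X M] mX by simp
  have "AE \<omega> in M. X \<omega> \<in> (\<Union>i::nat. weighted_cube \<rho> i)" if \<rho>: "0 < \<rho>" "\<rho> < 1" for \<rho>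
  proof -
    let ?E = "{\<omega> \<in> space M. X \<omega> \<notin> (\<Union>i::nat. weighted_cube \<rho> i)}"
    have "range (\<lambda>i::nat. weighted_cube \<rho> i) \<subseteq> sets borel"
      using borel_closed[OF closed_weighted_cube] by blast
    then have "- (\<Union>i::nat. weighted_cube \<rho> i) \<in> sets borel"
      by (intro borel_comp sets.countable_UN)
    from measurable_sets[OF mX' this] have E: "?E \<in> sets M"
      by (simp add: vimage_def Int_def conj_commute)
    let ?D = "m / (1 - \<rho>\<^sup>2)"
    have le: "prob ?E \<le> ?D / (real (Suc i))\<^sup>2" for i
    proof -
      have "?E \<subseteq> {\<omega> \<in> space M. \<exists>k. cmod (X \<omega> k) * \<rho> ^ k > real (Suc i)}"
        by (auto simp: weighted_cube_def not_le simp del: of_nat_Suc)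
      moreover have "{\<omega> \<in> space M. \<exists>k. cmod (X \<omega> k) * \<rho> ^ k > real (Suc i)} \<in> sets M"
        using mX by measurable
      ultimately have "prob ?E \<le> prob {\<omega> \<in> space M. \<exists>k. cmod (X \<omega> k) * \<rho> ^ k > real (Suc i)}"
        by (rule finite_measure_mono)
      also have "\<dots> \<le> ?D / (real (Suc i))\<^sup>2"
        by (rule prob_exists_large_coordinate[OF mX int m \<rho>]) simp
      finally show ?thesis .
    qed
    have "(\<lambda>i. ?D / (real (Suc i))\<^sup>2) \<longlonglongrightarrow> 0" by real_asymp
    then have "prob ?E \<le> 0" by (rule LIMSEQ_le_const) (use le in blast)
    then have "prob ?E = 0" using measure_nonneg[of M ?E] by linarith
    then have "?E \<in> null_sets M" using E by (auto simp: null_sets_def emeasure_eq_measure)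
    then show ?thesis by (rule AE_I') auto
  qed
  then have each: "AE \<omega> in M. X \<omega> \<in> (\<Union>i::nat. weighted_cube (1 - 1 / (real n + 2)) i)" for n :: nat
    by (simp add: field_simps)
  have "AE \<omega> in M. \<forall>n::nat. X \<omega> \<in> (\<Union>i::nat. weighted_cube (1 - 1 / (real n + 2)) i)"
    unfolding AE_all_countable by (intro allI each)
  then show ?thesis unfolding disk_coeffs_def by (auto elim: eventually_mono)
qed

text \<open>Continuous step functions squeeze the distribution function from both sides. The shift
  by \<open>Suc\<close> is needed since the laws are known to be probability measures from index 1
  on.\<close>

lemma conv_in_distributionI:
  fixes P :: "nat \<Rightarrow> 'a measure" and Q :: "'b measure"
  assumes P: "\<And>N. N \<ge> 1 \<Longrightarrow> prob_space (P N)" and Q: "prob_space Q"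
    and X: "\<And>N. N \<ge> 1 \<Longrightarrow> X N \<in> borel_measurable (P N)" and Y: "Y \<in> borel_measurable Q"
    and conv: "\<And>x y. x < y \<Longrightarrow> (\<lambda>N. \<integral>\<omega>. cts_step x y (X N \<omega>) \<partial>P N) \<longlonglongrightarrow> (\<integral>\<omega>. cts_step x y (Y \<omega>) \<partial>Q)"
  shows "conv_in_distribution P X Q Y"
proof -
  have dP: "real_distribution (distr (P (Suc n)) borel (X (Suc n)))" for n
    using prob_space.real_distribution_distr[OF P X, of "Suc n"] by simp
  have dQ: "real_distribution (distr Q borel Y)"
    by (rule prob_space.real_distribution_distr[OF Q Y])
  have "weak_conv_m (\<lambda>n. distr (P (Suc n)) borel (X (Suc n))) (distr Q borel Y)"
  proof (rule integral_cts_step_conv_imp_weak_conv[OF dP dQ])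
    fix x y :: real assume xy: "x < y"
    note mc = borel_measurable_continuous_onI[OF cts_step_continuous[OF xy]]
    have "integral\<^sup>L (distr (P (Suc n)) borel (X (Suc n))) (cts_step x y) = (\<integral>\<omega>. cts_step x y (X (Suc n) \<omega>) \<partial>P (Suc n))" for n
      by (rule integral_distr[OF X mc]) simp
    moreover have "integral\<^sup>L (distr Q borel Y) (cts_step x y) = (\<integral>\<omega>. cts_step x y (Y \<omega>) \<partial>Q)"
      by (rule integral_distr[OF Y mc])
    ultimately show "(\<lambda>n. integral\<^sup>L (distr (P (Suc n)) borel (X (Suc n))) (cts_step x y)) \<longlonglongrightarrow> integral\<^sup>L (distr Q borel Y) (cts_step x y)"
      using LIMSEQ_Suc[OF conv[OF xy]] by (simp only:)
  qed
  then have "weak_conv_m (\<lambda>N. distr (P N) borel (X N)) (distr Q borel Y)"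
    unfolding weak_conv_m_def weak_conv_def by (blast intro: LIMSEQ_imp_Suc)
  then show ?thesis using X Y by (simp add: conv_in_distribution_def)
qed

text \<open>Since an average cannot be further away from \<open>L\<close> than all averaged values, it suffices to
  control a suitable deterministic value of the independent variable.\<close>

lemma (in prob_space) exists_value_further_from:
  fixes f :: "'b \<times> 'c \<Rightarrow> real" and L :: real
  assumes ind: "(\<exists>u. \<forall>\<omega>\<in>space M. Y \<omega> = u) \<or> indep_rv M S X T Y"
    and f: "f \<in> borel_measurable (S \<Otimes>\<^sub>M T)" and B: "\<And>p. \<bar>f p\<bar> \<le> B"
  shows "\<exists>\<omega>0\<in>space M. \<bar>expectation (\<lambda>\<omega>. f (X \<omega>, Y \<omega>)) - L\<bar> \<le> \<bar>expectation (\<lambda>\<omega>. f (X \<omega>, Y \<omega>0)) - L\<bar>"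
  using ind
proof
  assume "\<exists>u. \<forall>\<omega>\<in>space M. Y \<omega> = u"
  then obtain u where u: "\<And>\<omega>. \<omega> \<in> space M \<Longrightarrow> Y \<omega> = u" by blast
  obtain \<omega>0 where w: "\<omega>0 \<in> space M" using not_empty by blast
  have "expectation (\<lambda>\<omega>. f (X \<omega>, Y \<omega>)) = expectation (\<lambda>\<omega>. f (X \<omega>, Y \<omega>0))"
    by (rule Bochner_Integration.integral_cong[OF refl]) (simp add: u w)
  then show ?thesis using w by (intro bexI[of _ \<omega>0]) auto
next
  assume "indep_rv M S X T Y"
  \<comment> \<open>\<open>Y\<close> is the variable to be frozen, so it has to be the outer one in
    the iterated expectation.\<close>
  then have ind: "indep_rv M T Y S X" by (rule indep_rv_sym)
  define h where "h \<omega> = expectation (\<lambda>\<omega>'. f (X \<omega>', Y \<omega>))" for \<omega>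
  have f': "(\<lambda>p. f (snd p, fst p)) \<in> borel_measurable (T \<Otimes>\<^sub>M S)"
    using measurable_compose[OF measurable_pair_swap' f] by (simp add: case_prod_beta)
  have E: "expectation (\<lambda>\<omega>. f (X \<omega>, Y \<omega>)) = expectation h"
    using indep_rv_integral(1)[OF ind f', of B] B by (simp add: h_def[abs_def])
  have mh: "h \<in> borel_measurable M"
    using indep_rv_integral(2)[OF ind f', of B] B by (simp add: h_def[abs_def])
  have hb: "\<bar>h \<omega>\<bar> \<le> B" for \<omega>
  proof -
    have "\<bar>h \<omega>\<bar> \<le> expectation (\<lambda>\<omega>'. \<bar>f (X \<omega>', Y \<omega>)\<bar>)" unfolding h_def by (rule integral_abs_bound)
    also have "\<dots> \<le> expectation (\<lambda>_. B)"
      by (rule integral_mono_AE') (use B order_trans[OF abs_ge_zero B] in auto)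
    finally show ?thesis by (simp add: prob_space)
  qed
  have ih: "integrable M h" by (rule integrable_const_bound[of _ B, OF _ mh]) (simp add: hb)
  show ?thesis
  proof (rule ccontr)
    assume "\<not> ?thesis"
    then have less: "\<bar>h \<omega> - L\<bar> < \<bar>expectation h - L\<bar>" if "\<omega> \<in> space M" for \<omega>
      using that unfolding E h_def by (simp add: not_le)
    have "expectation h - L = expectation (\<lambda>\<omega>. h \<omega> - L)" using ih by (simp add: prob_space)
    then have "\<bar>expectation h - L\<bar> \<le> expectation (\<lambda>\<omega>. \<bar>h \<omega> - L\<bar>)" by (simp add: integral_abs_bound)
    also have "\<dots> < \<bar>expectation h - L\<bar>"
      by (rule expectation_less) (use ih less in auto)
    finally show False by simp
  qed
qed

theorem theorem3:
  fixes a :: complex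
    and P :: "nat \<Rightarrow> 'a measure"
    and V :: "nat \<Rightarrow> 'a \<Rightarrow> complex mat"
    and Z :: "nat \<Rightarrow> nat \<Rightarrow> 'a \<Rightarrow> complex"
    and v :: "nat \<Rightarrow> 'a \<Rightarrow> complex vec"
    and D M A :: "nat \<Rightarrow> 'a \<Rightarrow> complex mat"
    and Q :: "'b measure"
    and c :: "nat \<Rightarrow> 'b \<Rightarrow> complex"
    and \<phi> :: "'b \<Rightarrow> complex \<Rightarrow> complex"
  defines "D \<equiv> \<lambda>N \<omega>. mat_diag N (\<lambda>i. Z N i \<omega>)"
    and "M \<equiv> \<lambda>N \<omega>. V N \<omega> * D N \<omega> * mat_adjoint (V N \<omega>)"
    and "A \<equiv> \<lambda>N \<omega>. 1\<^sub>m N -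
           (1 - a * complex_of_real (real N powr (- 1 / 2))) \<cdot>\<^sub>m outer_self (v N \<omega>)"
    and "\<phi> \<equiv> \<lambda>\<omega> z. a / complex_of_real (sqrt 2) - (\<Sum>k. c (Suc k) \<omega> * z ^ Suc k)"
  assumes "a \<noteq> 0"
    and "prob_space Q"
    and "\<And>k. k \<ge> 1 \<Longrightarrow> std_complex_gaussian Q (c k)"
    and "prob_space.indep_vars Q (\<lambda>_. borel) c {1..}"
    and "\<And>N. N \<ge> 1 \<Longrightarrow> prob_space (P N)"
    and "\<And>N. N \<ge> 1 \<Longrightarrow> V N \<in> measurable (P N) (unitary_borel N)"
    and "\<And>N. N \<ge> 1 \<Longrightarrow> haar_unitary N (distr (P N) (unitary_borel N) (V N))"
    and "\<And>N. N \<ge> 1 \<Longrightarrow> prob_space.indep_vars (P N) (\<lambda>_. borel) (Z N) {..<N}"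
    and "\<And>N i. i < N \<Longrightarrow> distr (P N) borel (Z N i) = distr (P N) borel (Z N 0)"
    and "\<And>N i \<omega>. i < N \<Longrightarrow> \<omega> \<in> space (P N) \<Longrightarrow> cmod (Z N i \<omega>) = 1"
    and "\<And>N. N \<ge> 1 \<Longrightarrow>
           prob_space.indep_var (P N) (unitary_borel N) (V N) (mat_borel N) (D N)"
    and "\<And>N. N \<ge> 1 \<Longrightarrow> AE \<omega> in P N. simple_spectrum (D N \<omega>)"
    and "\<And>b :: int. (\<lambda>N. SUP k\<in>{1..}. cmod (\<integral>\<omega>. Z N 0 \<omega> ^ k \<partial>P N))
           \<in> o(\<lambda>N. real N powi (- b))"
    and "\<And>N. N \<ge> 1 \<Longrightarrow> v N \<in> measurable (P N) (sphere_borel N)"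
    and "\<And>N. N \<ge> 1 \<Longrightarrow>
           (\<exists>u. \<forall>\<omega>\<in>space (P N). v N \<omega> = u) \<or>
           (indep_rv (P N) (mat_borel N) (M N) (sphere_borel N) (v N) \<and>
            (\<exists>f. distributed (P N) (uniform_sphere N) (v N) f \<and> (\<forall>x\<in>unit_sphere N. f x \<noteq> 0)))"
  shows "vague_conv_disk P (\<lambda>N \<omega>. eigenvalue_measure (M N \<omega> * A N \<omega>))
           Q (\<lambda>\<omega>. zero_measure (\<phi> \<omega>))"
proof -
  let ?c = "a / complex_of_real (sqrt 2)"
  have c0: "?c \<noteq> 0" using assms(5) by simp
  note Q = assms(6) and cg = assms(7) and cind = assms(8) and P = assms(9) and mV = assms(10) and haar = assms(11)
    and indZ = assms(12) and lawZ = assms(13) and normZ = assms(14) and indVD = assms(15) and momZ = assms(17)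
    and mv = assms(18) and vcase = assms(19)
  define \<delta> where "\<delta> N = (SUP k\<in>{1..}. cmod (\<integral>\<omega>. Z N 0 \<omega> ^ k \<partial>P N))" for N
  have VU: "V N \<omega> \<in> unitary_group N" if "N \<ge> 1" "\<omega> \<in> space (P N)" for N \<omega>
    using measurable_space[OF mV[OF that(1)] that(2)] by simp
  have vS: "v N \<omega> \<in> unit_sphere N" if "N \<ge> 1" "\<omega> \<in> space (P N)" for N \<omega>
    using measurable_space[OF mv[OF that(1)] that(2)] by simp
  have M_eq: "M N \<omega> = V N \<omega> * mat_diag N (\<lambda>i. Z N i \<omega>) * mat_adjoint (V N \<omega>)" for N \<omega>
    by (simp add: M_def D_def)
  \<comment> \<open>Established for a deterministic unit vector; the random vector is frozen before
    this is applied.\<close>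
  have W: "weighted_unit_sum (P N) N (\<lambda>\<omega>. adjoint_apply N (V N \<omega>) u) (Z N) (\<delta> N)"
    if N: "N \<ge> 1" and u: "u \<in> unit_sphere N" for N u
  proof -
    interpret prob_space "P N" by (rule P[OF N])
    have mZ: "Z N i \<in> borel_measurable (P N)" if "i < N" for i
      using indZ[OF N] that by (auto simp: indep_vars_def)
    have rot: "rotation_invariant_vector (P N) N (\<lambda>\<omega>. adjoint_apply N (V N \<omega>) u)"
      using N by (intro haar_vector_rotation_invariant P mV haar u) auto
    have mom: "cmod (expectation (\<lambda>\<omega>. Z N 0 \<omega> ^ k)) \<le> \<delta> N" if "k \<ge> 1" for k
      unfolding \<delta>_def
    proof (rule cSUP_upper)
      show "k \<in> {1..}" using that by simp
      \<comment> \<open>Boundedness by 1 makes the supremum defining \<open>\<delta> N\<close> an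
        actual upper bound.\<close>
      have "cmod (expectation (\<lambda>\<omega>. Z N 0 \<omega> ^ l)) \<le> 1" for l
      proof -
        have "cmod (expectation (\<lambda>\<omega>. Z N 0 \<omega> ^ l)) \<le> expectation (\<lambda>\<omega>. cmod (Z N 0 \<omega> ^ l))"
          by (rule integral_norm_bound)
        also have "\<dots> = expectation (\<lambda>\<omega>. 1)"
          using N by (intro Bochner_Integration.integral_cong refl) (simp add: norm_power normZ)
        finally show ?thesis by (simp add: prob_space)
      qed
      then show "bdd_above ((\<lambda>k. cmod (expectation (\<lambda>\<omega>. Z N 0 \<omega> ^ k))) ` {1..})"
        by (intro bdd_aboveI[of _ 1]) auto
    qed
    have ind: "indep_rv (P N) (PiM {..<N} (\<lambda>_. borel)) (\<lambda>\<omega>. \<lambda>j\<in>{..<N}. adjoint_apply N (V N \<omega>) u j)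
       (PiM {..<N} (\<lambda>_. borel)) (\<lambda>\<omega>. \<lambda>j\<in>{..<N}. Z N j \<omega>)"
    proof -
      have f: "(\<lambda>X. \<lambda>j\<in>{..<N}. adjoint_apply N X u j) \<in> measurable (unitary_borel N) (PiM {..<N} (\<lambda>_. borel))"
        by (intro measurable_restrict measurable_adjoint_apply) simp
      have g: "(\<lambda>X. \<lambda>j\<in>{..<N}. X $$ (j, j)) \<in> measurable (mat_borel N) (PiM {..<N} (\<lambda>_. borel))"
        by (intro measurable_restrict measurable_mat_entry) auto
      have "(\<lambda>j\<in>{..<N}. D N \<omega> $$ (j, j)) = (\<lambda>j\<in>{..<N}. Z N j \<omega>)" for \<omega>
        by (rule restrict_ext) (simp add: D_def mat_diag_def)
      then show ?thesis
        using indep_rv_compose[OF indep_var_imp_indep_rv[OF indVD[OF N]] f g] by (simp only:)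
    qed
    show ?thesis
      by (intro weighted_unit_sum.intro rot weighted_unit_sum_axioms.intro indZ[OF N] lawZ normZ mom ind)
  qed
  \<comment> \<open>The moment hypothesis is taken with \<open>b = 1\<close>: then
    \<open>sqrt N * \<delta> N\<close> is small compared with \<open>sqrt N / N\<close>.\<close>
  have \<delta>lim: "(\<lambda>N. sqrt N * \<delta> N) \<longlonglongrightarrow> 0"
  proof -
    have "\<delta> \<in> o(\<lambda>N. real N powi (- 1))" unfolding \<delta>_def[abs_def] by (rule momZ)
    then have "(\<lambda>N. sqrt N * \<delta> N) \<in> o(\<lambda>N. sqrt N * real N powi (- 1))"
      by (rule landau_o.small.mult_left)
    also have "(\<lambda>N. sqrt N * real N powi (- 1)) = (\<lambda>N. sqrt N / real N)"
      by (simp add: power_int_minus divide_inverse)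
    also have "(\<lambda>N. sqrt N / real N) \<in> O(\<lambda>N. 1)" by real_asymp
    finally show ?thesis by (rule smalloD_tendsto[of _ _ "\<lambda>_. 1", simplified])
  qed
  define s where "s N = 1 - a * complex_of_real (real N powr (- 1 / 2))" for N
  have slim: "s \<longlonglongrightarrow> 1"
  proof -
    have "(\<lambda>N. real N powr (- 1 / 2)) \<longlonglongrightarrow> 0" by real_asymp
    then have "(\<lambda>N. 1 - a * complex_of_real (real N powr (- 1 / 2))) \<longlonglongrightarrow> 1 - a * complex_of_real 0"
      by (intro tendsto_intros)
    then show ?thesis by (simp add: s_def[abs_def])
  qed
  have mM: "M N \<in> measurable (P N) (mat_borel N)" if N: "N \<ge> 1" for N
  proof (rule measurable_mat_borelI)
    show "M N \<omega> \<in> carrier_mat N N" if "\<omega> \<in> space (P N)" for \<omega>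
      unfolding M_eq using unitary_groupD(1,2)[OF VU[OF N that]]
      by (intro mult_carrier_mat[of _ N N] mat_diag_dim)
    fix i j assume ij: "i < N" "j < N"
    have V: "(\<lambda>\<omega>. V N \<omega> $$ (p, q)) \<in> borel_measurable (P N)" if "p < N" "q < N" for p q
      by (rule measurable_compose[OF mV[OF N] measurable_unitary_entry[OF that]])
    have mZ: "Z N p \<in> borel_measurable (P N)" if "p < N" for p
      using indZ[OF N] that by (auto simp: prob_space.indep_vars_def[OF P[OF N]])
    have "(\<lambda>\<omega>. \<Sum>p<N. V N \<omega> $$ (i, p) * Z N p \<omega> * cnj (V N \<omega> $$ (j, p))) \<in> borel_measurable (P N)"
      using ij by (intro borel_measurable_sum borel_measurable_times V mZ measurable_compose[OF V borel_measurable_cnj]) auto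
    also have "?this \<longleftrightarrow> (\<lambda>\<omega>. M N \<omega> $$ (i, j)) \<in> borel_measurable (P N)"
      unfolding M_eq by (rule measurable_cong) (simp only: conjugated_diag_index[OF VU[OF N] ij])
    finally show "(\<lambda>\<omega>. M N \<omega> $$ (i, j)) \<in> borel_measurable (P N)" .
  qed
  show ?thesis
    unfolding vague_conv_disk_def
  proof (intro allI impI)
    fix g :: "complex \<Rightarrow> real"
    assume g: "continuous_on (ball 0 1) g" and "\<exists>K. compact K \<and> K \<subseteq> ball 0 1 \<and> (\<forall>z\<in>ball 0 1 - K. g z = 0)"
    then obtain K where K: "compact K" "K \<subseteq> ball 0 1" "\<And>z. z \<in> ball 0 1 - K \<Longrightarrow> g z = 0" by blast
    \<comment> \<open>The largest modulus on the compact set \<open>K\<close> is below 1, and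
      \<open>\<rho>\<close> is put halfway between it and 1.\<close>
    obtain \<rho> where \<rho>: "0 < \<rho>" "\<rho> < 1" and K\<rho>: "K \<subseteq> ball 0 \<rho>"
    proof (cases "K = {}")
      case True
      then show ?thesis using that[of "1/2"] by simp
    next
      case False
      have "continuous_on K cmod" by (intro continuous_intros)
      from continuous_attains_sup[OF K(1) False this] obtain z0 where z0: "z0 \<in> K" "\<And>z. z \<in> K \<Longrightarrow> cmod z \<le> cmod z0" by blast
      have "cmod z0 < 1" using z0(1) K(2) by auto
      moreover have "K \<subseteq> ball 0 ((1 + cmod z0) / 2)"
        using z0(2) \<open>cmod z0 < 1\<close> by (force simp: field_simps)
      ultimately show ?thesis by (intro that[of "(1 + cmod z0) / 2"]) (auto simp: add_pos_nonneg)
    qed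
    have sub: "ball (0::complex) \<rho> \<subseteq> ball 0 1" using \<rho> by auto
    have g\<rho>: "continuous_on (ball 0 \<rho>) g" using g sub by (rule continuous_on_subset)
    have K0: "g z = 0" if "z \<in> ball 0 \<rho> - K" for z using K(3) that sub by blast
    note zf = zero_functional_cons_measurable[OF \<rho>(1) g\<rho> K(1) K\<rho> K0]
    let ?coeff = "\<lambda>N p. perturbation_coeff a N (fst p) (snd p)"
    have mcoeff: "?coeff N \<in> borel_measurable (mat_borel N \<Otimes>\<^sub>M sphere_borel N)" for N
    proof (rule measurable_coordinatewise_then_product)
      show "(\<lambda>p. ?coeff N p k) \<in> borel_measurable (mat_borel N \<Otimes>\<^sub>M sphere_borel N)" for k
        unfolding perturbation_coeff_def
        by (intro borel_measurable_times spectral_moment_measurable) auto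
    qed
    have eig: "(\<integral>z. g z \<partial>eigenvalue_measure (M N \<omega> * A N \<omega>)) =
        zero_functional g \<rho> (cons_coeff ?c (?coeff N (M N \<omega>, v N \<omega>)))" if N: "N \<ge> 1" and \<omega>: "\<omega> \<in> space (P N)" for N \<omega>
      unfolding M_eq A_def fst_conv snd_conv
      by (rule integral_eigenvalue_measure_perturbed[OF VU[OF N \<omega>] vS[OF N \<omega>] _ _ assms(5) g K(3) K\<rho> \<rho>])
        (use N \<omega> normZ in auto)
    have mMv: "(\<lambda>\<omega>. (M N \<omega>, v N \<omega>)) \<in> measurable (P N) (mat_borel N \<Otimes>\<^sub>M sphere_borel N)" if "N \<ge> 1" for N
      using mM[OF that] mv[OF that] by (rule measurable_Pair)
    have lim: "(\<integral>z. g z \<partial>zero_measure (\<phi> \<omega>)) =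
        (if (\<lambda>k. c (Suc k) \<omega>) \<in> disk_coeffs then zero_functional g \<rho> (cons_coeff ?c (\<lambda>k. c (Suc k) \<omega>)) else 0)" for \<omega>
      unfolding \<phi>_def by (rule integral_zero_measure_power_series[OF c0 g K(1,3) K\<rho> \<rho>])
    have mc: "(\<lambda>\<omega>. c (Suc k) \<omega>) \<in> borel_measurable Q" for k
      using distr_std_complex_gaussian(1)[OF cg[of "Suc k"]] by simp
    have mC: "(\<lambda>\<omega>. (\<lambda>k. c (Suc k) \<omega>)) \<in> borel_measurable Q"
      by (rule measurable_coordinatewise_then_product) (rule mc)
    have AEc: "AE \<omega> in Q. (\<lambda>k. c (Suc k) \<omega>) \<in> disk_coeffs"
      by (rule prob_space.AE_disk_coeffs[OF Q mc])
        (auto simp: integrable_std_complex_gaussian_square[OF cg])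
    show "conv_in_distribution P (\<lambda>N \<omega>. \<integral>z. g z \<partial>eigenvalue_measure (M N \<omega> * A N \<omega>)) Q (\<lambda>\<omega>. \<integral>z. g z \<partial>zero_measure (\<phi> \<omega>))"
    proof (rule conv_in_distributionI[OF P Q])
      show "(\<lambda>\<omega>. \<integral>z. g z \<partial>eigenvalue_measure (M N \<omega> * A N \<omega>)) \<in> borel_measurable (P N)" if N: "N \<ge> 1" for N
      proof -
        have "(\<lambda>\<omega>. zero_functional g \<rho> (cons_coeff ?c (?coeff N (M N \<omega>, v N \<omega>)))) \<in> borel_measurable (P N)"
          by (rule measurable_compose[OF mMv[OF N] measurable_compose[OF mcoeff zf]])
        then show ?thesis by (subst measurable_cong[OF eig[OF N]])
      qed
      show mY: "(\<lambda>\<omega>. \<integral>z. g z \<partial>zero_measure (\<phi> \<omega>)) \<in> borel_measurable Q"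
        unfolding lim
      proof (rule measurable_If)
        show "(\<lambda>\<omega>. zero_functional g \<rho> (cons_coeff ?c (\<lambda>k. c (Suc k) \<omega>))) \<in> borel_measurable Q"
          by (rule measurable_compose[OF mC zf])
        show "{\<omega> \<in> space Q. (\<lambda>k. c (Suc k) \<omega>) \<in> disk_coeffs} \<in> sets Q"
          using measurable_sets[OF mC disk_coeffs_measurable] by (simp add: vimage_def Int_def conj_commute)
      qed simp
      fix x y :: real assume xy: "x < y"
      let ?F = "step_functional g \<rho> ?c x y"
      let ?L = "\<integral>\<omega>. ?F (\<lambda>k. c (Suc k) \<omega>) \<partial>Q"
      have mF: "?F \<in> borel_measurable borel"
        by (rule step_functional_measurable[OF \<rho>(1) g\<rho> K(1) K\<rho> K0 xy])
      have bF: "\<bar>?F X\<bar> \<le> 1" for X unfolding step_functional_def by (rule cts_step_bounded[OF xy])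
      \<comment> \<open>The two integrands differ only where the coefficients leave
        \<open>disk_coeffs\<close>, which is a null event.\<close>
      have L_eq: "(\<integral>\<omega>. cts_step x y (\<integral>z. g z \<partial>zero_measure (\<phi> \<omega>)) \<partial>Q) = ?L"
      proof (rule integral_cong_AE)
        show "(\<lambda>\<omega>. cts_step x y (\<integral>z. g z \<partial>zero_measure (\<phi> \<omega>))) \<in> borel_measurable Q"
          by (rule measurable_compose[OF mY borel_measurable_continuous_onI[OF cts_step_continuous[OF xy]]])
        show "(\<lambda>\<omega>. ?F (\<lambda>k. c (Suc k) \<omega>)) \<in> borel_measurable Q" by (rule measurable_compose[OF mC mF])
        show "AE \<omega> in Q. cts_step x y (\<integral>z. g z \<partial>zero_measure (\<phi> \<omega>)) = ?F (\<lambda>k. c (Suc k) \<omega>)"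
          using AEc by eventually_elim (simp add: lim step_functional_def)
      qed
      \<comment> \<open>\<open>H N u\<close> is the expectation with the vector frozen at
        \<open>u\<close>. For each \<open>N\<close> some value of \<open>v N\<close> gives an
        expectation at least as far from \<open>?L\<close> as the true one, so convergence along
        these deterministic vectors suffices.\<close>
      define H where "H N u = (\<integral>\<omega>. ?F (?coeff N (M N \<omega>, u)) \<partial>P N)" for N u
      have "\<exists>u. u \<in> unit_sphere N \<and> \<bar>(\<integral>\<omega>. ?F (?coeff N (M N \<omega>, v N \<omega>)) \<partial>P N) - ?L\<bar> \<le> \<bar>H N u - ?L\<bar>" if N: "N \<ge> 1" for N
      proof -
        interpret prob_space "P N" by (rule P[OF N])
        have "(\<exists>u. \<forall>\<omega>\<in>space (P N). v N \<omega> = u) \<or> indep_rv (P N) (mat_borel N) (M N) (sphere_borel N) (v N)"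
          using vcase[OF N] by blast
        from exists_value_further_from[OF this measurable_compose[OF mcoeff mF] bF, of ?L]
        obtain \<omega>0 where "\<omega>0 \<in> space (P N)"
          "\<bar>(\<integral>\<omega>. ?F (?coeff N (M N \<omega>, v N \<omega>)) \<partial>P N) - ?L\<bar> \<le> \<bar>H N (v N \<omega>0) - ?L\<bar>"
          unfolding H_def by blast
        then show ?thesis using vS[OF N] by blast
      qed
      then have "\<forall>N\<in>{1..}. \<exists>u. u \<in> unit_sphere N \<and> \<bar>(\<integral>\<omega>. ?F (?coeff N (M N \<omega>, v N \<omega>)) \<partial>P N) - ?L\<bar> \<le> \<bar>H N u - ?L\<bar>"
        by simp
      from bchoice[OF this] obtain u where u: "\<And>N. N \<ge> 1 \<Longrightarrow> u N \<in> unit_sphere N"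
        and further: "\<And>N. N \<ge> 1 \<Longrightarrow> \<bar>(\<integral>\<omega>. ?F (?coeff N (M N \<omega>, v N \<omega>)) \<partial>P N) - ?L\<bar> \<le> \<bar>H N (u N) - ?L\<bar>"
        by auto
      have ev1: "\<forall>\<^sub>F N in sequentially. N \<ge> (1::nat)" by (rule eventually_ge_at_top)
      have "(\<lambda>N. \<integral>\<omega>. ?F (\<lambda>k. s N * sqrt N / sqrt 2 * (\<Sum>j<N. (cmod (adjoint_apply N (V N \<omega>) (u N) j))\<^sup>2 * cnj (Z N j \<omega>) ^ Suc k)) \<partial>P N) \<longlonglongrightarrow> ?L"
        by (rule gaussian_limit[where U = "\<lambda>N \<omega>. adjoint_apply N (V N \<omega>) (u N)", OF W[OF _ u] \<delta>lim slim Q cg cind \<rho> _ mF bF])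
          (use \<rho> in \<open>auto intro!: step_functional_continuous[OF _ _ g\<rho> K(1) K\<rho> K0 xy c0]\<close>)
      moreover have "\<forall>\<^sub>F N in sequentially. (\<integral>\<omega>. ?F (\<lambda>k. s N * sqrt N / sqrt 2 * (\<Sum>j<N. (cmod (adjoint_apply N (V N \<omega>) (u N) j))\<^sup>2 * cnj (Z N j \<omega>) ^ Suc k)) \<partial>P N) = H N (u N)"
        using ev1
      proof eventually_elim
        case (elim N)
        show ?case unfolding H_def
        proof (rule Bochner_Integration.integral_cong[OF refl])
          fix \<omega> assume \<omega>: "\<omega> \<in> space (P N)"
          have "?coeff N (M N \<omega>, u N) = (\<lambda>k. s N * sqrt N / sqrt 2 * (\<Sum>j<N. (cmod (adjoint_apply N (V N \<omega>) (u N) j))\<^sup>2 * cnj (Z N j \<omega>) ^ Suc k))"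
            unfolding M_eq fst_conv snd_conv perturbation_coeff_def s_def spectral_moment_conjugated_diag[OF VU[OF elim \<omega>]] ..
          then show "?F (\<lambda>k. s N * sqrt N / sqrt 2 * (\<Sum>j<N. (cmod (adjoint_apply N (V N \<omega>) (u N) j))\<^sup>2 * cnj (Z N j \<omega>) ^ Suc k)) = ?F (?coeff N (M N \<omega>, u N))"
            by (simp only:)
        qed
      qed
      ultimately have "(\<lambda>N. H N (u N)) \<longlonglongrightarrow> ?L" by (rule Lim_transform_eventually)
      then have "(\<lambda>N. \<bar>H N (u N) - ?L\<bar>) \<longlonglongrightarrow> 0" by (simp only: LIM_zero_iff tendsto_rabs_zero_iff)
      then have "(\<lambda>N. (\<integral>\<omega>. ?F (?coeff N (M N \<omega>, v N \<omega>)) \<partial>P N) - ?L) \<longlonglongrightarrow> 0"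
        by (rule Lim_null_comparison[rotated]) (use ev1 in eventually_elim, simp only: real_norm_def, rule further)
      then have "(\<lambda>N. \<integral>\<omega>. ?F (?coeff N (M N \<omega>, v N \<omega>)) \<partial>P N) \<longlonglongrightarrow> ?L"
        by (simp only: LIM_zero_iff)
      moreover have "\<forall>\<^sub>F N in sequentially. (\<integral>\<omega>. ?F (?coeff N (M N \<omega>, v N \<omega>)) \<partial>P N) =
          (\<integral>\<omega>. cts_step x y (\<integral>z. g z \<partial>eigenvalue_measure (M N \<omega> * A N \<omega>)) \<partial>P N)"
        using ev1
      proof eventually_elim
        case (elim N)
        show ?case
          by (rule Bochner_Integration.integral_cong[OF refl]) (simp only: step_functional_def eig[OF elim])
      qed
      ultimately show "(\<lambda>N. \<integral>\<omega>. cts_step x y (\<integral>z. g z \<partial>eigenvalue_measure (M N \<omega> * A N \<omega>)) \<partial>P N)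
          \<longlonglongrightarrow> (\<integral>\<omega>. cts_step x y (\<integral>z. g z \<partial>zero_measure (\<phi> \<omega>)) \<partial>Q)"
        unfolding L_eq by (rule Lim_transform_eventually)
    qed
  qed
qed

end
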